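(* (Spin Molien's formula) Let $W$ be a Weyl group with irreducible reflection representation $V$, and let $\chi^-$ be a simple $\mathbb{C}W^-$-character. Then the graded multiplicity $H_W^-(\chi^-,t)=\sum_k\dim\mathrm{Hom}_{\mathbb{C}W^-}(\chi^-,\mathcal B_W\otimes S^kV)\,t^k$ of $\chi^-$ in the $\mathbb{C}W^-$-module $\mathcal B_W\otimes S^*V$ is $$H_W^-(\chi^-,t)=\sum_{\langle x\rangle\in W_*^{\mathrm{es}}}\frac{\chi^-(\tilde x)\,\mathrm{tr}(\tilde x)|_{\mathcal B_W}}{|C_x|\,\det(1-tx)},$$ where $W_*^{\mathrm{es}}$ is the set of even split conjugacy classes of $W$, $\tilde x\in\widetilde W$ is chosen such that $x=\theta(\tilde x)$, $C_x$ is the centralizer of $x$ in $W$, and $\det(1-tx)$ is computed on $V$.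
   Context: Let $W$ be a Weyl group with Coxeter presentation $\langle s_1,\dots,s_n\mid (s_is_j)^{m_{ij}}=1\rangle$ ($m_{ii}=1$, $m_{ij}=m_{ji}\ge 2$ for $i\ne j$), and let $V$ be its (complex, $n$-dimensional) irreducible reflection representation, with a $W$-invariant nondegenerate symmetric bilinear form $(\cdot,\cdot)$ (positive definite on the real span of the roots). Double cover: $1\to\{1,z\}\to\widetilde W\xrightarrow{\theta}W\to1$ is the central extension in which $\widetilde W$ is generated by $z$ and $\tilde t_1,\dots,\tilde t_n$ with $z$ central, $z^2=1$, $(\tilde t_i\tilde t_j)^{m_{ij}}=z^{m_{ij}+1}$, and $\theta(\tilde t_i)=s_i$. The spin Weyl group algebra $\mathbb{C}W^-$ is the quotient of $\mathbb{C}\widetilde W$ by the ideal generated by $z+1$; it is generated by the images $t_i$ of $\tilde t_i$, with relations $(t_it_j)^{m_{ij}}=(-1)^{m_{ij}+1}$, and is a superalgebra with each $t_i$ odd. Thus $\mathbb CW^-$-characters are evaluated on elements of $\widetilde W$. Parity on $W$ (and on $\widetilde W$ via $\theta$): each generator $s_i$ is odd. A conjugacy class $\langle x\rangle$ of $W$ is split if $\theta^{-1}(\langle x\rangle)$ is a union of two conjugacy classes of $\widetilde W$, equivalently if a lift $\tilde x$ is not conjugate to $z\tilde x$; it is even split if it is split and $x$ is even. Modules over a superalgebra $A$ are $\mathbb{Z}_2$-graded, $M=M_{\bar0}\oplus M_{\bar1}$ with $A_iM_j\subseteq M_{i+j}$; homomorphisms may be even or odd (or sums of these), so $\dim\mathrm{Hom}_A(M,N)$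 equals the dimension of the space of $A$-linear maps between the underlying ungraded modules. A simple $\mathbb{C}W^-$-character is the (ordinary trace) character of a simple $\mathbb Z_2$-graded module, and is identified with that module. Basic spin module: let $\mathcal{C}l_V$ be the Clifford algebra of $(V,(\cdot,\cdot))$, with $v^2=(v,v)$ for $v\in V$ and $V$ odd. The assignment $t_i\mapsto \alpha_i/\sqrt{(\alpha_i,\alpha_i)}$, $\alpha_i$ the simple root of $s_i$, is a superalgebra homomorphism $\mathbb{C}W^-\to\mathcal{C}l_V$; the basic spin module $\mathcal B_W$ is the pullback of the unique simple $\mathcal{C}l_V$-module. If $M$ is a $\mathbb{C}W^-$-module and $U$ a $\mathbb{C}W$-module, $M\otimes U$ is a $\mathbb{C}W^-$-module via $t_i(m\otimes u)=t_im\otimes s_iu$. *)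

theory Defs
  imports
    "HOL-Analysis.Analysis"
    "HOL-Algebra.QuotRing"
    "HOL-Algebra.Generated_Groups"
    "HOL-Computational_Algebra.Formal_Power_Series"
    "HOL-Library.Poly_Mapping"
    "HOL-Library.Function_Algebras"
    "HOL-Library.Z2"
begin

section \<open>Groups given by generators and relations\<close>

text \<open>A letter \<open>(x, True)\<close> stands for the generator \<open>x\<close>, and \<open>(x, False)\<close> for its inverse.\<close>

type_synonym 'g word = "('g \<times> bool) list"

inductive pres_eq :: "('g word \<times> 'g word) set \<Rightarrow> 'g word \<Rightarrow> 'g word \<Rightarrow> bool"
  for R :: "('g word \<times> 'g word) set" where
  refl: "pres_eq R u u"
| sym: "pres_eq R u v \<Longrightarrow> pres_eq R v u"
| trans: "pres_eq R u v \<Longrightarrow> pres_eq R v w \<Longrightarrow> pres_eq R u w"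
| congr: "pres_eq R u v \<Longrightarrow> pres_eq R (a @ u @ b) (a @ v @ b)"
| cancel: "pres_eq R [(x, e), (x, \<not> e)] []"
| relator: "(u, v) \<in> R \<Longrightarrow> pres_eq R u v"

definition word_class :: "('g word \<times> 'g word) set \<Rightarrow> 'g word \<Rightarrow> 'g word set" where
  "word_class R u = {v. pres_eq R u v}"

definition presented_group :: "('g word \<times> 'g word) set \<Rightarrow> 'g word set monoid" where
  "presented_group R =
     \<lparr>carrier = Set.range (word_class R),
      mult = (\<lambda>A B. {w. \<exists>a\<in>A. \<exists>b\<in>B. pres_eq R (a @ b) w}),
      one = word_class R []\<rparr>"

definition word_eval :: "('a, 'r) monoid_scheme \<Rightarrow> ('g \<Rightarrow> 'a) \<Rightarrow> 'g word \<Rightarrow> 'a" where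
  "word_eval G s w =
     foldr (\<lambda>(x, e) y. (if e then s x else inv\<^bsub>G\<^esub> (s x)) \<otimes>\<^bsub>G\<^esub> y) w \<one>\<^bsub>G\<^esub>"

definition has_presentation ::
  "('a, 'r) monoid_scheme \<Rightarrow> ('g \<Rightarrow> 'a) \<Rightarrow> ('g word \<times> 'g word) set \<Rightarrow> bool" where
  "has_presentation G s R \<longleftrightarrow>
     Set.range s \<subseteq> carrier G \<and> generate G (Set.range s) = carrier G \<and>
     (\<forall>u v. word_eval G s u = word_eval G s v \<longleftrightarrow> pres_eq R u v)"

definition conj_class :: "('a, 'r) monoid_scheme \<Rightarrow> 'a \<Rightarrow> 'a set" where
  "conj_class G x = (\<lambda>g. g \<otimes>\<^bsub>G\<^esub> x \<otimes>\<^bsub>G\<^esub> inv\<^bsub>G\<^esub> g) ` carrier G"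

definition conj_classes :: "('a, 'r) monoid_scheme \<Rightarrow> 'a set set" where
  "conj_classes G = conj_class G ` carrier G"

definition centralizer :: "('a, 'r) monoid_scheme \<Rightarrow> 'a \<Rightarrow> 'a set" where
  "centralizer G x = {g \<in> carrier G. g \<otimes>\<^bsub>G\<^esub> x = x \<otimes>\<^bsub>G\<^esub> g}"


section \<open>Complex superalgebras and their modules\<close>

text \<open>\<open>embed c\<close> is the scalar \<open>c \<cdot> 1\<close>; the homogeneous parts are indexed by the field \<open>bit\<close>
  with two elements.\<close>

record 'a superalgebra = "'a ring" +
  embed :: "complex \<Rightarrow> 'a"
  homog :: "bit \<Rightarrow> 'a set"

definition delta :: "'g \<Rightarrow> 'g \<Rightarrow> complex" where
  "delta g = (\<lambda>x. if x = g then 1 else 0)"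

text \<open>The algebra of finitely supported functions on a monoid under convolution, graded by a
  parity function on the monoid.\<close>

definition monoid_superalgebra ::
  "('g, 'r) monoid_scheme \<Rightarrow> ('g \<Rightarrow> bit) \<Rightarrow> ('g \<Rightarrow> complex) superalgebra" where
  "monoid_superalgebra G par =
     \<lparr>carrier = {f. finite {x. f x \<noteq> 0} \<and> {x. f x \<noteq> 0} \<subseteq> carrier G},
      mult = (\<lambda>f h x. \<Sum>(y, z)\<in>{(y, z). f y \<noteq> 0 \<and> h z \<noteq> 0 \<and> y \<otimes>\<^bsub>G\<^esub> z = x}. f y * h z),
      one = delta \<one>\<^bsub>G\<^esub>,
      zero = (\<lambda>_. 0),
      add = (\<lambda>f h x. f x + h x),
      embed = (\<lambda>c x. c * delta \<one>\<^bsub>G\<^esub> x),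
      homog = (\<lambda>i. {f. finite {x. f x \<noteq> 0} \<and> {x. f x \<noteq> 0} \<subseteq> {x \<in> carrier G. par x = i}})\<rparr>"

definition quotient_superalgebra ::
  "('a, 'r) superalgebra_scheme \<Rightarrow> 'a set \<Rightarrow> 'a set superalgebra" where
  "quotient_superalgebra A I =
     ring.extend (A Quot I)
       (superalgebra.fields (\<lambda>c. I +>\<^bsub>A\<^esub> embed A c) (\<lambda>i. (\<lambda>a. I +>\<^bsub>A\<^esub> a) ` homog A i))"

definition superalgebra_hom ::
  "('a, 'r) superalgebra_scheme \<Rightarrow> ('b, 's) superalgebra_scheme \<Rightarrow> ('a \<Rightarrow> 'b) \<Rightarrow> bool" where
  "superalgebra_hom A B \<phi> \<longleftrightarrow>
     \<phi> \<in> ring_hom A B \<and> (\<forall>c. \<phi> (embed A c) = embed B c) \<and> (\<forall>i. \<phi> ` homog A i \<subseteq> homog B i)"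

text \<open>The vectors of a module \<open>M\<close> over a superalgebra with elements of type \<open>'a\<close> form a subspace
  of an ambient complex vector space \<open>'m\<close>, namely the sum of the two graded pieces.\<close>

record ('a, 'm) supermod =
  scal :: "complex \<Rightarrow> 'm \<Rightarrow> 'm"
  piece :: "bit \<Rightarrow> 'm set"
  act :: "'a \<Rightarrow> 'm \<Rightarrow> 'm"

definition vectors :: "('a, 'm::ab_group_add) supermod \<Rightarrow> 'm set" where
  "vectors M = {x + y |x y. x \<in> piece M 0 \<and> y \<in> piece M 1}"

locale supermodule =
  fixes A :: "('a, 'r) superalgebra_scheme" (structure)
    and M :: "('a, 'm::ab_group_add) supermod"
  assumes vector_space: "vector_space (scal M)"
    and subspace: "module.subspace (scal M) (piece M i)"
    and direct: "piece M 0 \<inter> piece M 1 = {0}"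
    and graded: "a \<in> homog A i \<Longrightarrow> x \<in> piece M j \<Longrightarrow> act M a x \<in> piece M (i + j)"
    and act_closed: "a \<in> carrier A \<Longrightarrow> x \<in> vectors M \<Longrightarrow> act M a x \<in> vectors M"
    and act_plus: "a \<in> carrier A \<Longrightarrow> x \<in> vectors M \<Longrightarrow> y \<in> vectors M \<Longrightarrow>
          act M a (x + y) = act M a x + act M a y"
    and act_add: "a \<in> carrier A \<Longrightarrow> b \<in> carrier A \<Longrightarrow> x \<in> vectors M \<Longrightarrow>
          act M (a \<oplus> b) x = act M a x + act M b x"
    and act_mult: "a \<in> carrier A \<Longrightarrow> b \<in> carrier A \<Longrightarrow> x \<in> vectors M \<Longrightarrow>
          act M (a \<otimes> b) x = act M a (act M b x)"
    and act_embed: "x \<in> vectors M \<Longrightarrow> act M (embed A c) x = scal M c x"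

definition graded_submodule ::
  "('a, 'r) superalgebra_scheme \<Rightarrow> ('a, 'm::ab_group_add) supermod \<Rightarrow> 'm set \<Rightarrow> bool" where
  "graded_submodule A M U \<longleftrightarrow>
     module.subspace (scal M) U \<and>
     U = {x + y |x y. x \<in> U \<inter> piece M 0 \<and> y \<in> U \<inter> piece M 1} \<and>
     (\<forall>a\<in>carrier A. \<forall>x\<in>U. act M a x \<in> U)"

definition simple_supermodule ::
  "('a, 'r) superalgebra_scheme \<Rightarrow> ('a, 'm::ab_group_add) supermod \<Rightarrow> bool" where
  "simple_supermodule A M \<longleftrightarrow>
     supermodule A M \<and> vectors M \<noteq> {0} \<and>
     (\<forall>U. graded_submodule A M U \<longrightarrow> U = {0} \<or> U = vectors M)"

definition pullback :: "('a \<Rightarrow> 'b) \<Rightarrow> ('b, 'm) supermod \<Rightarrow> ('a, 'm) supermod" where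
  "pullback \<phi> M = \<lparr>scal = scal M, piece = piece M, act = (\<lambda>a. act M (\<phi> a))\<rparr>"

text \<open>All linear intertwiners of the underlying ungraded modules. A map is determined by its
  values on the source, so it is normalized to vanish elsewhere.\<close>

definition hom_space ::
  "('a, 'r) superalgebra_scheme \<Rightarrow> ('a, 'm::ab_group_add) supermod \<Rightarrow>
   ('a, 'k::ab_group_add) supermod \<Rightarrow> ('m \<Rightarrow> 'k) set" where
  "hom_space A M N =
     {f. (\<forall>x\<in>vectors M. f x \<in> vectors N) \<and> (\<forall>x. x \<notin> vectors M \<longrightarrow> f x = 0) \<and>
         (\<forall>x\<in>vectors M. \<forall>y\<in>vectors M. f (x + y) = f x + f y) \<and>
         (\<forall>c. \<forall>x\<in>vectors M. f (scal M c x) = scal N c (f x)) \<and>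
         (\<forall>a\<in>carrier A. \<forall>x\<in>vectors M. f (act M a x) = act N a (f x))}"

definition hom_dim ::
  "('a, 'r) superalgebra_scheme \<Rightarrow> ('a, 'm::ab_group_add) supermod \<Rightarrow>
   ('a, 'k::ab_group_add) supermod \<Rightarrow> nat" where
  "hom_dim A M N = vector_space.dim (\<lambda>c f x. scal N c (f x)) (hom_space A M N)"

definition mod_trace :: "('a, 'm::ab_group_add) supermod \<Rightarrow> ('m \<Rightarrow> 'm) \<Rightarrow> complex" where
  "mod_trace M h =
     (let B = (SOME B. \<not> module.dependent (scal M) B \<and> module.span (scal M) B = vectors M)
      in \<Sum>b\<in>B. module.representation (scal M) B (h b) b)"


section \<open>Root systems and Weyl groups\<close>

text \<open>The real span of the roots is identified isometrically with \<open>real^'n\<close>, and its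
  complexification \<open>V\<close> with \<open>complex^'n\<close>.\<close>

definition reflection :: "real^'n \<Rightarrow> real^'n^'n::finite" where
  "reflection \<beta> = matrix (\<lambda>v. v - (2 * (v \<bullet> \<beta>) / (\<beta> \<bullet> \<beta>)) *\<^sub>R \<beta>)"

definition root_system :: "(real^'n::finite) set \<Rightarrow> bool" where
  "root_system \<Phi> \<longleftrightarrow>
     finite \<Phi> \<and> 0 \<notin> \<Phi> \<and> span \<Phi> = UNIV \<and>
     (\<forall>\<beta>\<in>\<Phi>. \<Phi> \<inter> span {\<beta>} = {\<beta>, - \<beta>}) \<and>
     (\<forall>\<beta>\<in>\<Phi>. \<forall>\<gamma>\<in>\<Phi>. reflection \<beta> *v \<gamma> \<in> \<Phi>) \<and>
     (\<forall>\<beta>\<in>\<Phi>. \<forall>\<gamma>\<in>\<Phi>. 2 * (\<gamma> \<bullet> \<beta>) / (\<beta> \<bullet> \<beta>) \<in> \<int>)"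

definition simple_roots :: "(real^'n::finite) set \<Rightarrow> ('n \<Rightarrow> real^'n) \<Rightarrow> bool" where
  "simple_roots \<Phi> \<alpha> \<longleftrightarrow>
     inj \<alpha> \<and> Set.range \<alpha> \<subseteq> \<Phi> \<and> independent (Set.range \<alpha>) \<and>
     (\<forall>\<beta>\<in>\<Phi>. \<exists>c :: 'n \<Rightarrow> int.
        \<beta> = (\<Sum>i\<in>UNIV. real_of_int (c i) *\<^sub>R \<alpha> i) \<and> ((\<forall>i. c i \<ge> 0) \<or> (\<forall>i. c i \<le> 0)))"

definition general_linear :: "(real^'n^'n::finite) monoid" where
  "general_linear = \<lparr>carrier = {A. invertible A}, mult = (**), one = mat 1\<rparr>"

definition weyl_group :: "(real^'n::finite) set \<Rightarrow> (real^'n^'n) monoid" where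
  "weyl_group \<Phi> = subgroup_generated general_linear (reflection ` \<Phi>)"

definition cvec :: "real^'n \<Rightarrow> complex^'n::finite" where
  "cvec v = (\<chi> i. complex_of_real (v $ i))"

definition cmat :: "real^'n^'n \<Rightarrow> complex^'n^'n::finite" where
  "cmat x = (\<chi> i j. complex_of_real (x $ i $ j))"

definition irreducible_reflection_rep :: "(real^'n::finite) set \<Rightarrow> bool" where
  "irreducible_reflection_rep \<Phi> \<longleftrightarrow>
     (\<forall>U :: (complex^'n) set.
        vec.subspace U \<and> (\<forall>x\<in>carrier (weyl_group \<Phi>). \<forall>u\<in>U. cmat x *v u \<in> U)
        \<longrightarrow> U = {0} \<or> U = UNIV)"

definition coxeter_matrix :: "('n \<Rightarrow> 'n \<Rightarrow> nat) \<Rightarrow> bool" where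
  "coxeter_matrix m \<longleftrightarrow>
     (\<forall>i. m i i = 1) \<and> (\<forall>i j. i \<noteq> j \<longrightarrow> m i j = m j i \<and> m i j \<ge> 2)"

definition coxeter_relations :: "('n \<Rightarrow> 'n \<Rightarrow> nat) \<Rightarrow> ('n word \<times> 'n word) set" where
  "coxeter_relations m =
     {(concat (replicate (m i j) [(i, True), (j, True)]), []) |i j. True}"

text \<open>An irreducible Weyl group together with its presentation on the simple reflections.\<close>

definition weyl_datum ::
  "(real^'n::finite) set \<Rightarrow> ('n \<Rightarrow> real^'n) \<Rightarrow> ('n \<Rightarrow> 'n \<Rightarrow> nat) \<Rightarrow> bool" where
  "weyl_datum \<Phi> \<alpha> m \<longleftrightarrow>
     root_system \<Phi> \<and> simple_roots \<Phi> \<alpha> \<and> irreducible_reflection_rep \<Phi> \<and> coxeter_matrix m \<and>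
     has_presentation (weyl_group \<Phi>) (\<lambda>i. reflection (\<alpha> i)) (coxeter_relations m)"

text \<open>The parity homomorphism for which every simple reflection is odd.\<close>

definition weyl_parity ::
  "(real^'n::finite) set \<Rightarrow> ('n \<Rightarrow> real^'n) \<Rightarrow> real^'n^'n \<Rightarrow> bit" where
  "weyl_parity \<Phi> \<alpha> x =
     (THE p. \<exists>w. word_eval (weyl_group \<Phi>) (\<lambda>i. reflection (\<alpha> i)) w = x \<and> p = of_nat (length w))"


section \<open>The double cover and the spin Weyl group algebra\<close>

datatype 'n cover_gen = Z | T 'n

definition cover_relations ::
  "('n \<Rightarrow> 'n \<Rightarrow> nat) \<Rightarrow> ('n cover_gen word \<times> 'n cover_gen word) set" where
  "cover_relations m =
     {([(Z, True), (T i, True)], [(T i, True), (Z, True)]) |i. True} \<union>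
     {([(Z, True), (Z, True)], [])} \<union>
     {(concat (replicate (m i j) [(T i, True), (T j, True)]),
       replicate (m i j + 1) (Z, True)) |i j. True}"

type_synonym 'n cover_elt = "'n cover_gen word set"

definition double_cover :: "('n \<Rightarrow> 'n \<Rightarrow> nat) \<Rightarrow> 'n cover_elt monoid" where
  "double_cover m = presented_group (cover_relations m)"

definition cover_z :: "('n \<Rightarrow> 'n \<Rightarrow> nat) \<Rightarrow> 'n cover_elt" where
  "cover_z m = word_class (cover_relations m) [(Z, True)]"

definition cover_t :: "('n \<Rightarrow> 'n \<Rightarrow> nat) \<Rightarrow> 'n \<Rightarrow> 'n cover_elt" where
  "cover_t m i = word_class (cover_relations m) [(T i, True)]"

text \<open>The projection with \<open>z \<mapsto> 1\<close> and \<open>t\<^sub>i \<mapsto> s\<^sub>i\<close>: every word in the class \<open>g\<close> has the same value.\<close>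

definition theta ::
  "(real^'n::finite) set \<Rightarrow> ('n \<Rightarrow> real^'n) \<Rightarrow> 'n cover_elt \<Rightarrow> real^'n^'n" where
  "theta \<Phi> \<alpha> g =
     the_elem (word_eval (weyl_group \<Phi>)
       (\<lambda>x. case x of Z \<Rightarrow> mat 1 | T i \<Rightarrow> reflection (\<alpha> i)) ` g)"

definition split_class ::
  "(real^'n::finite) set \<Rightarrow> ('n \<Rightarrow> real^'n) \<Rightarrow> ('n \<Rightarrow> 'n \<Rightarrow> nat) \<Rightarrow> (real^'n^'n) set \<Rightarrow> bool" where
  "split_class \<Phi> \<alpha> m C \<longleftrightarrow>
     (\<exists>D\<in>conj_classes (double_cover m). \<exists>E\<in>conj_classes (double_cover m).
        D \<noteq> E \<and> {g \<in> carrier (double_cover m). theta \<Phi> \<alpha> g \<in> C} = D \<union> E)"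

definition even_split_classes ::
  "(real^'n::finite) set \<Rightarrow> ('n \<Rightarrow> real^'n) \<Rightarrow> ('n \<Rightarrow> 'n \<Rightarrow> nat) \<Rightarrow> (real^'n^'n) set set" where
  "even_split_classes \<Phi> \<alpha> m =
     {C \<in> conj_classes (weyl_group \<Phi>). split_class \<Phi> \<alpha> m C \<and> (\<forall>x\<in>C. weyl_parity \<Phi> \<alpha> x = 0)}"

type_synonym 'n spin_elt = "('n cover_elt \<Rightarrow> complex) set"

definition cover_algebra ::
  "(real^'n::finite) set \<Rightarrow> ('n \<Rightarrow> real^'n) \<Rightarrow> ('n \<Rightarrow> 'n \<Rightarrow> nat) \<Rightarrow>
   ('n cover_elt \<Rightarrow> complex) superalgebra" where
  "cover_algebra \<Phi> \<alpha> m =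
     monoid_superalgebra (double_cover m) (\<lambda>g. weyl_parity \<Phi> \<alpha> (theta \<Phi> \<alpha> g))"

definition spin_ideal ::
  "(real^'n::finite) set \<Rightarrow> ('n \<Rightarrow> real^'n) \<Rightarrow> ('n \<Rightarrow> 'n \<Rightarrow> nat) \<Rightarrow>
   ('n cover_elt \<Rightarrow> complex) set" where
  "spin_ideal \<Phi> \<alpha> m =
     (let A = cover_algebra \<Phi> \<alpha> m in Idl\<^bsub>A\<^esub> {delta (cover_z m) \<oplus>\<^bsub>A\<^esub> \<one>\<^bsub>A\<^esub>})"

definition spin_algebra ::
  "(real^'n::finite) set \<Rightarrow> ('n \<Rightarrow> real^'n) \<Rightarrow> ('n \<Rightarrow> 'n \<Rightarrow> nat) \<Rightarrow> 'n spin_elt superalgebra" where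
  "spin_algebra \<Phi> \<alpha> m = quotient_superalgebra (cover_algebra \<Phi> \<alpha> m) (spin_ideal \<Phi> \<alpha> m)"

definition spin_image ::
  "(real^'n::finite) set \<Rightarrow> ('n \<Rightarrow> real^'n) \<Rightarrow> ('n \<Rightarrow> 'n \<Rightarrow> nat) \<Rightarrow> 'n cover_elt \<Rightarrow> 'n spin_elt" where
  "spin_image \<Phi> \<alpha> m g = spin_ideal \<Phi> \<alpha> m +>\<^bsub>cover_algebra \<Phi> \<alpha> m\<^esub> delta g"

definition spin_character ::
  "(real^'n::finite) set \<Rightarrow> ('n \<Rightarrow> real^'n) \<Rightarrow> ('n \<Rightarrow> 'n \<Rightarrow> nat) \<Rightarrow>
   ('n spin_elt, 'm::ab_group_add) supermod \<Rightarrow> 'n cover_elt \<Rightarrow> complex" where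
  "spin_character \<Phi> \<alpha> m M g = mod_trace M (act M (spin_image \<Phi> \<alpha> m g))"


section \<open>The Clifford algebra and the basic spin module\<close>

text \<open>The tensor algebra of \<open>V = complex^'n\<close> is the monoid algebra of the free monoid on the
  standard basis, graded by word length modulo 2.\<close>

definition tensor_algebra :: "('n list \<Rightarrow> complex) superalgebra" where
  "tensor_algebra =
     monoid_superalgebra \<lparr>carrier = UNIV, mult = (@), one = []\<rparr> (\<lambda>w. of_nat (length w))"

definition tensor_vec :: "complex^'n \<Rightarrow> 'n::finite list \<Rightarrow> complex" where
  "tensor_vec v = (\<lambda>w. \<Sum>i\<in>UNIV. v $ i * delta [i] w)"

text \<open>The form on \<open>V\<close> is the bilinear (not sesquilinear) extension of the real inner product.\<close>

definition bilin :: "complex^'n \<Rightarrow> complex^'n::finite \<Rightarrow> complex" where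
  "bilin u v = (\<Sum>i\<in>UNIV. u $ i * v $ i)"

definition clifford_ideal :: "('n::finite list \<Rightarrow> complex) set" where
  "clifford_ideal =
     Idl\<^bsub>tensor_algebra\<^esub>
       {tensor_vec v \<otimes>\<^bsub>tensor_algebra\<^esub> tensor_vec v
          \<ominus>\<^bsub>tensor_algebra\<^esub> embed tensor_algebra (bilin v v) |v. True}"

definition clifford_algebra :: "('n::finite list \<Rightarrow> complex) set superalgebra" where
  "clifford_algebra = quotient_superalgebra tensor_algebra clifford_ideal"

definition clifford_vec :: "complex^'n \<Rightarrow> ('n::finite list \<Rightarrow> complex) set" where
  "clifford_vec v = clifford_ideal +>\<^bsub>tensor_algebra\<^esub> tensor_vec v"

definition spin_to_clifford ::
  "(real^'n::finite) set \<Rightarrow> ('n \<Rightarrow> real^'n) \<Rightarrow> ('n \<Rightarrow> 'n \<Rightarrow> nat) \<Rightarrow>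
   ('n spin_elt \<Rightarrow> ('n list \<Rightarrow> complex) set) \<Rightarrow> bool" where
  "spin_to_clifford \<Phi> \<alpha> m \<phi> \<longleftrightarrow>
     superalgebra_hom (spin_algebra \<Phi> \<alpha> m) clifford_algebra \<phi> \<and>
     (\<forall>i. \<phi> (spin_image \<Phi> \<alpha> m (cover_t m i)) =
            clifford_vec (cvec ((1 / sqrt (\<alpha> i \<bullet> \<alpha> i)) *\<^sub>R \<alpha> i)))"

definition basic_spin_module ::
  "(real^'n::finite) set \<Rightarrow> ('n \<Rightarrow> real^'n) \<Rightarrow> ('n \<Rightarrow> 'n \<Rightarrow> nat) \<Rightarrow>
   ('n spin_elt, 'b::ab_group_add) supermod \<Rightarrow> bool" where
  "basic_spin_module \<Phi> \<alpha> m B \<longleftrightarrow>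
     (\<exists>\<phi> S. spin_to_clifford \<Phi> \<alpha> m \<phi> \<and> simple_supermodule clifford_algebra S \<and>
            B = pullback \<phi> S)"


section \<open>Symmetric powers and the graded multiplicity\<close>

text \<open>The symmetric algebra of \<open>V\<close> is the polynomial algebra in which the variable
  \<open>X\<^sub>j\<close> is the \<open>j\<close>-th standard basis vector of \<open>complex^'n\<close>; a group element acts by the algebra
  automorphism extending its action on \<open>V\<close>.\<close>

type_synonym 'n symalg = "('n \<Rightarrow>\<^sub>0 nat) \<Rightarrow>\<^sub>0 complex"

definition sym_power :: "nat \<Rightarrow> 'n::finite symalg set" where
  "sym_power k =
     {p. \<forall>\<mu>\<in>Poly_Mapping.keys p. (\<Sum>j\<in>UNIV. Poly_Mapping.lookup \<mu> j) = k}"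

definition sym_act :: "real^'n^'n \<Rightarrow> 'n::finite symalg \<Rightarrow> 'n symalg" where
  "sym_act x p =
     (\<Sum>\<mu>\<in>Poly_Mapping.keys p. Poly_Mapping.single 0 (Poly_Mapping.lookup p \<mu>) *
        (\<Prod>j\<in>UNIV. (\<Sum>i\<in>UNIV. Poly_Mapping.single (Poly_Mapping.single i 1) (cmat x $ i $ j))
                     ^ Poly_Mapping.lookup \<mu> j))"

text \<open>The tensor product of \<open>B\<close> with the symmetric algebra is realized as polynomials
  with coefficients in \<open>B\<close>.\<close>

definition tensor_scal ::
  "('a, 'b::ab_group_add) supermod \<Rightarrow> complex \<Rightarrow> (('n \<Rightarrow>\<^sub>0 nat) \<Rightarrow>\<^sub>0 'b) \<Rightarrow>
   (('n \<Rightarrow>\<^sub>0 nat) \<Rightarrow>\<^sub>0 'b)" where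
  "tensor_scal B c = Poly_Mapping.map (scal B c)"

definition pure_tensor ::
  "('a, 'b::ab_group_add) supermod \<Rightarrow> 'b \<Rightarrow> 'n symalg \<Rightarrow> (('n \<Rightarrow>\<^sub>0 nat) \<Rightarrow>\<^sub>0 'b)" where
  "pure_tensor B b p = Poly_Mapping.map (\<lambda>c. scal B c b) p"

text \<open>The linear extension of \<open>b \<otimes> p \<mapsto> g b \<otimes> \<theta>(g) p\<close>.\<close>

definition cover_tensor_act ::
  "(real^'n::finite) set \<Rightarrow> ('n \<Rightarrow> real^'n) \<Rightarrow> ('n \<Rightarrow> 'n \<Rightarrow> nat) \<Rightarrow>
   ('n spin_elt, 'b::ab_group_add) supermod \<Rightarrow> 'n cover_elt \<Rightarrow>
   (('n \<Rightarrow>\<^sub>0 nat) \<Rightarrow>\<^sub>0 'b) \<Rightarrow> (('n \<Rightarrow>\<^sub>0 nat) \<Rightarrow>\<^sub>0 'b)" where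
  "cover_tensor_act \<Phi> \<alpha> m B g f =
     (\<Sum>\<mu>\<in>Poly_Mapping.keys f.
        pure_tensor B (act B (spin_image \<Phi> \<alpha> m g) (Poly_Mapping.lookup f \<mu>))
          (sym_act (theta \<Phi> \<alpha> g) (Poly_Mapping.single \<mu> 1)))"

text \<open>The module \<open>B \<otimes> S\<^sup>kV\<close>. On the image of the generator \<open>t\<^sub>i\<close> the action is
  \<open>t\<^sub>i (b \<otimes> p) = t\<^sub>i b \<otimes> s\<^sub>i p\<close>. An element of the spin algebra is a coset, and acts through any
  representative \<open>c = \<Sum>c(g) g\<close>; the choice is immaterial because \<open>z\<close> acts by \<open>-1\<close>.\<close>

definition spin_tensor ::
  "(real^'n::finite) set \<Rightarrow> ('n \<Rightarrow> real^'n) \<Rightarrow> ('n \<Rightarrow> 'n \<Rightarrow> nat) \<Rightarrow>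
   ('n spin_elt, 'b::ab_group_add) supermod \<Rightarrow> nat \<Rightarrow>
   ('n spin_elt, ('n \<Rightarrow>\<^sub>0 nat) \<Rightarrow>\<^sub>0 'b) supermod" where
  "spin_tensor \<Phi> \<alpha> m B k =
     \<lparr>scal = tensor_scal B,
      piece = (\<lambda>i. module.span (tensor_scal B)
                 {pure_tensor B b p |b p. b \<in> piece B i \<and> p \<in> sym_power k}),
      act = (\<lambda>a f. let c = (SOME c. c \<in> a)
                   in \<Sum>g\<in>{g. c g \<noteq> 0}. tensor_scal B (c g) (cover_tensor_act \<Phi> \<alpha> m B g f))\<rparr>"

definition graded_multiplicity ::
  "(real^'n::finite) set \<Rightarrow> ('n \<Rightarrow> real^'n) \<Rightarrow> ('n \<Rightarrow> 'n \<Rightarrow> nat) \<Rightarrow>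
   ('n spin_elt, 'm::ab_group_add) supermod \<Rightarrow> ('n spin_elt, 'b::ab_group_add) supermod \<Rightarrow>
   complex fps" where
  "graded_multiplicity \<Phi> \<alpha> m M B =
     Abs_fps (\<lambda>k. of_nat (hom_dim (spin_algebra \<Phi> \<alpha> m) M (spin_tensor \<Phi> \<alpha> m B k)))"

definition det_one_minus_t :: "real^'n^'n::finite \<Rightarrow> complex fps" where
  "det_one_minus_t x = det (mat 1 - (\<chi> i j. fps_X * fps_const (cmat x $ i $ j)))"

end

theory Submission
  imports Defs "HOL-Algebra.Multiplicative_Group"
begin

text \<open>
Let \<open>G\<close> be the double cover of \<open>W\<close>, with central element \<open>z\<close>. A module over the spin algebra
is a representation of the finite group \<open>G\<close> on which \<open>z\<close> acts as \<open>-1\<close>, so Schur orthogonality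
computes the multiplicity of a simple module \<open>M\<close> in \<open>B \<otimes> S\<^sup>kV\<close> as the average over \<open>G\<close> of
\<open>\<psi>(g\<^sup>-\<^sup>1) \<beta>(g) h(\<theta> g)\<close>, where \<open>\<psi>\<close> and \<open>\<beta>\<close> are the characters of \<open>M\<close> and \<open>B\<close>, and \<open>h(x)\<close> is the
trace of \<open>x\<close> on \<open>S\<^sup>kV\<close> (\<open>dim_intertwiners\<close>, \<open>tensor_trace\<close>). Elements of \<open>W\<close> have finite order,
hence are diagonalizable over the complex numbers, and the generating series of their traces on the
symmetric powers is \<open>1/det(1 - tx)\<close> (\<open>molien_finite_order\<close>).

The formula to be proved has \<open>\<psi>(g)\<close> in the place of \<open>\<psi>(g\<^sup>-\<^sup>1)\<close>. Replacing \<open>g\<close> by \<open>g\<^sup>-\<^sup>1\<close> moves the inverse to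
the other two factors. It disappears from \<open>h\<close>, because \<open>x\<close> is orthogonal and \<open>det(1 - tx)\<close> does not
change under transposition. It disappears from \<open>\<beta>\<close> when \<open>g\<close> is even: up to sign, \<open>g\<close> is a product of an
even number of generators \<open>t\<^sub>i\<close>, which act as unit vectors of the Clifford algebra, its inverse is the
reversed product up to the same sign, and the trace of a product of an even number of vectors is
invariant under reversal (\<open>clifford_trace_reverse\<close>). Finally \<open>\<psi>(g) = 0\<close> when \<open>g\<close> is odd, since odd
elements exchange the two graded pieces of \<open>M\<close> (\<open>frame_trace_odd\<close>).

The summand \<open>\<psi>(g) \<beta>(g) h(\<theta> g)\<close> is a class function on \<open>G\<close>, unchanged under \<open>g \<mapsto> z g\<close> because two signs
cancel. It vanishes on odd elements, and on those \<open>g\<close> that are conjugate to \<open>z g\<close>, because there \<open>\<psi>(g)\<close> is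
its own negative. As \<open>\<theta>\<close> is two-to-one and the class of \<open>x\<close> in \<open>W\<close> has \<open>|W|/|C\<^sub>x|\<close> elements, the average
over \<open>G\<close> becomes the asserted sum over even split classes (\<open>sum_over_double_cover\<close>).
\<close>

section \<open>Traces computed in frames\<close>

definition linear_between ::
  "(complex \<Rightarrow> 'a \<Rightarrow> 'a::ab_group_add) \<Rightarrow> 'a set \<Rightarrow> (complex \<Rightarrow> 'b \<Rightarrow> 'b::ab_group_add) \<Rightarrow> 'b set \<Rightarrow>
   ('a \<Rightarrow> 'b) \<Rightarrow> bool" where
  "linear_between s U s' W f \<longleftrightarrow>
     (\<forall>x\<in>U. f x \<in> W) \<and> (\<forall>x\<in>U. \<forall>y\<in>U. f (x + y) = f x + f y) \<and>
     (\<forall>c. \<forall>x\<in>U. f (s c x) = s' c (f x))"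

text \<open>A finite family of vectors and coordinate functionals that decomposes the identity of \<open>U\<close>. The
vectors may be dependent: traces can be computed from any such decomposition, and frames of spaces
of linear maps and of tensor products are obtained by taking products of the index sets.\<close>

definition frame ::
  "(complex \<Rightarrow> 'a \<Rightarrow> 'a::ab_group_add) \<Rightarrow> 'a set \<Rightarrow> 'i set \<Rightarrow> ('i \<Rightarrow> 'a) \<Rightarrow> ('i \<Rightarrow> 'a \<Rightarrow> complex) \<Rightarrow> bool"
  where
  "frame s U I e c \<longleftrightarrow>
     vector_space s \<and> module.subspace s U \<and> finite I \<and> (\<forall>i\<in>I. e i \<in> U) \<and>
     (\<forall>i\<in>I. linear_between s U (*) UNIV (c i)) \<and> (\<forall>x\<in>U. (\<Sum>i\<in>I. s (c i x) (e i)) = x)"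

definition frame_trace :: "'i set \<Rightarrow> ('i \<Rightarrow> 'a) \<Rightarrow> ('i \<Rightarrow> 'a \<Rightarrow> complex) \<Rightarrow> ('a \<Rightarrow> 'a) \<Rightarrow> complex" where
  "frame_trace I e c h = (\<Sum>i\<in>I. c i (h (e i)))"

lemma linear_betweenI:
  assumes "\<And>x. x \<in> U \<Longrightarrow> f x \<in> W"
    and "\<And>x y. x \<in> U \<Longrightarrow> y \<in> U \<Longrightarrow> f (x + y) = f x + f y"
    and "\<And>c x. x \<in> U \<Longrightarrow> f (s c x) = s' c (f x)"
  shows "linear_between s U s' W f"
  using assms by (simp add: linear_between_def)

lemma linear_betweenD:
  assumes "linear_between s U s' W f" "x \<in> U"
  shows "f x \<in> W" "y \<in> U \<Longrightarrow> f (x + y) = f x + f y" "f (s c x) = s' c (f x)"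
  using assms by (simp_all add: linear_between_def)

lemma linear_between_zero:
  assumes "linear_between s U s' W f" "0 \<in> U"
  shows "f 0 = 0"
  using linear_betweenD(2)[OF assms(1) assms(2) assms(2)] by simp

lemma linear_between_sum:
  assumes f: "linear_between s U s' W f" and U: "vector_space s" "module.subspace s U"
    and x: "\<And>i. i \<in> J \<Longrightarrow> x i \<in> U"
  shows "f (\<Sum>i\<in>J. x i) = (\<Sum>i\<in>J. f (x i))"
proof -
  interpret vector_space s by fact
  show ?thesis
    using x
  proof (induction J rule: infinite_finite_induct)
    case (insert i J)
    have "(\<Sum>i\<in>J. x i) \<in> U" using insert by (intro subspace_sum U) auto
    with insert linear_betweenD(2)[OF f] show ?case by simp
  qed (use linear_between_zero[OF f] subspace_0[OF U(2)] in auto)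
qed

lemma linear_between_in_span:
  assumes "vector_space s" "module.subspace s U" and f: "linear_between s U s U f"
    and "X \<subseteq> U" and fX: "\<And>x. x \<in> X \<Longrightarrow> f x \<in> module.span s Y" and y: "y \<in> module.span s X"
  shows "f y \<in> module.span s Y"
proof -
  interpret vector_space s by fact
  note U = assms(2) and lin = linear_betweenD[OF f]
  let ?V = "{x \<in> U. f x \<in> span Y}"
  have "subspace ?V"
  proof (rule subspaceI)
    show "0 \<in> ?V"
      using linear_between_zero[OF f subspace_0[OF U]] subspace_0[OF U] by (simp add: span_zero)
  qed (auto simp: lin(2,3) intro: subspace_add[OF U] subspace_scale[OF U] span_add span_scale)
  moreover have "X \<subseteq> ?V" using assms(4) fX by blast
  ultimately show ?thesis using y span_minimal by blast
qed

lemma linear_between_compose: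
  assumes "linear_between s U s' W f" "linear_between s' W s'' X g"
  shows "linear_between s U s'' X (\<lambda>x. g (f x))"
  using assms by (simp add: linear_between_def)

lemma linear_between_id: "linear_between s U s U (\<lambda>x. x)"
  by (simp add: linear_between_def)

lemma frameD:
  assumes "frame s U I e c"
  shows "vector_space s" "module.subspace s U" "finite I" "i \<in> I \<Longrightarrow> e i \<in> U"
    "i \<in> I \<Longrightarrow> linear_between s U (*) UNIV (c i)"
    "x \<in> U \<Longrightarrow> (\<Sum>i\<in>I. s (c i x) (e i)) = x"
  using assms by (simp_all add: frame_def)

lemma frame_coeff_map:
  assumes F: "frame s U I e c" and F': "frame s' W J e' c'"
    and f: "linear_between s U s' W f" and j: "j \<in> J" and x: "x \<in> U"
  shows "c' j (f x) = (\<Sum>i\<in>I. c i x * c' j (f (e i)))"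
proof -
  interpret vector_space s by (rule frameD(1)[OF F])
  have lin: "linear_between s U (*) UNIV (\<lambda>x. c' j (f x))"
    by (rule linear_between_compose[OF f frameD(5)[OF F' j]])
  have "c' j (f x) = c' j (f (\<Sum>i\<in>I. s (c i x) (e i)))"
    by (simp add: frameD(6)[OF F x])
  also have "\<dots> = (\<Sum>i\<in>I. c' j (f (s (c i x) (e i))))"
    using frameD(2,4)[OF F] subspace_scale by (intro linear_between_sum[OF lin frameD(1,2)[OF F]]) auto
  also have "\<dots> = (\<Sum>i\<in>I. c i x * c' j (f (e i)))"
    using linear_betweenD(3)[OF lin frameD(4)[OF F]] by (intro sum.cong) auto
  finally show ?thesis .
qed

text \<open>Both sides are the same double sum of products of matrix entries. Besides cyclicity this gives
independence of the frame (take \<open>f\<close> to be the identity), and it identifies the trace of a projection with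
the trace of the identity on its image (take \<open>g\<close> to be the inclusion).\<close>

lemma frame_trace_commute:
  assumes F: "frame s U I e c" and F': "frame s' W J e' c'"
    and f: "linear_between s U s' W f" and g: "linear_between s' W s U g"
  shows "frame_trace I e c (\<lambda>x. g (f x)) = frame_trace J e' c' (\<lambda>y. f (g y))"
proof -
  have "frame_trace I e c (\<lambda>x. g (f x)) = (\<Sum>i\<in>I. \<Sum>j\<in>J. c' j (f (e i)) * c i (g (e' j)))"
    unfolding frame_trace_def
    using frame_coeff_map[OF F' F g] linear_betweenD(1)[OF f frameD(4)[OF F]]
    by (intro sum.cong) auto
  also have "\<dots> = (\<Sum>j\<in>J. \<Sum>i\<in>I. c i (g (e' j)) * c' j (f (e i)))"
    by (subst sum.swap) (simp add: mult.commute)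
  also have "\<dots> = frame_trace J e' c' (\<lambda>y. f (g y))"
    unfolding frame_trace_def
    using frame_coeff_map[OF F F' f] linear_betweenD(1)[OF g frameD(4)[OF F']]
    by (intro sum.cong) auto
  finally show ?thesis .
qed

lemma frame_trace_independent:
  assumes "frame s U I e c" "frame s U J e' c'" "linear_between s U s U h"
  shows "frame_trace I e c h = frame_trace J e' c' h"
  using frame_trace_commute[OF assms(1,2) linear_between_id assms(3)] by simp

lemma basis_frame:
  assumes "vector_space s" "finite X" "\<not> module.dependent s X" "module.span s X = U"
  shows "frame s U X (\<lambda>b. b) (\<lambda>b x. module.representation s X x b)"
proof -
  interpret vector_space s by fact
  show ?thesis
    using assms
    by (auto simp: frame_def linear_between_def span_base representation_add representation_scale
        sum_representation_eq)
qed

lemma frame_span: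
  assumes F: "frame s U I e c"
  shows "module.span s (e ` I) = U"
proof -
  interpret vector_space s by (rule frameD(1)[OF F])
  show ?thesis
  proof
    show "span (e ` I) \<subseteq> U" by (rule span_minimal) (use frameD(2,4)[OF F] in auto)
    show "U \<subseteq> span (e ` I)"
    proof
      fix x assume "x \<in> U"
      then have "x = (\<Sum>i\<in>I. s (c i x) (e i))" using frameD(6)[OF F] by simp
      also have "\<dots> \<in> span (e ` I)" by (intro span_sum span_scale span_base) auto
      finally show "x \<in> span (e ` I)" .
    qed
  qed
qed

lemma subspace_basis_in_finite_span:
  assumes "vector_space s" "module.subspace s U" "finite X" "U \<subseteq> module.span s X"
  obtains Y where "finite Y" "\<not> module.dependent s Y" "module.span s Y = U"
    "card Y = vector_space.dim s U"
proof -
  interpret vector_space s by fact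
  obtain Y where Y: "Y \<subseteq> U" "independent Y" "U \<subseteq> span Y" "card Y = dim U"
    using basis_exists by blast
  have "finite Y" using independent_span_bound[OF assms(3) Y(2)] Y(1) assms(4) by auto
  moreover have "span Y = U" using Y span_minimal[OF Y(1) assms(2)] by auto
  ultimately show ?thesis using that Y by auto
qed

lemma frame_exists_of_finite_span:
  assumes "vector_space s" "finite X" "module.span s X = U"
  shows "\<exists>Y. frame s U Y (\<lambda>b. b) (\<lambda>b x. module.representation s Y x b)"
proof -
  interpret vector_space s by fact
  have sub: "subspace U" using subspace_span[of X] by (simp only: assms(3))
  have "U \<subseteq> span X" by (simp only: assms(3))
  from subspace_basis_in_finite_span[OF assms(1) sub assms(2) this]
  obtain Y where "finite Y" "independent Y" "span Y = U" .
  then show ?thesis by (intro exI[of _ Y] basis_frame[OF assms(1)])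
qed

text \<open>The basis selected by \<open>mod_trace\<close> is finite, being independent inside the span of a frame, and
hence is itself a frame.\<close>

lemma mod_trace_eq_frame_trace:
  assumes F: "frame (scal M) (vectors M) I e c"
    and h: "linear_between (scal M) (vectors M) (scal M) (vectors M) h"
  shows "mod_trace M h = frame_trace I e c h"
proof -
  interpret vector_space "scal M" by (rule frameD(1)[OF F])
  define X where "X = (SOME X. independent X \<and> span X = vectors M)"
  have "\<exists>X. independent X \<and> span X = vectors M"
    using subspace_basis_in_finite_span[OF frameD(1,2)[OF F], of "e ` I"]
      frame_span[OF F] frameD(3)[OF F] by (metis finite_imageI subset_refl)
  then have X: "independent X" "span X = vectors M"
    unfolding X_def by (metis (mono_tags, lifting) someI_ex)+
  have "X \<subseteq> span (e ` I)"
    using X(2) frame_span[OF F] span_superset by metis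
  then have "finite X"
    using independent_span_bound[OF _ X(1)] frameD(3)[OF F] by blast
  then have "frame (scal M) (vectors M) X (\<lambda>b. b) (\<lambda>b x. representation X x b)"
    using basis_frame[OF frameD(1)[OF F]] X by blast
  from frame_trace_independent[OF this F h] show ?thesis
    by (simp add: mod_trace_def Let_def X_def[symmetric] frame_trace_def)
qed

lemma dim_eq_frame_trace:
  assumes F: "frame s U I e c"
  shows "of_nat (vector_space.dim s U) = frame_trace I e c (\<lambda>x. x)"
proof -
  interpret vector_space s by (rule frameD(1)[OF F])
  obtain Y where Y: "finite Y" "independent Y" "span Y = U" "card Y = dim U"
    using subspace_basis_in_finite_span[OF frameD(1,2)[OF F], of "e ` I"]
      frame_span[OF F] frameD(3)[OF F] by blast
  have "frame_trace I e c (\<lambda>x. x) = frame_trace Y (\<lambda>b. b) (\<lambda>b x. representation Y x b) (\<lambda>x. x)"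
    by (intro frame_trace_independent[OF F basis_frame[OF frameD(1)[OF F] Y(1,2,3)]] linear_between_id)
  also have "\<dots> = of_nat (card Y)"
    by (simp add: frame_trace_def representation_basis Y(2))
  finally show ?thesis using Y by simp
qed


section \<open>Intertwiners of a finite group\<close>

text \<open>Maps are made to vanish outside \<open>U\<close>, so that they form a subspace of the space of all
functions and represent each linear map on \<open>U\<close> exactly once.\<close>

definition linear_maps ::
  "(complex \<Rightarrow> 'a \<Rightarrow> 'a::ab_group_add) \<Rightarrow> 'a set \<Rightarrow> (complex \<Rightarrow> 'b \<Rightarrow> 'b::ab_group_add) \<Rightarrow> 'b set \<Rightarrow>
   ('a \<Rightarrow> 'b) set" where
  "linear_maps s U s' W = {f. linear_between s U s' W f \<and> (\<forall>x. x \<notin> U \<longrightarrow> f x = 0)}"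

lemma vector_space_pointwise:
  assumes "vector_space s'"
  shows "vector_space (\<lambda>c (f :: 'a \<Rightarrow> 'b::ab_group_add) x. s' c (f x))"
proof -
  interpret vector_space s' by fact
  show ?thesis
    by unfold_locales (auto simp: fun_eq_iff scale_right_distrib scale_left_distrib)
qed

lemma linear_maps_subspace:
  assumes "vector_space s" "module.subspace s U" "vector_space s'" "module.subspace s' W"
  shows "module.subspace (\<lambda>c f x. s' c (f x)) (linear_maps s U s' W)"
proof -
  interpret s': vector_space s' by fact
  interpret P: vector_space "\<lambda>c (f :: 'a \<Rightarrow> 'b) x. s' c (f x)"
    by (rule vector_space_pointwise) fact
  show ?thesis
    by (rule P.subspaceI)
      (use assms(4) in \<open>auto simp: linear_maps_def linear_between_def s'.subspace_0 s'.subspace_add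
          s'.subspace_scale s'.scale_right_distrib mult.commute\<close>)
qed

lemma sum_apply: "(\<Sum>i\<in>A. f i) x = (\<Sum>i\<in>A. f i x)"
  by (induction A rule: infinite_finite_induct) auto

text \<open>The frame of matrix units.\<close>

lemma linear_maps_frame:
  assumes F: "frame s U I e c" and F': "frame s' W J e' c'"
  shows "frame (\<lambda>c f x. s' c (f x)) (linear_maps s U s' W) (I \<times> J)
    (\<lambda>(i, j) x. if x \<in> U then s' (c i x) (e' j) else 0) (\<lambda>(i, j) f. c' j (f (e i)))"
proof -
  interpret s: vector_space s by (rule frameD(1)[OF F])
  interpret s': vector_space s' by (rule frameD(1)[OF F'])
  note U = frameD(2)[OF F] and W = frameD(2)[OF F']
  have unit: "(\<lambda>x. if x \<in> U then s' (c i x) (e' j) else 0) \<in> linear_maps s U s' W"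
    if "i \<in> I" "j \<in> J" for i j
    using linear_betweenD[OF frameD(5)[OF F that(1)]] frameD(4)[OF F' that(2)]
    by (auto simp: linear_maps_def intro!: linear_betweenI s'.subspace_scale[OF W]
        s.subspace_add[OF U] s.subspace_scale[OF U] s'.scale_left_distrib)
  have func: "linear_between (\<lambda>c f x. s' c (f x)) (linear_maps s U s' W) (*) UNIV (\<lambda>f. c' j (f (e i)))"
    if "i \<in> I" "j \<in> J" for i j
    using linear_betweenD(2,3)[OF frameD(5)[OF F' that(2)]] frameD(4)[OF F that(1)]
    by (auto simp: linear_maps_def linear_betweenD(1) intro!: linear_betweenI)
  have expand: "(\<Sum>p\<in>I \<times> J. (\<lambda>x. s' ((case p of (i, j) \<Rightarrow> \<lambda>f. c' j (f (e i))) f)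
        ((case p of (i, j) \<Rightarrow> \<lambda>x. if x \<in> U then s' (c i x) (e' j) else 0) x))) = f"
    if f: "f \<in> linear_maps s U s' W" for f
  proof
    fix x
    have lin: "linear_between s U s' W f" using f by (simp add: linear_maps_def)
    have "(\<Sum>p\<in>I \<times> J. (\<lambda>x. s' ((case p of (i, j) \<Rightarrow> \<lambda>f. c' j (f (e i))) f)
        ((case p of (i, j) \<Rightarrow> \<lambda>x. if x \<in> U then s' (c i x) (e' j) else 0) x))) x =
      (\<Sum>p\<in>I \<times> J. case p of (i, j) \<Rightarrow> s' (c' j (f (e i))) (if x \<in> U then s' (c i x) (e' j) else 0))"
      by (auto simp: sum_apply intro!: sum.cong)
    also have "\<dots> = (\<Sum>i\<in>I. \<Sum>j\<in>J. s' (c' j (f (e i))) (if x \<in> U then s' (c i x) (e' j) else 0))"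
      by (subst sum.cartesian_product) simp
    also have "\<dots> = f x"
    proof (cases "x \<in> U")
      case True
      have "(\<Sum>i\<in>I. \<Sum>j\<in>J. s' (c' j (f (e i))) (s' (c i x) (e' j))) =
          (\<Sum>i\<in>I. s' (c i x) (\<Sum>j\<in>J. s' (c' j (f (e i))) (e' j)))"
        by (simp add: s'.scale_sum_right s'.scale_scale mult.commute)
      also have "\<dots> = (\<Sum>i\<in>I. s' (c i x) (f (e i)))"
        using frameD(6)[OF F'] linear_betweenD(1)[OF lin frameD(4)[OF F]] by simp
      also have "\<dots> = (\<Sum>i\<in>I. f (s (c i x) (e i)))"
        using linear_betweenD(3)[OF lin frameD(4)[OF F]] by simp
      also have "\<dots> = f (\<Sum>i\<in>I. s (c i x) (e i))"
        using s.subspace_scale[OF U frameD(4)[OF F]]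
        by (intro linear_between_sum[OF lin frameD(1,2)[OF F], symmetric])
      finally show ?thesis using True frameD(6)[OF F True] by simp
    next
      case False
      then show ?thesis using f by (simp add: linear_maps_def)
    qed
    finally show "(\<Sum>p\<in>I \<times> J. (\<lambda>x. s' ((case p of (i, j) \<Rightarrow> \<lambda>f. c' j (f (e i))) f)
        ((case p of (i, j) \<Rightarrow> \<lambda>x. if x \<in> U then s' (c i x) (e' j) else 0) x))) x = f x" .
  qed
  show ?thesis
    unfolding frame_def
    using linear_maps_subspace[OF frameD(1,2)[OF F] frameD(1,2)[OF F']] frameD(3)[OF F]
      frameD(3)[OF F'] vector_space_pointwise[OF frameD(1)[OF F']] unit func expand
    by (auto split: prod.splits)
qed

definition group_rep ::
  "('g, 'r) monoid_scheme \<Rightarrow> (complex \<Rightarrow> 'a \<Rightarrow> 'a::ab_group_add) \<Rightarrow> 'a set \<Rightarrow> ('g \<Rightarrow> 'a \<Rightarrow> 'a) \<Rightarrow> bool"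
  where
  "group_rep G s U \<rho> \<longleftrightarrow>
     (\<forall>g\<in>carrier G. linear_between s U s U (\<rho> g)) \<and>
     (\<forall>g\<in>carrier G. \<forall>h\<in>carrier G. \<forall>x\<in>U. \<rho> (g \<otimes>\<^bsub>G\<^esub> h) x = \<rho> g (\<rho> h x)) \<and>
     (\<forall>x\<in>U. \<rho> \<one>\<^bsub>G\<^esub> x = x)"

lemma group_repD:
  assumes "group_rep G s U \<rho>"
  shows "g \<in> carrier G \<Longrightarrow> linear_between s U s U (\<rho> g)"
    "g \<in> carrier G \<Longrightarrow> h \<in> carrier G \<Longrightarrow> x \<in> U \<Longrightarrow> \<rho> (g \<otimes>\<^bsub>G\<^esub> h) x = \<rho> g (\<rho> h x)"
    "x \<in> U \<Longrightarrow> \<rho> \<one>\<^bsub>G\<^esub> x = x"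
  using assms by (auto simp: group_rep_def)

lemma frame_trace_conj:
  assumes F: "frame s U J e c" and \<rho>: "group_rep G s U \<rho>" and G: "group G"
    and g: "g \<in> carrier G" and k: "k \<in> carrier G"
  shows "frame_trace J e c (\<rho> (k \<otimes>\<^bsub>G\<^esub> g \<otimes>\<^bsub>G\<^esub> inv\<^bsub>G\<^esub> k)) = frame_trace J e c (\<rho> g)"
proof -
  interpret group G by fact
  note lin = group_repD(1)[OF \<rho>]
  have V: "e j \<in> U" if "j \<in> J" for j using frameD(4)[OF F that] .
  have "frame_trace J e c (\<rho> (k \<otimes>\<^bsub>G\<^esub> g \<otimes>\<^bsub>G\<^esub> inv\<^bsub>G\<^esub> k)) =
      frame_trace J e c (\<lambda>v. \<rho> (k \<otimes>\<^bsub>G\<^esub> g) (\<rho> (inv\<^bsub>G\<^esub> k) v))"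
    unfolding frame_trace_def
    by (intro sum.cong HOL.refl) (simp add: group_repD(2)[OF \<rho>] g k V)
  also have "\<dots> = frame_trace J e c (\<lambda>v. \<rho> (inv\<^bsub>G\<^esub> k) (\<rho> (k \<otimes>\<^bsub>G\<^esub> g) v))"
    using g k by (intro frame_trace_commute[OF F F lin lin]) auto
  also have "\<dots> = frame_trace J e c (\<rho> (inv\<^bsub>G\<^esub> k \<otimes>\<^bsub>G\<^esub> (k \<otimes>\<^bsub>G\<^esub> g)))"
    unfolding frame_trace_def
    by (intro sum.cong HOL.refl) (simp add: group_repD(2)[OF \<rho>, of "inv\<^bsub>G\<^esub> k" "k \<otimes>\<^bsub>G\<^esub> g"] g k V)
  also have "inv\<^bsub>G\<^esub> k \<otimes>\<^bsub>G\<^esub> (k \<otimes>\<^bsub>G\<^esub> g) = g" using g k by (simp add: m_assoc[symmetric])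
  finally show ?thesis .
qed

definition intertwiners where
  "intertwiners G s U \<rho> s' W \<sigma> =
     {f \<in> linear_maps s U s' W. \<forall>g\<in>carrier G. \<forall>x\<in>U. f (\<rho> g x) = \<sigma> g (f x)}"

text \<open>Averaging \<open>f \<mapsto> \<sigma>(g) f \<rho>(g\<^sup>-\<^sup>1)\<close> over the group projects the space of all linear maps onto the
intertwiners, so their dimension is the trace of this projection. In the frame of matrix units the
summand for \<open>g\<close> has trace \<open>tr \<rho>(g\<^sup>-\<^sup>1) \<cdot> tr \<sigma>(g)\<close>.\<close>

lemma dim_intertwiners:
  fixes G (structure) and s :: "complex \<Rightarrow> 'a \<Rightarrow> 'a::ab_group_add" and s' :: "complex \<Rightarrow> 'b \<Rightarrow> 'b::ab_group_add"
  assumes G: "group G" "finite (carrier G)"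
    and F: "frame s U I e c" and F': "frame s' W J e' c'"
    and \<rho>: "group_rep G s U \<rho>" and \<sigma>: "group_rep G s' W \<sigma>"
  shows "of_nat (vector_space.dim (\<lambda>c f x. s' c (f x)) (intertwiners G s U \<rho> s' W \<sigma>)) =
    (\<Sum>g\<in>carrier G. frame_trace I e c (\<rho> (inv\<^bsub>G\<^esub> g)) * frame_trace J e' c' (\<sigma> g))
      / of_nat (card (carrier G))"
proof -
  interpret group G by fact
  interpret s: vector_space s by (rule frameD(1)[OF F])
  interpret s': vector_space s' by (rule frameD(1)[OF F'])
  interpret P: vector_space "\<lambda>c (f :: 'a \<Rightarrow> 'b) x. s' c (f x)"
    by (rule vector_space_pointwise) (rule frameD(1)[OF F'])
  note U = frameD(2)[OF F] and W = frameD(2)[OF F']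
  note \<rho>U = linear_betweenD[OF group_repD(1)[OF \<rho>]]
  note \<sigma>W = linear_betweenD[OF group_repD(1)[OF \<sigma>]]
  let ?H = "linear_maps s U s' W" and ?K = "intertwiners G s U \<rho> s' W \<sigma>"
  let ?s = "\<lambda>c (f :: 'a \<Rightarrow> 'b) x. s' c (f x)"
  define n :: complex where "n = of_nat (card (carrier G))"
  have n0: "n \<noteq> 0" using G(2) by (auto simp: n_def)
  have FH: "frame ?s ?H (I \<times> J)
    (\<lambda>(i, j) x. if x \<in> U then s' (c i x) (e' j) else 0) (\<lambda>(i, j) f. c' j (f (e i)))"
    by (rule linear_maps_frame[OF F F'])
  have HD: "linear_between s U s' W f" if "f \<in> ?H" for f
    using that by (simp add: linear_maps_def)
  have subK: "P.subspace ?K"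
  proof (rule P.subspaceI)
    show "0 \<in> ?K"
      using P.subspace_0[OF frameD(2)[OF FH]] linear_between_zero[OF group_repD(1)[OF \<sigma>] s'.subspace_0[OF W]]
      by (auto simp: intertwiners_def)
    show "f + g \<in> ?K" if "f \<in> ?K" "g \<in> ?K" for f g
      using that P.subspace_add[OF frameD(2)[OF FH]] \<sigma>W(2) linear_betweenD(1)[OF HD]
      by (auto simp: intertwiners_def)
    show "?s a f \<in> ?K" if "f \<in> ?K" for f a
      using that P.subspace_scale[OF frameD(2)[OF FH]] \<sigma>W(3) linear_betweenD(1)[OF HD]
      by (auto simp: intertwiners_def)
  qed
  \<comment> \<open>the average over the group, a projection onto the intertwiners\<close>
  define P where "P f = (\<lambda>x. if x \<in> U then
      s' (1 / n) (\<Sum>g\<in>carrier G. \<sigma> g (f (\<rho> (inv g) x))) else 0)" for f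
  have term_lin: "linear_between s U s' W (\<lambda>x. \<sigma> g (f (\<rho> (inv g) x)))"
    if "f \<in> ?H" "g \<in> carrier G" for f g
    using that by (intro linear_between_compose[OF linear_between_compose[OF _ HD]]
        group_repD(1)[OF \<rho>] group_repD(1)[OF \<sigma>]) auto
  have PH: "P f \<in> ?H" if f: "f \<in> ?H" for f
    unfolding linear_maps_def
  proof (intro CollectI conjI linear_betweenI)
    fix x assume x: "x \<in> U"
    show "P f x \<in> W"
      using x linear_betweenD(1)[OF term_lin[OF f]]
      by (auto simp: P_def intro!: s'.subspace_scale[OF W] s'.subspace_sum[OF W])
    show "P f (x + y) = P f x + P f y" if "y \<in> U" for y
      using x that linear_betweenD(2)[OF term_lin[OF f]] s.subspace_add[OF U]
      by (simp add: P_def sum.distrib s'.scale_right_distrib)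
    show "P f (s a x) = s' a (P f x)" for a
      using x linear_betweenD(3)[OF term_lin[OF f]] s.subspace_scale[OF U]
      by (simp add: P_def s'.scale_sum_right s'.scale_scale mult.commute)
  qed (auto simp: P_def)
  have PK: "P f \<in> ?K" if f: "f \<in> ?H" for f
    unfolding intertwiners_def
  proof (intro CollectI conjI PH[OF f] ballI)
    fix h x assume h: "h \<in> carrier G" and x: "x \<in> U"
    have hx: "\<rho> h x \<in> U" using \<rho>U(1) h x by auto
    have inW: "f (\<rho> (inv g) x) \<in> W" if "g \<in> carrier G" for g
      using that x \<rho>U(1) linear_betweenD(1)[OF HD[OF f]] by auto
    have "(\<Sum>g\<in>carrier G. \<sigma> g (f (\<rho> (inv g) (\<rho> h x)))) =
        (\<Sum>g\<in>carrier G. \<sigma> (h \<otimes> g) (f (\<rho> (inv (h \<otimes> g)) (\<rho> h x))))"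
      by (rule sum.reindex_bij_witness[of _ "\<lambda>g. h \<otimes> g" "\<lambda>g. inv h \<otimes> g"])
        (auto simp: h m_assoc[symmetric])
    also have "\<dots> = (\<Sum>g\<in>carrier G. \<sigma> h (\<sigma> g (f (\<rho> (inv g) x))))"
    proof (rule sum.cong[OF HOL.refl])
      fix g assume g: "g \<in> carrier G"
      have "\<rho> (inv (h \<otimes> g)) (\<rho> h x) = \<rho> (inv (h \<otimes> g) \<otimes> h) x"
        using g h x group_repD(2)[OF \<rho>] by simp
      also have "inv (h \<otimes> g) \<otimes> h = inv g"
        using g h by (simp add: inv_mult_group m_assoc)
      finally show "\<sigma> (h \<otimes> g) (f (\<rho> (inv (h \<otimes> g)) (\<rho> h x))) = \<sigma> h (\<sigma> g (f (\<rho> (inv g) x)))"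
        using g h inW group_repD(2)[OF \<sigma>] by simp
    qed
    also have "\<dots> = \<sigma> h (\<Sum>g\<in>carrier G. \<sigma> g (f (\<rho> (inv g) x)))"
      using inW \<sigma>W(1)
      by (intro linear_between_sum[OF group_repD(1)[OF \<sigma> h] frameD(1,2)[OF F'], symmetric]) auto
    finally have sum_h: "(\<Sum>g\<in>carrier G. \<sigma> g (f (\<rho> (inv g) (\<rho> h x)))) =
        \<sigma> h (\<Sum>g\<in>carrier G. \<sigma> g (f (\<rho> (inv g) x)))" .
    have "(\<Sum>g\<in>carrier G. \<sigma> g (f (\<rho> (inv g) x))) \<in> W"
      by (intro s'.subspace_sum[OF W] \<sigma>W(1) inW)
    then show "P f (\<rho> h x) = \<sigma> h (P f x)"
      using x hx \<sigma>W(3)[OF h] sum_h by (simp add: P_def)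
  qed
  have P_fixes: "P f = f" if f: "f \<in> ?K" for f
  proof
    fix x
    show "P f x = f x"
    proof (cases "x \<in> U")
      case True
      have "\<sigma> g (f (\<rho> (inv g) x)) = f x" if g: "g \<in> carrier G" for g
      proof -
        have "\<sigma> g (f (\<rho> (inv g) x)) = f (\<rho> g (\<rho> (inv g) x))"
          using f g True \<rho>U(1) by (auto simp: intertwiners_def)
        also have "\<rho> g (\<rho> (inv g) x) = x"
          using group_repD(2)[OF \<rho> g, of "inv g" x] group_repD(3)[OF \<rho>] g True by simp
        finally show ?thesis .
      qed
      then show ?thesis
        using True n0 by (simp add: P_def s'.sum_constant_scale n_def[symmetric])
    next
      case False
      then show ?thesis using f by (simp add: P_def intertwiners_def linear_maps_def)
    qed
  qed
  have P_lin: "linear_between ?s ?H ?s ?K P"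
  proof (rule linear_betweenI)
    show "P f \<in> ?K" if "f \<in> ?H" for f by (rule PK[OF that])
    show "P (f + g) = P f + P g" if "f \<in> ?H" "g \<in> ?H" for f g
      using \<rho>U(1) \<sigma>W(2) linear_betweenD(1)[OF HD[OF that(1)]] linear_betweenD(1)[OF HD[OF that(2)]]
      by (auto simp: P_def fun_eq_iff sum.distrib s'.scale_right_distrib)
    show "P (?s a f) = ?s a (P f)" if "f \<in> ?H" for a f
      using \<rho>U(1) \<sigma>W(3) linear_betweenD(1)[OF HD[OF that(1)]]
      by (auto simp: P_def fun_eq_iff s'.scale_sum_right s'.scale_scale mult.commute)
  qed
  have KH: "?K \<subseteq> ?H" by (auto simp: intertwiners_def)
  have incl: "linear_between ?s ?K ?s ?H (\<lambda>f. f)"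
    using KH by (auto intro: linear_betweenI)
  let ?eH = "\<lambda>(i, j) x. if x \<in> U then s' (c i x) (e' j) else 0"
  obtain Y where Y: "finite Y" "P.independent Y" "P.span Y = ?K" "card Y = P.dim ?K"
    using subspace_basis_in_finite_span[OF frameD(1)[OF FH] subK, of "?eH ` (I \<times> J)"]
      frame_span[OF FH] frameD(3)[OF FH] KH by blast
  have FK: "frame ?s ?K Y (\<lambda>b. b) (\<lambda>b x. P.representation Y x b)"
    by (rule basis_frame[OF frameD(1)[OF FH] Y(1-3)])
  have "of_nat (P.dim ?K) = frame_trace Y (\<lambda>b. b) (\<lambda>b x. P.representation Y x b) (\<lambda>f. f)"
    by (rule dim_eq_frame_trace[OF FK])
  also have "\<dots> = frame_trace Y (\<lambda>b. b) (\<lambda>b x. P.representation Y x b) (\<lambda>f. P f)"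
    unfolding frame_trace_def
    by (intro sum.cong HOL.refl) (use P_fixes frameD(4)[OF FK] in auto)
  also have "\<dots> = frame_trace (I \<times> J) ?eH (\<lambda>(i, j) f. c' j (f (e i))) P"
    by (rule frame_trace_commute[OF FK FH incl P_lin])
  also have "\<dots> = (\<Sum>i\<in>I. \<Sum>j\<in>J. c' j (P (?eH (i, j)) (e i)))"
    unfolding frame_trace_def sum.cartesian_product by (intro sum.cong) auto
  also have "\<dots> = (\<Sum>i\<in>I. \<Sum>j\<in>J. \<Sum>g\<in>carrier G. 1 / n * (c i (\<rho> (inv g) (e i)) * c' j (\<sigma> g (e' j))))"
  proof (intro sum.cong HOL.refl)
    fix i j assume i: "i \<in> I" and j: "j \<in> J"
    have ei: "e i \<in> U" and ej: "e' j \<in> W" using frameD(4)[OF F i] frameD(4)[OF F' j] .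
    have *: "\<sigma> g (?eH (i, j) (\<rho> (inv g) (e i))) = s' (c i (\<rho> (inv g) (e i))) (\<sigma> g (e' j))"
      if g: "g \<in> carrier G" for g
      using \<rho>U(1)[OF _ ei, of "inv g"] g \<sigma>W(3)[OF g ej] by simp
    have W1: "s' (c i (\<rho> (inv g) (e i))) (\<sigma> g (e' j)) \<in> W" if g: "g \<in> carrier G" for g
      using g \<sigma>W(1)[OF g ej] s'.subspace_scale[OF W] by auto
    note cj = frameD(5)[OF F' j]
    have "P (?eH (i, j)) (e i) = s' (1 / n) (\<Sum>g\<in>carrier G. s' (c i (\<rho> (inv g) (e i))) (\<sigma> g (e' j)))"
      using ei * by (simp add: P_def)
    moreover have "(\<Sum>g\<in>carrier G. s' (c i (\<rho> (inv g) (e i))) (\<sigma> g (e' j))) \<in> W"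
      by (intro s'.subspace_sum[OF W] W1)
    ultimately have "c' j (P (?eH (i, j)) (e i)) =
        1 / n * c' j (\<Sum>g\<in>carrier G. s' (c i (\<rho> (inv g) (e i))) (\<sigma> g (e' j)))"
      using linear_betweenD(3)[OF cj] by simp
    also have "c' j (\<Sum>g\<in>carrier G. s' (c i (\<rho> (inv g) (e i))) (\<sigma> g (e' j))) =
        (\<Sum>g\<in>carrier G. c' j (s' (c i (\<rho> (inv g) (e i))) (\<sigma> g (e' j))))"
      by (rule linear_between_sum[OF cj frameD(1,2)[OF F'] W1])
    also have "\<dots> = (\<Sum>g\<in>carrier G. c i (\<rho> (inv g) (e i)) * c' j (\<sigma> g (e' j)))"
      using linear_betweenD(3)[OF cj \<sigma>W(1)[OF _ ej]] by simp
    finally show "c' j (P (?eH (i, j)) (e i)) =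
        (\<Sum>g\<in>carrier G. 1 / n * (c i (\<rho> (inv g) (e i)) * c' j (\<sigma> g (e' j))))"
      by (simp add: sum_distrib_left)
  qed
  also have "\<dots> = (\<Sum>g\<in>carrier G. \<Sum>i\<in>I. \<Sum>j\<in>J. 1 / n * (c i (\<rho> (inv g) (e i)) * c' j (\<sigma> g (e' j))))"
    by (subst sum.swap[of _ I "carrier G"], intro sum.cong HOL.refl sum.swap)
  also have "\<dots> = (\<Sum>g\<in>carrier G. 1 / n * (frame_trace I e c (\<rho> (inv g)) * frame_trace J e' c' (\<sigma> g)))"
    unfolding frame_trace_def sum_product by (simp only: sum_distrib_left)
  finally show ?thesis
    by (simp add: n_def[symmetric] sum_distrib_left[symmetric] sum_divide_distrib)
qed


section \<open>Monoid algebras\<close>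

definition support :: "('g \<Rightarrow> complex) \<Rightarrow> 'g set" where
  "support f = {x. f x \<noteq> 0}"

definition linear_extension ::
  "(complex \<Rightarrow> 'a \<Rightarrow> 'a::ab_group_add) \<Rightarrow> ('g \<Rightarrow> 'a) \<Rightarrow> ('g \<Rightarrow> complex) \<Rightarrow> 'a" where
  "linear_extension s \<phi> f = (\<Sum>g\<in>support f. s (f g) (\<phi> g))"

lemma support_delta: "support (delta g) = {g}"
  by (auto simp: support_def delta_def)

locale complex_vector_space = vector_space scale
  for scale :: "complex \<Rightarrow> 'b::ab_group_add \<Rightarrow> 'b"
begin

lemma linear_extension_superset:
  assumes "finite S" "support f \<subseteq> S"
  shows "linear_extension scale \<phi> f = (\<Sum>g\<in>S. scale (f g) (\<phi> g))"
  unfolding linear_extension_def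
  by (rule sum.mono_neutral_left) (use assms in \<open>auto simp: support_def\<close>)

lemma linear_extension_add:
  assumes "finite (support f)" "finite (support h)"
  shows "linear_extension scale \<phi> (\<lambda>x. f x + h x) =
    linear_extension scale \<phi> f + linear_extension scale \<phi> h"
proof -
  have "support (\<lambda>x. f x + h x) \<subseteq> support f \<union> support h" by (auto simp: support_def)
  then show ?thesis
    using assms linear_extension_superset[of "support f \<union> support h"]
    by (simp add: scale_left_distrib sum.distrib)
qed

lemma linear_extension_scale:
  assumes "finite (support f)"
  shows "linear_extension scale \<phi> (\<lambda>x. c * f x) = scale c (linear_extension scale \<phi> f)"
proof -
  have "support (\<lambda>x. c * f x) \<subseteq> support f" by (auto simp: support_def)
  then show ?thesis
    using assms linear_extension_superset[of "support f"] by (simp add: scale_sum_right)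
qed

lemma linear_extension_delta: "linear_extension scale \<phi> (delta g) = \<phi> g"
  by (simp add: linear_extension_def support_delta) (simp add: delta_def)

lemma linear_extension_zero: "linear_extension scale \<phi> (\<lambda>_. 0) = 0"
  by (simp add: linear_extension_def support_def)

lemma linear_extension_cong:
  "(\<And>g. g \<in> support f \<Longrightarrow> \<phi> g = \<psi> g) \<Longrightarrow> linear_extension scale \<phi> f = linear_extension scale \<psi> f"
  by (simp add: linear_extension_def)

lemma linear_extension_in_subspace:
  assumes "subspace W" "\<And>g. g \<in> support f \<Longrightarrow> \<phi> g \<in> W"
  shows "linear_extension scale \<phi> f \<in> W"
  unfolding linear_extension_def using assms by (intro subspace_sum subspace_scale) auto

end

lemma vector_space_complex: "vector_space ((*) :: complex \<Rightarrow> complex \<Rightarrow> complex)"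
  by unfold_locales (auto simp: algebra_simps)

interpretation complex_scalars: complex_vector_space "(*) :: complex \<Rightarrow> complex \<Rightarrow> complex"
  by (rule complex_vector_space.intro[OF vector_space_complex])

text \<open>The value at \<open>x\<close> is a linear extension too, so identities in a monoid algebra can be proved by
evaluating linear extensions.\<close>

lemma linear_extension_point:
  "finite (support f) \<Longrightarrow> linear_extension (*) (\<lambda>y. delta y x) f = f x"
  by (subst complex_scalars.linear_extension_superset[of "insert x (support f)"])
    (auto simp: delta_def if_distrib cong: if_cong)

context monoid
begin

abbreviation "alg par \<equiv> monoid_superalgebra G par"

lemma alg_carrier: "f \<in> carrier (alg par) \<longleftrightarrow> finite (support f) \<and> support f \<subseteq> carrier G"
  by (simp add: monoid_superalgebra_def support_def)

lemma alg_add: "f \<oplus>\<^bsub>alg par\<^esub> h = (\<lambda>x. f x + h x)"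
  and alg_zero: "\<zero>\<^bsub>alg par\<^esub> = (\<lambda>_. 0)"
  and alg_one: "\<one>\<^bsub>alg par\<^esub> = delta \<one>"
  and alg_embed: "embed (alg par) c = (\<lambda>x. c * delta \<one> x)"
  by (simp_all add: monoid_superalgebra_def)

lemma alg_mult: "(f \<otimes>\<^bsub>alg par\<^esub> h) x =
    (\<Sum>p | p \<in> support f \<times> support h \<and> fst p \<otimes> snd p = x. f (fst p) * h (snd p))"
proof -
  have "{(y, z). f y \<noteq> 0 \<and> h z \<noteq> 0 \<and> y \<otimes> z = x} =
      {p \<in> support f \<times> support h. fst p \<otimes> snd p = x}"
    by (auto simp: support_def)
  then show ?thesis by (simp add: monoid_superalgebra_def split_def)
qed

lemma support_alg_mult:
  "support (f \<otimes>\<^bsub>alg par\<^esub> h) \<subseteq> (\<lambda>p. fst p \<otimes> snd p) ` (support f \<times> support h)"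
proof
  fix x assume "x \<in> support (f \<otimes>\<^bsub>alg par\<^esub> h)"
  then have "{p \<in> support f \<times> support h. fst p \<otimes> snd p = x} \<noteq> {}"
    unfolding support_def mem_Collect_eq alg_mult by (metis (no_types, lifting) sum.empty)
  then obtain p where "p \<in> support f \<times> support h" "fst p \<otimes> snd p = x" by blast
  then show "x \<in> (\<lambda>p. fst p \<otimes> snd p) ` (support f \<times> support h)" by blast
qed

text \<open>This property of convolution carries the algebra laws and, applied to operators, the
multiplicativity of the extension of a representation to the group algebra.\<close>

lemma linear_extension_alg_mult:
  assumes s: "vector_space s" and f: "finite (support f)" and h: "finite (support h)"
  shows "linear_extension s \<phi> (f \<otimes>\<^bsub>alg par\<^esub> h) =
    linear_extension s (\<lambda>y. linear_extension s (\<lambda>z. \<phi> (y \<otimes> z)) h) f"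
proof -
  interpret complex_vector_space s by (rule complex_vector_space.intro) fact
  let ?m = "\<lambda>p. fst p \<otimes> snd p" and ?S = "support f \<times> support h"
  have "linear_extension s \<phi> (f \<otimes>\<^bsub>alg par\<^esub> h) =
      (\<Sum>u\<in>?m ` ?S. s (\<Sum>p | p \<in> ?S \<and> ?m p = u. f (fst p) * h (snd p)) (\<phi> u))"
    using f h by (subst linear_extension_superset[OF _ support_alg_mult]) (auto simp: alg_mult)
  also have "\<dots> = (\<Sum>u\<in>?m ` ?S. \<Sum>p | p \<in> ?S \<and> ?m p = u. s (f (fst p) * h (snd p)) (\<phi> (?m p)))"
    by (simp add: scale_sum_left)
  also have "\<dots> = (\<Sum>p\<in>?S. s (f (fst p) * h (snd p)) (\<phi> (?m p)))"
    using f h by (intro sum.group) auto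
  also have "\<dots> = (\<Sum>y\<in>support f. \<Sum>z\<in>support h. s (f y * h z) (\<phi> (y \<otimes> z)))"
    by (simp add: sum.cartesian_product split_def)
  also have "\<dots> = linear_extension s (\<lambda>y. linear_extension s (\<lambda>z. \<phi> (y \<otimes> z)) h) f"
    by (simp add: linear_extension_def scale_sum_right)
  finally show ?thesis .
qed

lemma alg_mult_point:
  assumes "finite (support f)" "finite (support h)"
  shows "(f \<otimes>\<^bsub>alg par\<^esub> h) x =
    linear_extension (*) (\<lambda>y. linear_extension (*) (\<lambda>z. delta (y \<otimes> z) x) h) f"
proof -
  have "finite (support (f \<otimes>\<^bsub>alg par\<^esub> h))"
    using finite_subset[OF support_alg_mult] assms by blast
  from linear_extension_point[OF this, symmetric] show ?thesis
    by (simp only: linear_extension_alg_mult[OF vector_space_complex assms])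
qed

lemma alg_mult_closed:
  assumes "f \<in> carrier (alg par)" "h \<in> carrier (alg par)"
  shows "f \<otimes>\<^bsub>alg par\<^esub> h \<in> carrier (alg par)"
proof -
  let ?P = "(\<lambda>p. fst p \<otimes> snd p) ` (support f \<times> support h)"
  have sub: "support (f \<otimes>\<^bsub>alg par\<^esub> h) \<subseteq> ?P" by (rule support_alg_mult)
  have fin: "finite ?P" using assms by (simp add: alg_carrier)
  have P: "?P \<subseteq> carrier G"
    using assms unfolding alg_carrier by (intro image_subsetI m_closed) auto
  show ?thesis
    unfolding alg_carrier using finite_subset[OF sub fin] subset_trans[OF sub P] by (rule conjI)
qed

lemma delta_carrier: "g \<in> carrier G \<Longrightarrow> delta g \<in> carrier (alg par)"
  by (simp add: alg_carrier support_delta)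

lemma embed_carrier: "embed (alg par) c \<in> carrier (alg par)"
  by (auto simp: alg_carrier alg_embed support_def delta_def)

lemma alg_mult_delta:
  "delta g \<otimes>\<^bsub>alg par\<^esub> delta h = delta (g \<otimes> h)"
  by (rule ext, subst alg_mult_point)
    (simp_all add: support_delta complex_scalars.linear_extension_delta)

lemma embed_eq: "embed (alg par) c \<otimes>\<^bsub>alg par\<^esub> f = (\<lambda>x. c * f x)"
  and embed_eq': "f \<otimes>\<^bsub>alg par\<^esub> embed (alg par) c = (\<lambda>x. c * f x)"
  if f: "f \<in> carrier (alg par)"
proof -
  have fin: "finite (support f)" "finite (support (\<lambda>x. c * delta \<one> x))" "finite (support (delta \<one>))"
    using f embed_carrier[of par c] by (auto simp: alg_carrier alg_embed support_delta)
  have supp: "g \<in> support f \<Longrightarrow> g \<in> carrier G" for g using f by (auto simp: alg_carrier)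
  show "embed (alg par) c \<otimes>\<^bsub>alg par\<^esub> f = (\<lambda>x. c * f x)"
  proof
    fix x
    have "linear_extension (*) (\<lambda>z. delta (\<one> \<otimes> z) x) f = linear_extension (*) (\<lambda>z. delta z x) f"
      by (rule complex_scalars.linear_extension_cong) (simp add: supp)
    then show "(embed (alg par) c \<otimes>\<^bsub>alg par\<^esub> f) x = c * f x"
      unfolding alg_embed
      by (simp add: alg_mult_point[OF fin(2) fin(1)] complex_scalars.linear_extension_scale[OF fin(3)]
          complex_scalars.linear_extension_delta linear_extension_point[OF fin(1)])
  qed
  show "f \<otimes>\<^bsub>alg par\<^esub> embed (alg par) c = (\<lambda>x. c * f x)"
  proof
    fix x
    have "(f \<otimes>\<^bsub>alg par\<^esub> embed (alg par) c) x =
        linear_extension (*) (\<lambda>y. c * delta (y \<otimes> \<one>) x) f"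
      unfolding alg_embed
      by (simp add: alg_mult_point[OF fin(1) fin(2)] complex_scalars.linear_extension_scale[OF fin(3)]
          complex_scalars.linear_extension_delta)
    also have "\<dots> = c * linear_extension (*) (\<lambda>y. delta y x) f"
      unfolding linear_extension_def sum_distrib_left
      by (rule sum.cong) (auto simp: supp)
    finally show "(f \<otimes>\<^bsub>alg par\<^esub> embed (alg par) c) x = c * f x"
      by (simp add: linear_extension_point[OF fin(1)])
  qed
qed

lemma alg_mult_assoc:
  assumes "f \<in> carrier (alg par)" "h \<in> carrier (alg par)" "k \<in> carrier (alg par)"
  shows "(f \<otimes>\<^bsub>alg par\<^esub> h) \<otimes>\<^bsub>alg par\<^esub> k = f \<otimes>\<^bsub>alg par\<^esub> (h \<otimes>\<^bsub>alg par\<^esub> k)"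
proof
  fix x
  have fin: "finite (support f)" "finite (support h)" "finite (support k)"
    "finite (support (f \<otimes>\<^bsub>alg par\<^esub> h))" "finite (support (h \<otimes>\<^bsub>alg par\<^esub> k))"
    using assms alg_mult_closed[OF assms(1,2)] alg_mult_closed[OF assms(2,3)]
    by (auto simp: alg_carrier)
  note V = vector_space_complex
  have "((f \<otimes>\<^bsub>alg par\<^esub> h) \<otimes>\<^bsub>alg par\<^esub> k) x = linear_extension (*) (\<lambda>y. linear_extension (*)
      (\<lambda>z. linear_extension (*) (\<lambda>w. delta (y \<otimes> z \<otimes> w) x) k) h) f"
    unfolding alg_mult_point[OF fin(4,3)] linear_extension_alg_mult[OF V fin(1,2)] ..
  also have "\<dots> = linear_extension (*) (\<lambda>y. linear_extension (*)
      (\<lambda>z. linear_extension (*) (\<lambda>w. delta (y \<otimes> (z \<otimes> w)) x) k) h) f"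
    using assms by (intro complex_scalars.linear_extension_cong) (auto simp: alg_carrier m_assoc subset_iff)
  also have "\<dots> = (f \<otimes>\<^bsub>alg par\<^esub> (h \<otimes>\<^bsub>alg par\<^esub> k)) x"
    unfolding alg_mult_point[OF fin(1,5)] linear_extension_alg_mult[OF V fin(2,3)] ..
  finally show "((f \<otimes>\<^bsub>alg par\<^esub> h) \<otimes>\<^bsub>alg par\<^esub> k) x = (f \<otimes>\<^bsub>alg par\<^esub> (h \<otimes>\<^bsub>alg par\<^esub> k)) x" .
qed

lemma alg_add_closed:
  assumes "f \<in> carrier (alg par)" "h \<in> carrier (alg par)"
  shows "(\<lambda>x. f x + h x) \<in> carrier (alg par)"
proof -
  have sub: "support (\<lambda>x. f x + h x) \<subseteq> support f \<union> support h" by (auto simp: support_def)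
  have fin: "finite (support f \<union> support h)" and P: "support f \<union> support h \<subseteq> carrier G"
    using assms by (auto simp: alg_carrier)
  show ?thesis
    unfolding alg_carrier using finite_subset[OF sub fin] subset_trans[OF sub P] by (rule conjI)
qed

lemma alg_distrib_left:
  assumes "f \<in> carrier (alg par)" "h \<in> carrier (alg par)" "k \<in> carrier (alg par)"
  shows "(\<lambda>x. f x + h x) \<otimes>\<^bsub>alg par\<^esub> k = (\<lambda>x. (f \<otimes>\<^bsub>alg par\<^esub> k) x + (h \<otimes>\<^bsub>alg par\<^esub> k) x)"
proof
  fix x
  have fin: "finite (support f)" "finite (support h)" "finite (support k)"
    "finite (support (\<lambda>x. f x + h x))"
    using assms alg_add_closed[OF assms(1,2)] by (auto simp: alg_carrier)
  show "((\<lambda>x. f x + h x) \<otimes>\<^bsub>alg par\<^esub> k) x = (f \<otimes>\<^bsub>alg par\<^esub> k) x + (h \<otimes>\<^bsub>alg par\<^esub> k) x"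
    unfolding alg_mult_point[OF fin(4,3)] alg_mult_point[OF fin(1,3)] alg_mult_point[OF fin(2,3)]
    by (rule complex_scalars.linear_extension_add[OF fin(1,2)])
qed

lemma alg_distrib_right:
  assumes "f \<in> carrier (alg par)" "h \<in> carrier (alg par)" "k \<in> carrier (alg par)"
  shows "k \<otimes>\<^bsub>alg par\<^esub> (\<lambda>x. f x + h x) = (\<lambda>x. (k \<otimes>\<^bsub>alg par\<^esub> f) x + (k \<otimes>\<^bsub>alg par\<^esub> h) x)"
proof
  fix x
  have fin: "finite (support f)" "finite (support h)" "finite (support k)"
    "finite (support (\<lambda>x. f x + h x))"
    using assms alg_add_closed[OF assms(1,2)] by (auto simp: alg_carrier)
  show "(k \<otimes>\<^bsub>alg par\<^esub> (\<lambda>x. f x + h x)) x = (k \<otimes>\<^bsub>alg par\<^esub> f) x + (k \<otimes>\<^bsub>alg par\<^esub> h) x"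
    unfolding alg_mult_point[OF fin(3,4)] alg_mult_point[OF fin(3,1)] alg_mult_point[OF fin(3,2)]
      complex_scalars.linear_extension_add[OF fin(1,2)]
    by (simp add: linear_extension_def[of _ _ k] sum.distrib distrib_left)
qed

lemma ring_alg: "ring (alg par)"
proof (rule Ring.ringI)
  show "abelian_group (alg par)"
  proof (rule abelian_groupI)
    fix f assume f: "f \<in> carrier (alg par)"
    have "(\<lambda>x. - f x) \<in> carrier (alg par)" using f by (simp add: alg_carrier support_def)
    then show "\<exists>h\<in>carrier (alg par). h \<oplus>\<^bsub>alg par\<^esub> f = \<zero>\<^bsub>alg par\<^esub>"
      by (intro bexI[of _ "\<lambda>x. - f x"]) (auto simp: alg_add alg_zero)
    show "\<zero>\<^bsub>alg par\<^esub> \<oplus>\<^bsub>alg par\<^esub> f = f" by (simp add: alg_add alg_zero)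
    fix h assume h: "h \<in> carrier (alg par)"
    show "f \<oplus>\<^bsub>alg par\<^esub> h \<in> carrier (alg par)"
      using alg_add_closed[OF f h] by (simp add: alg_add)
    show "f \<oplus>\<^bsub>alg par\<^esub> h = h \<oplus>\<^bsub>alg par\<^esub> f" by (simp add: alg_add add.commute)
    fix k
    show "(f \<oplus>\<^bsub>alg par\<^esub> h) \<oplus>\<^bsub>alg par\<^esub> k = f \<oplus>\<^bsub>alg par\<^esub> (h \<oplus>\<^bsub>alg par\<^esub> k)"
      by (simp add: alg_add add.assoc)
  next
    show "\<zero>\<^bsub>alg par\<^esub> \<in> carrier (alg par)" by (simp add: alg_zero alg_carrier support_def)
  qed
  show "Group.monoid (alg par)"
  proof (rule monoidI)
    show "\<one>\<^bsub>alg par\<^esub> \<in> carrier (alg par)" by (simp add: alg_one delta_carrier)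
    fix f assume f: "f \<in> carrier (alg par)"
    have one: "\<one>\<^bsub>alg par\<^esub> = embed (alg par) 1" by (simp add: alg_one alg_embed)
    show "\<one>\<^bsub>alg par\<^esub> \<otimes>\<^bsub>alg par\<^esub> f = f" "f \<otimes>\<^bsub>alg par\<^esub> \<one>\<^bsub>alg par\<^esub> = f"
      unfolding one by (simp_all add: embed_eq[OF f] embed_eq'[OF f])
  qed (fact alg_mult_closed alg_mult_assoc)+
next
  fix f h k assume fhk: "f \<in> carrier (alg par)" "h \<in> carrier (alg par)" "k \<in> carrier (alg par)"
  show "(f \<oplus>\<^bsub>alg par\<^esub> h) \<otimes>\<^bsub>alg par\<^esub> k = f \<otimes>\<^bsub>alg par\<^esub> k \<oplus>\<^bsub>alg par\<^esub> h \<otimes>\<^bsub>alg par\<^esub> k"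
    unfolding alg_add by (rule alg_distrib_left[OF fhk])
  show "k \<otimes>\<^bsub>alg par\<^esub> (f \<oplus>\<^bsub>alg par\<^esub> h) = k \<otimes>\<^bsub>alg par\<^esub> f \<oplus>\<^bsub>alg par\<^esub> k \<otimes>\<^bsub>alg par\<^esub> h"
    unfolding alg_add by (rule alg_distrib_right[OF fhk])
qed

end


section \<open>Modules over quotients of monoid algebras\<close>

lemma quotient_carrier: "carrier (quotient_superalgebra A I) = (\<lambda>f. I +>\<^bsub>A\<^esub> f) ` carrier A"
  and quotient_add: "x \<oplus>\<^bsub>quotient_superalgebra A I\<^esub> y = x \<oplus>\<^bsub>A Quot I\<^esub> y"
  and quotient_mult: "x \<otimes>\<^bsub>quotient_superalgebra A I\<^esub> y = x \<otimes>\<^bsub>A Quot I\<^esub> y"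
  and quotient_embed: "embed (quotient_superalgebra A I) c = I +>\<^bsub>A\<^esub> embed A c"
  and quotient_homog: "homog (quotient_superalgebra A I) i = (\<lambda>a. I +>\<^bsub>A\<^esub> a) ` homog A i"
  by (auto simp: quotient_superalgebra_def ring.defs superalgebra.defs FactRing_def A_RCOSETS_def'
      a_r_coset_def)

text \<open>The spin algebra and the Clifford algebra are both quotients of monoid algebras, of the double
cover and of the free monoid respectively, so their modules share this setting. By \<open>act_coset\<close> the action
is determined by the operators \<open>op g\<close> of the monoid elements.\<close>

locale quotient_module =
  fixes G :: "('g, 'r) monoid_scheme" (structure) and par :: "'g \<Rightarrow> bit"
    and I :: "('g \<Rightarrow> complex) set" and M :: "(('g \<Rightarrow> complex) set, 'm::ab_group_add) supermod"
  assumes monoid_G: "Group.monoid G"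
    and ideal_I: "ideal I (monoid_superalgebra G par)"
    and supermodule_M: "supermodule (quotient_superalgebra (monoid_superalgebra G par) I) M"
begin

abbreviation "A \<equiv> monoid_superalgebra G par"
abbreviation "Q \<equiv> quotient_superalgebra A I"
abbreviation "coset f \<equiv> I +>\<^bsub>A\<^esub> f"
definition "op g = act M (coset (delta g))"

sublocale Group.monoid G by (rule monoid_G)
sublocale complex_vector_space "scal M"
  by (rule complex_vector_space.intro[OF supermodule.vector_space[OF supermodule_M]])

lemmas M_subspace = supermodule.subspace[OF supermodule_M]
  and M_direct = supermodule.direct[OF supermodule_M]
  and M_graded = supermodule.graded[OF supermodule_M]
  and M_closed = supermodule.act_closed[OF supermodule_M]
  and M_plus = supermodule.act_plus[OF supermodule_M]
  and M_add = supermodule.act_add[OF supermodule_M]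
  and M_mult = supermodule.act_mult[OF supermodule_M]
  and M_embed = supermodule.act_embed[OF supermodule_M]

lemma coset_hom: "(+>\<^bsub>A\<^esub>) I \<in> ring_hom A (A Quot I)"
  by (rule ideal.rcos_ring_hom[OF ideal_I])

lemma coset_carrier: "f \<in> carrier A \<Longrightarrow> coset f \<in> carrier Q"
  by (simp add: quotient_carrier)

lemma coset_add:
  "f \<in> carrier A \<Longrightarrow> h \<in> carrier A \<Longrightarrow> coset f \<oplus>\<^bsub>Q\<^esub> coset h = coset (\<lambda>x. f x + h x)"
  using ring_hom_add[OF coset_hom, of f h] by (simp add: quotient_add alg_add)

lemma coset_mult:
  "f \<in> carrier A \<Longrightarrow> h \<in> carrier A \<Longrightarrow> coset f \<otimes>\<^bsub>Q\<^esub> coset h = coset (f \<otimes>\<^bsub>A\<^esub> h)"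
  using ring_hom_mult[OF coset_hom, of f h] by (simp add: quotient_mult)

lemma vectors_subspace: "subspace (vectors M)"
  unfolding vectors_def by (rule subspace_sums[OF M_subspace M_subspace])

lemma piece_subset_vectors: "piece M i \<subseteq> vectors M"
proof
  fix x assume x: "x \<in> piece M i"
  have "x = x + 0" "x = 0 + x" by auto
  then show "x \<in> vectors M"
    using x subspace_0[OF M_subspace] unfolding vectors_def by (cases i) blast+
qed

text \<open>The scalar \<open>c\<close> acts as the element \<open>embed c\<close>, which is central.\<close>

lemma act_scale:
  assumes a: "a \<in> carrier Q" and x: "x \<in> vectors M"
  shows "act M a (scal M c x) = scal M c (act M a x)"
proof -
  obtain f where f: "f \<in> carrier A" "a = coset f" using a by (auto simp: quotient_carrier)
  have e: "embed Q c \<in> carrier Q" by (simp add: quotient_embed coset_carrier embed_carrier)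
  have "a \<otimes>\<^bsub>Q\<^esub> embed Q c = embed Q c \<otimes>\<^bsub>Q\<^esub> a"
    by (simp add: f quotient_embed coset_mult embed_carrier embed_eq embed_eq')
  moreover have "act M (a \<otimes>\<^bsub>Q\<^esub> embed Q c) x = act M a (scal M c x)"
    using M_mult[OF a e x] M_embed[OF x] by simp
  moreover have "act M (embed Q c \<otimes>\<^bsub>Q\<^esub> a) x = scal M c (act M a x)"
    using M_mult[OF e a x] M_embed[OF M_closed[OF a x]] by simp
  ultimately show ?thesis by simp
qed

lemma act_linear:
  assumes "a \<in> carrier Q"
  shows "linear_between (scal M) (vectors M) (scal M) (vectors M) (act M a)"
  using assms by (intro linear_betweenI M_closed M_plus act_scale)

lemma op_linear:
  "g \<in> carrier G \<Longrightarrow> linear_between (scal M) (vectors M) (scal M) (vectors M) (op g)"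
  unfolding op_def by (intro act_linear coset_carrier delta_carrier)

text \<open>Point masses are split off one at a time, by induction on a finite set that contains the
support.\<close>

lemma act_coset:
  assumes f: "f \<in> carrier A" and x: "x \<in> vectors M"
  shows "act M (coset f) x = linear_extension (scal M) (\<lambda>g. op g x) f"
proof -
  have zero: "(\<lambda>_. 0) \<in> carrier A" by (simp add: alg_carrier support_def)
  have "f \<in> carrier A \<Longrightarrow> support f \<subseteq> S \<Longrightarrow>
      act M (coset f) x = linear_extension (scal M) (\<lambda>g. op g x) f"
    if "finite S" for S
    using that
  proof (induction S arbitrary: f)
    case empty
    then have f: "f = (\<lambda>_. 0)" by (auto simp: support_def)
    have "act M (coset (\<lambda>_. 0)) x + act M (coset (\<lambda>_. 0)) x = act M (coset (\<lambda>_. 0)) x"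
      using M_add[OF coset_carrier[OF zero] coset_carrier[OF zero] x]
      by (simp add: coset_add[OF zero zero])
    then show ?case by (simp add: f linear_extension_zero)
  next
    case (insert g S)
    show ?case
    proof (cases "g \<in> support f")
      case False
      then show ?thesis using insert by auto
    next
      case True
      then have g: "g \<in> carrier G" using insert.prems by (auto simp: alg_carrier)
      define h where "h = f(g := 0)"
      have sh: "support h \<subseteq> support f" "support h \<subseteq> S"
        using insert.prems by (auto simp: h_def support_def split: if_splits)
      have h: "h \<in> carrier A"
        using insert.prems(1) sh(1) finite_subset by (auto simp: alg_carrier)
      let ?d = "\<lambda>y. f g * delta g y"
      have d: "?d = embed A (f g) \<otimes>\<^bsub>A\<^esub> delta g" by (simp add: embed_eq delta_carrier g)
      have dc: "?d \<in> carrier A" unfolding d by (intro alg_mult_closed embed_carrier delta_carrier g)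
      have f_eq: "f = (\<lambda>y. h y + ?d y)" by (auto simp: h_def delta_def)
      have ds: "finite (support (delta g))" by (simp add: support_delta)
      have "act M (coset ?d) x = scal M (f g) (op g x)"
        using M_mult[OF coset_carrier[OF embed_carrier] coset_carrier[OF delta_carrier[OF g]] x]
          M_embed[OF M_closed[OF coset_carrier[OF delta_carrier[OF g]] x]]
        unfolding d by (simp add: coset_mult embed_carrier delta_carrier g op_def quotient_embed)
      moreover have "act M (coset f) x = act M (coset h) x + act M (coset ?d) x"
        by (subst f_eq) (metis M_add[OF coset_carrier[OF h] coset_carrier[OF dc] x] coset_add[OF h dc])
      moreover have "linear_extension (scal M) (\<lambda>g. op g x) f =
          linear_extension (scal M) (\<lambda>g. op g x) h + scal M (f g) (op g x)"
        using h dc linear_extension_add[of h ?d "\<lambda>g. op g x"]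
        by (subst f_eq) (simp add: alg_carrier linear_extension_scale[OF ds] linear_extension_delta)
      ultimately show ?thesis using insert.IH[OF h sh(2)] by simp
    qed
  qed
  from this[OF _ f] show ?thesis using f by (auto simp: alg_carrier)
qed

lemma op_mult:
  "g \<in> carrier G \<Longrightarrow> h \<in> carrier G \<Longrightarrow> x \<in> vectors M \<Longrightarrow> op (g \<otimes> h) x = op g (op h x)"
  using M_mult[of "coset (delta g)" "coset (delta h)" x]
  by (simp add: op_def coset_carrier delta_carrier coset_mult alg_mult_delta)

lemma op_one: "x \<in> vectors M \<Longrightarrow> op \<one> x = x"
  using M_embed[of x 1] by (simp add: op_def quotient_embed alg_embed)

lemma op_group_rep: "group_rep G (scal M) (vectors M) op"
  using op_linear op_mult op_one by (simp add: group_rep_def)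

lemma op_graded:
  assumes "g \<in> carrier G" "x \<in> piece M j"
  shows "op g x \<in> piece M (par g + j)"
proof -
  have "support (delta g) = {g}" by (rule support_delta)
  then have "delta g \<in> homog A (par g)"
    using assms(1) by (auto simp: monoid_superalgebra_def support_def)
  then show ?thesis
    unfolding op_def using assms(2) by (intro M_graded) (simp add: quotient_homog)
qed

lemma span_graded_submodule:
  assumes X: "X \<subseteq> piece M 0 \<union> piece M 1"
    and op: "\<And>g x. g \<in> carrier G \<Longrightarrow> x \<in> X \<Longrightarrow> op g x \<in> span X"
  shows "graded_submodule Q M (span X)"
  unfolding graded_submodule_def
proof (intro conjI ballI)
  have XV: "span X \<subseteq> vectors M"
    using X piece_subset_vectors by (intro span_minimal vectors_subspace) blast
  show "subspace (span X)" by (rule subspace_span)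
  let ?P = "\<lambda>i. span X \<inter> piece M i"
  let ?U = "{x + y |x y. x \<in> ?P 0 \<and> y \<in> ?P 1}"
  have P: "subspace (?P i)" for i by (intro subspace_inter subspace_span M_subspace)
  show "span X = ?U"
  proof
    show "?U \<subseteq> span X" by (auto intro: span_add)
    have "subspace ?U" by (rule subspace_sums[OF P P])
    moreover have "X \<subseteq> ?U"
    proof
      fix x assume x: "x \<in> X"
      have "x = x + 0" "x = 0 + x" by auto
      then show "x \<in> ?U" using x X span_base[OF x] subspace_0[OF P] by blast
    qed
    ultimately show "span X \<subseteq> ?U" by (rule span_minimal[rotated])
  qed
  fix a x assume a: "a \<in> carrier Q" and x: "x \<in> span X"
  have op_span: "op g x \<in> span X" if g: "g \<in> carrier G" for g
    by (rule linear_between_in_span[OF vector_space_axioms vectors_subspace op_linear[OF g]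
          subset_trans[OF span_superset XV] op[OF g] x])
  obtain f where f: "f \<in> carrier A" "a = coset f" using a by (auto simp: quotient_carrier)
  have "act M a x = linear_extension (scal M) (\<lambda>g. op g x) f"
    using act_coset[OF f(1)] x XV f(2) by auto
  also have "\<dots> \<in> span X"
    using f(1) op_span by (intro linear_extension_in_subspace subspace_span) (auto simp: alg_carrier)
  finally show "act M a x \<in> span X" .
qed

text \<open>The action on \<open>N\<close> enters only as the linear extension of operators \<open>\<tau> g\<close>. This is the form in
which it is available for the tensor product, whose action is defined through chosen representatives.\<close>

lemma hom_space_eq_intertwiners:
  assumes "vector_space (scal N)" "module.subspace (scal N) (vectors N)"
    and N: "\<And>f y. f \<in> carrier A \<Longrightarrow> y \<in> vectors N \<Longrightarrow>
      act N (coset f) y = linear_extension (scal N) (\<lambda>g. \<tau> g y) f"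
    and \<tau>: "\<And>g y. g \<in> carrier G \<Longrightarrow> y \<in> vectors N \<Longrightarrow> \<tau> g y \<in> vectors N"
  shows "hom_space Q M N = intertwiners G (scal M) (vectors M) op (scal N) (vectors N) \<tau>"
proof -
  interpret N: complex_vector_space "scal N" by (rule complex_vector_space.intro) fact
  have "(\<forall>a\<in>carrier Q. \<forall>x\<in>vectors M. \<phi> (act M a x) = act N a (\<phi> x)) \<longleftrightarrow>
      (\<forall>g\<in>carrier G. \<forall>x\<in>vectors M. \<phi> (op g x) = \<tau> g (\<phi> x))"
    if \<phi>: "linear_between (scal M) (vectors M) (scal N) (vectors N) \<phi>" for \<phi>
  proof (intro iffI ballI)
    fix g x assume g: "g \<in> carrier G" and x: "x \<in> vectors M"
      and *: "\<forall>a\<in>carrier Q. \<forall>x\<in>vectors M. \<phi> (act M a x) = act N a (\<phi> x)"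
    have "\<phi> (op g x) = act N (coset (delta g)) (\<phi> x)"
      using * g x by (simp add: op_def coset_carrier delta_carrier)
    also have "\<dots> = \<tau> g (\<phi> x)"
      using g x linear_betweenD(1)[OF \<phi>] by (simp add: N delta_carrier N.linear_extension_delta)
    finally show "\<phi> (op g x) = \<tau> g (\<phi> x)" .
  next
    fix a x assume a: "a \<in> carrier Q" and x: "x \<in> vectors M"
      and *: "\<forall>g\<in>carrier G. \<forall>x\<in>vectors M. \<phi> (op g x) = \<tau> g (\<phi> x)"
    obtain f where f: "f \<in> carrier A" "a = coset f" using a by (auto simp: quotient_carrier)
    have sup: "g \<in> carrier G" if "g \<in> support f" for g using f that by (auto simp: alg_carrier)
    have op: "op g x \<in> vectors M" if "g \<in> support f" for g
      using linear_betweenD(1)[OF op_linear[OF sup[OF that]] x] .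
    have "\<phi> (act M a x) = \<phi> (\<Sum>g\<in>support f. scal M (f g) (op g x))"
      using act_coset[OF f(1) x] f(2) by (simp add: linear_extension_def)
    also have "\<dots> = (\<Sum>g\<in>support f. \<phi> (scal M (f g) (op g x)))"
      using op by (intro linear_between_sum[OF \<phi> vector_space_axioms vectors_subspace]
          subspace_scale[OF vectors_subspace])
    also have "\<dots> = (\<Sum>g\<in>support f. scal N (f g) (\<tau> g (\<phi> x)))"
      using op sup * x linear_betweenD(3)[OF \<phi>] by (intro sum.cong) auto
    also have "\<dots> = act N a (\<phi> x)"
      using N[OF f(1) linear_betweenD(1)[OF \<phi> x]] f(2) by (simp add: linear_extension_def)
    finally show "\<phi> (act M a x) = act N a (\<phi> x)" .
  qed
  then show ?thesis
    unfolding hom_space_def intertwiners_def linear_maps_def linear_between_def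
    by (intro Collect_cong) (auto simp: linear_between_def)
qed

lemma simple_homogeneous_vector:
  assumes "simple_supermodule Q M"
  obtains x i where "x \<in> piece M i" "x \<noteq> 0"
proof -
  have "vectors M \<noteq> {0}" using assms by (simp add: simple_supermodule_def)
  moreover have "0 \<in> vectors M" by (rule subspace_0[OF vectors_subspace])
  ultimately obtain v where "v \<in> vectors M" "v \<noteq> 0" by blast
  then obtain x y where xy: "x \<in> piece M 0" "y \<in> piece M 1" "x + y \<noteq> 0"
    by (auto simp: vectors_def)
  show ?thesis
  proof (cases "x = 0")
    case True
    then show ?thesis using that[of y 1] xy by simp
  next
    case False
    then show ?thesis using that[of x 0] xy by simp
  qed
qed

lemma simple_span:
  assumes "simple_supermodule Q M" and X: "X \<subseteq> piece M 0 \<union> piece M 1"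
    and op: "\<And>g x. g \<in> carrier G \<Longrightarrow> x \<in> X \<Longrightarrow> op g x \<in> span X"
    and "x \<in> X" "x \<noteq> 0"
  shows "span X = vectors M"
proof -
  have "span X \<noteq> {0}" using assms(4,5) span_base by blast
  then show ?thesis
    using assms(1) span_graded_submodule[OF X op] by (auto simp: simple_supermodule_def)
qed

text \<open>The finite orbit of a nonzero homogeneous vector spans a graded submodule.\<close>

lemma simple_finite_frame:
  assumes simple: "simple_supermodule Q M" and fin: "finite (carrier G)"
  shows "\<exists>Y. frame (scal M) (vectors M) Y (\<lambda>b. b) (\<lambda>b x. representation Y x b)"
proof -
  obtain x i where x: "x \<in> piece M i" "x \<noteq> 0" by (rule simple_homogeneous_vector[OF simple])
  have xV: "x \<in> vectors M" using x piece_subset_vectors by blast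
  let ?X = "(\<lambda>g. op g x) ` carrier G"
  have "span ?X = vectors M"
  proof (rule simple_span[OF simple])
    show "?X \<subseteq> piece M 0 \<union> piece M 1"
    proof
      fix y assume "y \<in> ?X"
      then obtain g where "g \<in> carrier G" "y = op g x" by auto
      then have "y \<in> piece M (par g + i)" using op_graded x by simp
      then show "y \<in> piece M 0 \<union> piece M 1" by (cases "par g + i") auto
    qed
    show "op g y \<in> span ?X" if "g \<in> carrier G" "y \<in> ?X" for g y
    proof -
      obtain h where h: "h \<in> carrier G" "y = op h x" using \<open>y \<in> ?X\<close> by auto
      then have "op g y = op (g \<otimes> h) x" using that xV by (simp add: op_mult)
      also have "\<dots> \<in> ?X" using that h by (intro imageI) simp
      finally show ?thesis by (rule span_base)
    qed
    show "x \<in> ?X" using op_one[OF xV] by (intro image_eqI[of _ _ \<one>]) auto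
    show "x \<noteq> 0" by fact
  qed
  then show ?thesis
    using frame_exists_of_finite_span[OF vector_space_axioms finite_imageI[OF fin]] by blast
qed

text \<open>The grading operator, equal to \<open>1\<close> on the even piece and to \<open>-1\<close> on the odd piece.\<close>

definition sign where
  "sign v = (let p = (SOME p. fst p \<in> piece M 0 \<and> snd p \<in> piece M 1 \<and> v = fst p + snd p)
    in fst p - snd p)"

lemma sign_sum:
  assumes x: "x \<in> piece M 0" and y: "y \<in> piece M 1"
  shows "sign (x + y) = x - y"
proof -
  define p where "p = (SOME p. fst p \<in> piece M 0 \<and> snd p \<in> piece M 1 \<and> x + y = fst p + snd p)"
  have "\<exists>p. fst p \<in> piece M 0 \<and> snd p \<in> piece M 1 \<and> x + y = fst p + snd p"
    using x y by (intro exI[of _ "(x, y)"]) simp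
  then have p: "fst p \<in> piece M 0" "snd p \<in> piece M 1" "x + y = fst p + snd p"
    unfolding p_def by (metis (mono_tags, lifting) someI_ex)+
  have eq: "x - fst p = snd p - y" using p(3) by (simp add: algebra_simps)
  have "x - fst p \<in> piece M 0" by (rule subspace_diff[OF M_subspace x p(1)])
  moreover have "x - fst p \<in> piece M 1" unfolding eq by (rule subspace_diff[OF M_subspace p(2) y])
  ultimately have "x - fst p \<in> {0}" using M_direct by blast
  then have "fst p = x" "snd p = y" using eq by simp_all
  then show ?thesis by (simp add: sign_def p_def[symmetric] Let_def)
qed

lemma vectors_cases:
  assumes "v \<in> vectors M"
  obtains x y where "x \<in> piece M 0" "y \<in> piece M 1" "v = x + y"
  using assms by (auto simp: vectors_def)

lemma vectorsI: "x \<in> piece M 0 \<Longrightarrow> y \<in> piece M 1 \<Longrightarrow> x + y \<in> vectors M"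
  by (auto simp: vectors_def)

lemma sign_vectors: "v \<in> vectors M \<Longrightarrow> sign v \<in> vectors M"
  and sign_sign: "v \<in> vectors M \<Longrightarrow> sign (sign v) = v"
proof -
  assume "v \<in> vectors M"
  then obtain x y where xy: "x \<in> piece M 0" "y \<in> piece M 1" "v = x + y" by (rule vectors_cases)
  have y': "- y \<in> piece M 1" using subspace_neg[OF M_subspace] xy by simp
  show "sign v \<in> vectors M" using vectorsI[OF xy(1) y'] by (simp add: xy sign_sum)
  show "sign (sign v) = v" using sign_sum[OF xy(1) y'] by (simp add: xy sign_sum)
qed

lemma sign_linear: "linear_between (scal M) (vectors M) (scal M) (vectors M) sign"
proof (rule linear_betweenI)
  fix v assume v: "v \<in> vectors M"
  show "sign v \<in> vectors M" by (rule sign_vectors[OF v])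
  obtain x y where xy: "x \<in> piece M 0" "y \<in> piece M 1" "v = x + y" using v by (rule vectors_cases)
  show "sign (v + w) = sign v + sign w" if w: "w \<in> vectors M" for w
  proof -
    obtain x' y' where xy': "x' \<in> piece M 0" "y' \<in> piece M 1" "w = x' + y'" using w by (rule vectors_cases)
    have "sign (v + w) = sign ((x + x') + (y + y'))" by (simp add: xy xy' algebra_simps)
    also have "\<dots> = (x + x') - (y + y')"
      using xy xy' subspace_add[OF M_subspace] by (intro sign_sum) auto
    also have "\<dots> = sign v + sign w" by (simp add: xy xy' sign_sum algebra_simps)
    finally show ?thesis .
  qed
  show "sign (scal M c v) = scal M c (sign v)" for c
    using xy sign_sum[of "scal M c x" "scal M c y"] subspace_scale[OF M_subspace]
    by (simp add: sign_sum scale_right_distrib scale_right_diff_distrib)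
qed

lemma op_sign_odd:
  assumes g: "g \<in> carrier G" "par g = 1" and v: "v \<in> vectors M"
  shows "op g (sign v) = - sign (op g v)"
proof -
  note lin = linear_betweenD[OF op_linear[OF g(1)]]
  obtain x y where xy: "x \<in> piece M 0" "y \<in> piece M 1" "v = x + y" using v by (rule vectors_cases)
  have V: "x \<in> vectors M" "y \<in> vectors M" "- y \<in> vectors M"
    using xy piece_subset_vectors[of 0] piece_subset_vectors[of 1] subspace_neg[OF vectors_subspace]
    by (simp_all add: subset_iff)
  have gx: "op g x \<in> piece M 1" and gy: "op g y \<in> piece M 0"
    using op_graded[OF g(1) xy(1)] op_graded[OF g(1) xy(2)] g(2) by simp_all
  have "op g (- y) = - op g y" using lin(3)[OF V(2), of "-1"] by simp
  then have "op g (sign v) = op g x - op g y"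
    using lin(2)[OF V(1) V(3)] by (simp add: xy sign_sum)
  moreover have "sign (op g v) = op g y - op g x"
    using sign_sum[OF gy gx] lin(2)[OF V(1,2)] by (simp add: xy add.commute)
  ultimately show ?thesis by simp
qed

text \<open>An odd element anticommutes with the grading operator, which is an involution; conjugation by it
therefore negates the trace without changing it.\<close>

lemma frame_trace_odd:
  assumes F: "frame (scal M) (vectors M) J e c" and g: "g \<in> carrier G" "par g = 1"
  shows "frame_trace J e c (op g) = 0"
proof -
  note lin = op_linear[OF g(1)]
  have V: "e j \<in> vectors M" if "j \<in> J" for j using frameD(4)[OF F that] .
  have "frame_trace J e c (op g) = frame_trace J e c (\<lambda>v. sign (sign (op g v)))"
    unfolding frame_trace_def
    using sign_sign[OF linear_betweenD(1)[OF lin V]] by simp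
  also have "\<dots> = frame_trace J e c (\<lambda>v. sign (op g (sign v)))"
    by (rule frame_trace_commute[OF F F linear_between_compose[OF lin sign_linear] sign_linear])
  also have "\<dots> = frame_trace J e c (\<lambda>v. - op g v)"
    unfolding frame_trace_def
  proof (rule sum.cong[OF HOL.refl])
    fix j assume j: "j \<in> J"
    have "op g (sign (sign (e j))) = - sign (op g (sign (e j)))"
      by (rule op_sign_odd[OF g sign_vectors[OF V[OF j]]])
    then show "c j (sign (op g (sign (e j)))) = c j (- op g (e j))"
      using sign_sign[OF V[OF j]] by simp
  qed
  also have "\<dots> = - frame_trace J e c (op g)"
    unfolding frame_trace_def sum_negf[symmetric]
  proof (rule sum.cong[OF HOL.refl])
    fix j assume j: "j \<in> J"
    show "c j (- op g (e j)) = - c j (op g (e j))"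
      using linear_betweenD(3)[OF frameD(5)[OF F j] linear_betweenD(1)[OF lin V[OF j]], of "-1"]
      by simp
  qed
  finally show ?thesis by simp
qed

end


section \<open>Presented groups and conjugacy classes\<close>

lemma pres_eq_append:
  assumes "pres_eq R u u'" "pres_eq R v v'"
  shows "pres_eq R (u @ v) (u' @ v')"
proof -
  have "pres_eq R (u @ v) (u' @ v)" using pres_eq.congr[OF assms(1), of "[]" v] by simp
  moreover have "pres_eq R (u' @ v) (u' @ v')" using pres_eq.congr[OF assms(2), of u' "[]"] by simp
  ultimately show ?thesis by (rule pres_eq.trans)
qed

lemma word_class_eq_iff: "word_class R u = word_class R v \<longleftrightarrow> pres_eq R u v"
  unfolding word_class_def set_eq_iff mem_Collect_eq
  by (meson pres_eq.refl pres_eq.sym pres_eq.trans)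

lemma word_class_self: "u \<in> word_class R u"
  by (simp add: word_class_def pres_eq.refl)

lemma presented_mult:
  "word_class R u \<otimes>\<^bsub>presented_group R\<^esub> word_class R v = word_class R (u @ v)"
proof (intro Set.set_eqI iffI)
  fix w assume "w \<in> word_class R u \<otimes>\<^bsub>presented_group R\<^esub> word_class R v"
  then obtain a b where "pres_eq R u a" "pres_eq R v b" "pres_eq R (a @ b) w"
    by (auto simp: presented_group_def word_class_def)
  then show "w \<in> word_class R (u @ v)"
    using pres_eq.trans[OF pres_eq_append] by (auto simp: word_class_def)
next
  fix w assume "w \<in> word_class R (u @ v)"
  then show "w \<in> word_class R u \<otimes>\<^bsub>presented_group R\<^esub> word_class R v"
    using word_class_self[of u R] word_class_self[of v R]
    by (auto simp: presented_group_def word_class_def)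
qed

lemma presented_one: "\<one>\<^bsub>presented_group R\<^esub> = word_class R []"
  by (simp add: presented_group_def)

lemma presented_carrier: "carrier (presented_group R) = range (word_class R)"
  by (simp add: presented_group_def)

definition inverse_word :: "'g word \<Rightarrow> 'g word" where
  "inverse_word w = map (\<lambda>(x, e). (x, \<not> e)) (rev w)"

lemma inverse_word_inverse: "pres_eq R (inverse_word w @ w) []"
proof (induction w)
  case Nil
  show ?case by (simp add: inverse_word_def pres_eq.refl)
next
  case (Cons a w)
  obtain x e where a: "a = (x, e)" by fastforce
  have "pres_eq R (inverse_word w @ [(x, \<not> e), (x, \<not> \<not> e)] @ w) (inverse_word w @ [] @ w)"
    by (rule pres_eq.congr[OF pres_eq.cancel])
  with Cons show ?case
    by (auto simp: a inverse_word_def intro: pres_eq.trans)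
qed

lemma group_presented_group: "group (presented_group R)"
proof (rule groupI)
  fix x assume "x \<in> carrier (presented_group R)"
  then obtain w where w: "x = word_class R w" by (auto simp: presented_carrier)
  show "\<exists>y\<in>carrier (presented_group R). y \<otimes>\<^bsub>presented_group R\<^esub> x = \<one>\<^bsub>presented_group R\<^esub>"
    by (rule bexI[of _ "word_class R (inverse_word w)"])
      (auto simp: w presented_mult presented_one presented_carrier word_class_eq_iff inverse_word_inverse)
qed (auto simp: presented_carrier presented_mult presented_one)

lemma presented_inv_letter:
  "inv\<^bsub>presented_group R\<^esub> (word_class R [(x, True)]) = word_class R [(x, False)]"
  using pres_eq.cancel[of R x False]
  by (intro group.inv_equality[OF group_presented_group])
    (auto simp: presented_mult presented_one presented_carrier word_class_eq_iff)

context group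
begin

lemma word_eval_Nil: "word_eval G s [] = \<one>"
  and word_eval_Cons:
    "word_eval G s ((x, e) # w) = (if e then s x else inv (s x)) \<otimes> word_eval G s w"
  by (simp_all add: word_eval_def)

lemma word_eval_closed:
  assumes "range s \<subseteq> carrier G"
  shows "word_eval G s w \<in> carrier G"
proof (induction w)
  case (Cons a w)
  then show ?case using assms by (cases a) (auto simp: word_eval_Cons)
qed (simp add: word_eval_Nil)

lemma word_eval_append:
  assumes "range s \<subseteq> carrier G"
  shows "word_eval G s (u @ v) = word_eval G s u \<otimes> word_eval G s v"
proof (induction u)
  case (Cons a u)
  have "s x \<in> carrier G" for x using assms by auto
  with Cons show ?case
    using word_eval_closed[OF assms] by (cases a) (auto simp: word_eval_Cons m_assoc)
qed (simp add: word_eval_Nil word_eval_closed[OF assms])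

lemma word_eval_pres_eq:
  assumes s: "range s \<subseteq> carrier G"
    and R: "\<And>u v. (u, v) \<in> R \<Longrightarrow> word_eval G s u = word_eval G s v"
    and "pres_eq R u v"
  shows "word_eval G s u = word_eval G s v"
  using assms(3)
proof (induction rule: pres_eq.induct)
  case (cancel x e)
  have "s x \<in> carrier G" using s by auto
  then show ?case by (cases e) (auto simp: word_eval_Cons word_eval_Nil)
qed (auto simp: word_eval_append[OF s] R)

lemma generate_range_eq_words:
  assumes s: "range s \<subseteq> carrier G"
  shows "generate G (range s) = range (word_eval G s)"
proof
  show "generate G (range s) \<subseteq> range (word_eval G s)"
  proof
    fix x assume "x \<in> generate G (range s)"
    then show "x \<in> range (word_eval G s)"
    proof (induction rule: generate.induct)
      case one
      show ?case using word_eval_Nil[of s] by (metis rangeI)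
    next
      case (incl h)
      then obtain y where y: "h = s y" by auto
      then have "h = word_eval G s [(y, True)]"
        using s by (simp add: word_eval_Cons word_eval_Nil image_subset_iff)
      then show ?case by blast
    next
      case (inv h)
      then obtain y where y: "h = s y" by auto
      then have "inv h = word_eval G s [(y, False)]"
        using s by (simp add: word_eval_Cons word_eval_Nil image_subset_iff)
      then show ?case by blast
    next
      case (eng h1 h2)
      then obtain u v where "h1 = word_eval G s u" "h2 = word_eval G s v" by auto
      then have "h1 \<otimes> h2 = word_eval G s (u @ v)" by (simp add: word_eval_append[OF s])
      then show ?case by blast
    qed
  qed
  show "range (word_eval G s) \<subseteq> generate G (range s)"
  proof safe
    fix w
    show "word_eval G s w \<in> generate G (range s)"
    proof (induction w)
      case (Cons a w)
      then show ?case
        by (cases a) (auto simp: word_eval_Cons intro!: generate.eng intro: generate.incl generate.inv)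
    qed (simp add: word_eval_Nil generate.one)
  qed
qed

text \<open>The elements that conjugate \<open>x\<close> to a given conjugate form a coset of the centralizer.\<close>

lemma conj_class_fibre:
  assumes x: "x \<in> carrier G" and g: "g \<in> carrier G"
  shows "bij_betw (\<lambda>h. g \<otimes> h) (centralizer G x)
    {k \<in> carrier G. k \<otimes> x \<otimes> inv k = g \<otimes> x \<otimes> inv g}"
proof (rule bij_betwI[of _ _ _ "\<lambda>k. inv g \<otimes> k"])
  show "(\<lambda>h. g \<otimes> h) \<in> centralizer G x \<rightarrow> {k \<in> carrier G. k \<otimes> x \<otimes> inv k = g \<otimes> x \<otimes> inv g}"
  proof
    fix h assume "h \<in> centralizer G x"
    then have h: "h \<in> carrier G" "h \<otimes> x = x \<otimes> h" by (auto simp: centralizer_def)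
    have "g \<otimes> h \<otimes> x \<otimes> inv (g \<otimes> h) = g \<otimes> (h \<otimes> x) \<otimes> inv h \<otimes> inv g"
      using x g h(1) by (simp add: inv_mult_group m_assoc)
    also have "\<dots> = g \<otimes> x \<otimes> inv g" using x g h by (simp add: m_assoc)
    finally show "g \<otimes> h \<in> {k \<in> carrier G. k \<otimes> x \<otimes> inv k = g \<otimes> x \<otimes> inv g}"
      using g h by simp
  qed
  show "(\<lambda>k. inv g \<otimes> k) \<in> {k \<in> carrier G. k \<otimes> x \<otimes> inv k = g \<otimes> x \<otimes> inv g} \<rightarrow> centralizer G x"
  proof
    fix k assume "k \<in> {k \<in> carrier G. k \<otimes> x \<otimes> inv k = g \<otimes> x \<otimes> inv g}"
    then have k: "k \<in> carrier G" "k \<otimes> x \<otimes> inv k = g \<otimes> x \<otimes> inv g" by auto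
    have "inv g \<otimes> k \<otimes> x = inv g \<otimes> (k \<otimes> x \<otimes> inv k) \<otimes> k"
      using x g k(1) by (simp add: m_assoc)
    also have "\<dots> = x \<otimes> (inv g \<otimes> k)" unfolding k(2) using x g k(1) by (simp add: m_assoc[symmetric])
    finally show "inv g \<otimes> k \<in> centralizer G x" using g k by (simp add: centralizer_def)
  qed
qed (use g in \<open>simp_all add: centralizer_def m_assoc[symmetric]\<close>)

lemma card_conj_class_mult_centralizer:
  assumes fin: "finite (carrier G)" and x: "x \<in> carrier G"
  shows "card (conj_class G x) * card (centralizer G x) = card (carrier G)"
proof -
  let ?c = "\<lambda>g. g \<otimes> x \<otimes> inv g"
  have "card (carrier G) = (\<Sum>g\<in>carrier G. 1)" by simp
  also have "\<dots> = (\<Sum>y\<in>?c ` carrier G. \<Sum>g | g \<in> carrier G \<and> ?c g = y. 1)"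
    by (rule sum.image_gen[OF fin])
  also have "\<dots> = (\<Sum>y\<in>?c ` carrier G. card (centralizer G x))"
  proof (rule sum.cong[OF HOL.refl])
    fix y assume "y \<in> ?c ` carrier G"
    then obtain g where g: "g \<in> carrier G" "y = ?c g" by auto
    have "card (centralizer G x) = card {k \<in> carrier G. ?c k = ?c g}"
      by (rule bij_betw_same_card[OF conj_class_fibre[OF x g(1)]])
    then show "(\<Sum>k | k \<in> carrier G \<and> ?c k = y. 1) = card (centralizer G x)"
      by (simp add: g(2))
  qed
  finally show ?thesis by (simp add: conj_class_def)
qed

lemma conj_class_self: "x \<in> carrier G \<Longrightarrow> x \<in> conj_class G x"
  unfolding conj_class_def by (rule image_eqI[of _ _ \<one>]) auto

lemma conj_class_subset: "x \<in> carrier G \<Longrightarrow> conj_class G x \<subseteq> carrier G"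
  unfolding conj_class_def by auto

lemma conj_class_eq:
  assumes x: "x \<in> carrier G" and y: "y \<in> conj_class G x"
  shows "conj_class G y = conj_class G x"
proof -
  have sub: "conj_class G y \<subseteq> conj_class G x"
    if x: "x \<in> carrier G" and y: "y \<in> conj_class G x" for x y
  proof
    fix z assume "z \<in> conj_class G y"
    then obtain h where h: "h \<in> carrier G" "z = h \<otimes> y \<otimes> inv h" by (auto simp: conj_class_def)
    obtain g where g: "g \<in> carrier G" "y = g \<otimes> x \<otimes> inv g" using y by (auto simp: conj_class_def)
    have "z = (h \<otimes> g) \<otimes> x \<otimes> inv (h \<otimes> g)" using x h g by (simp add: inv_mult_group m_assoc)
    then show "z \<in> conj_class G x" using h g by (auto simp: conj_class_def)
  qed
  obtain g where g: "g \<in> carrier G" "y = g \<otimes> x \<otimes> inv g" using y by (auto simp: conj_class_def)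
  have "x = inv g \<otimes> y \<otimes> inv (inv g)" using g x by (simp add: m_assoc) (simp add: m_assoc[symmetric])
  then have "x \<in> conj_class G y"
    unfolding conj_class_def using inv_closed[OF g(1)] by (rule image_eqI)
  moreover have "y \<in> carrier G" using g x by simp
  ultimately show ?thesis using sub x y by blast
qed

text \<open>The class of \<open>x\<close> has as many elements as the centralizer of \<open>x\<close> has cosets.\<close>

lemma sum_class_function:
  fixes f :: "'a \<Rightarrow> complex"
  assumes fin: "finite (carrier G)"
    and f: "\<And>g x. g \<in> carrier G \<Longrightarrow> x \<in> carrier G \<Longrightarrow> f (g \<otimes> x \<otimes> inv g) = f x"
    and r: "\<And>C. C \<in> conj_classes G \<Longrightarrow> r C \<in> C"
  shows "(\<Sum>x\<in>carrier G. f x) / of_nat (card (carrier G)) =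
    (\<Sum>C\<in>conj_classes G. f (r C) / of_nat (card (centralizer G (r C))))"
proof -
  have "(\<Sum>x\<in>carrier G. f x) = (\<Sum>C\<in>conj_classes G. \<Sum>x | x \<in> carrier G \<and> conj_class G x = C. f x)"
    unfolding conj_classes_def by (rule sum.image_gen[OF fin])
  also have "\<dots> = (\<Sum>C\<in>conj_classes G. of_nat (card C) * f (r C))"
  proof (rule sum.cong[OF HOL.refl])
    fix C assume C: "C \<in> conj_classes G"
    then obtain y where y: "y \<in> carrier G" "C = conj_class G y" by (auto simp: conj_classes_def)
    have "{x \<in> carrier G. conj_class G x = C} = C"
      using conj_class_eq[OF y(1)] conj_class_self conj_class_subset[OF y(1)] y(2) by blast
    moreover have "f x = f (r C)" if "x \<in> C" for x
      using that r[OF C] f y by (auto simp: conj_class_def)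
    ultimately show "(\<Sum>x | x \<in> carrier G \<and> conj_class G x = C. f x) = of_nat (card C) * f (r C)"
      by simp
  qed
  finally have "(\<Sum>x\<in>carrier G. f x) / of_nat (card (carrier G)) =
      (\<Sum>C\<in>conj_classes G. of_nat (card C) * f (r C) / of_nat (card (carrier G)))"
    by (simp add: sum_divide_distrib)
  also have "\<dots> = (\<Sum>C\<in>conj_classes G. f (r C) / of_nat (card (centralizer G (r C))))"
  proof (rule sum.cong[OF HOL.refl])
    fix C assume C: "C \<in> conj_classes G"
    then obtain y where y: "y \<in> carrier G" "C = conj_class G y" by (auto simp: conj_classes_def)
    have rC: "r C \<in> carrier G" "conj_class G (r C) = C"
      using r[OF C] conj_class_subset[OF y(1)] conj_class_eq[OF y(1)] y(2) by auto
    have "card C * card (centralizer G (r C)) = card (carrier G)"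
      using card_conj_class_mult_centralizer[OF fin rC(1)] rC(2) by simp
    moreover have "card (carrier G) \<noteq> 0" using fin by auto
    ultimately have "(of_nat (card (carrier G)) :: complex) = of_nat (card C) * of_nat (card (centralizer G (r C)))"
      "(of_nat (card C) :: complex) \<noteq> 0"
      by (metis of_nat_mult, metis mult_0 of_nat_eq_0_iff)
    then show "of_nat (card C) * f (r C) / of_nat (card (carrier G)) =
        f (r C) / of_nat (card (centralizer G (r C)))"
      by simp
  qed
  finally show ?thesis .
qed

end


section \<open>The double cover of a Weyl group\<close>

lemma group_general_linear: "group (general_linear :: (real^'n^'n::finite) monoid)"
proof (rule groupI)
  fix x :: "real^'n^'n" assume "x \<in> carrier general_linear"
  then obtain y where "x ** y = mat 1" "y ** x = mat 1"
    by (auto simp: general_linear_def invertible_def)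
  then show "\<exists>y\<in>carrier general_linear. y \<otimes>\<^bsub>general_linear\<^esub> x = \<one>\<^bsub>general_linear\<^esub>"
    by (intro bexI[of _ y]) (auto simp: general_linear_def invertible_def)
next
  fix x y :: "real^'n^'n" assume "x \<in> carrier general_linear" "y \<in> carrier general_linear"
  then show "x \<otimes>\<^bsub>general_linear\<^esub> y \<in> carrier general_linear"
    by (simp add: general_linear_def invertible_mult)
qed (auto simp: general_linear_def matrix_mul_assoc invertible_def intro: exI[of _ "mat 1"])

lemma orthogonal_matrix_reflection:
  fixes \<beta> :: "real^'n::finite"
  assumes "\<beta> \<noteq> 0"
  shows "orthogonal_matrix (reflection \<beta>)"
proof -
  let ?f = "\<lambda>v. v - (2 * (v \<bullet> \<beta>) / (\<beta> \<bullet> \<beta>)) *\<^sub>R \<beta>"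
  have lin: "linear ?f"
    by (rule linearI) (auto simp: inner_add_left algebra_simps add_divide_distrib scaleR_add_left)
  have "?f v \<bullet> ?f w = v \<bullet> w" for v w
  proof -
    have "\<beta> \<bullet> \<beta> \<noteq> 0" using assms by simp
    moreover have "\<beta> \<bullet> w = w \<bullet> \<beta>" by (rule inner_commute)
    ultimately show ?thesis
      by (simp add: inner_diff_left inner_diff_right)
  qed
  with lin have "orthogonal_transformation ?f" by (simp add: orthogonal_transformation_def)
  then show ?thesis by (simp add: orthogonal_transformation_matrix reflection_def)
qed

lemma root_stabilizer_subgroup:
  assumes "finite \<Phi>"
  shows "subgroup {x. orthogonal_matrix x \<and> (\<forall>\<beta>\<in>\<Phi>. x *v \<beta> \<in> \<Phi>)}
    (general_linear :: (real^'n^'n::finite) monoid)" (is "subgroup ?K ?G")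
proof (rule group.subgroupI[OF group_general_linear])
  show "?K \<subseteq> carrier ?G"
    by (auto simp: general_linear_def invertible_def orthogonal_matrix_def)
  show "?K \<noteq> {}" using orthogonal_matrix_id by (auto intro!: exI[of _ "mat 1"])
  show "x \<otimes>\<^bsub>?G\<^esub> y \<in> ?K" if "x \<in> ?K" "y \<in> ?K" for x y
    using that orthogonal_matrix_mul
    by (auto simp: general_linear_def matrix_vector_mul_assoc[symmetric])
  fix x assume x: "x \<in> ?K"
  have tx: "transpose x ** x = mat 1" "x ** transpose x = mat 1"
    using x by (auto simp: orthogonal_matrix_def)
  have inv: "inv\<^bsub>?G\<^esub> x = transpose x"
    by (rule group.inv_equality[OF group_general_linear])
      (use tx in \<open>auto simp: general_linear_def invertible_def\<close>)
  have inj: "inj ((*v) x)"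
    by (rule injI) (metis tx(1) matrix_vector_mul_assoc matrix_vector_mul_lid)
  have "(*v) x ` \<Phi> = \<Phi>"
    using x by (intro card_subset_eq assms card_image inj_on_subset[OF inj]) auto
  have "transpose x *v \<beta> \<in> \<Phi>" if "\<beta> \<in> \<Phi>" for \<beta>
  proof -
    have "\<beta> \<in> (*v) x ` \<Phi>" using that \<open>(*v) x ` \<Phi> = \<Phi>\<close> by simp
    then obtain \<gamma> where "\<gamma> \<in> \<Phi>" "\<beta> = x *v \<gamma>" by (rule imageE)
    then show ?thesis by (simp add: matrix_vector_mul_assoc tx)
  qed
  then show "inv\<^bsub>?G\<^esub> x \<in> ?K" using x by (simp add: inv)
qed

text \<open>A matrix is determined by its action on a spanning set.\<close>

lemma finite_root_preserving:
  assumes "finite \<Phi>" "span \<Phi> = (UNIV :: (real^'n::finite) set)"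
  shows "finite {x :: real^'n^'n. \<forall>\<beta>\<in>\<Phi>. x *v \<beta> \<in> \<Phi>}" (is "finite ?K")
proof -
  let ?r = "\<lambda>x :: real^'n^'n. restrict ((*v) x) \<Phi>"
  have "?r ` ?K \<subseteq> \<Phi> \<rightarrow>\<^sub>E \<Phi>" by auto
  then have "finite (?r ` ?K)" using finite_PiE[OF assms(1), of "\<lambda>_. \<Phi>"] assms(1) finite_subset by blast
  moreover have "inj_on ?r ?K"
  proof (rule inj_onI)
    fix x y assume *: "?r x = ?r y"
    have "x *v v = y *v v" for v
    proof (rule linear_eq_on_span[where f = "(*v) x" and g = "(*v) y" and B = \<Phi>])
      show "x *v \<beta> = y *v \<beta>" if "\<beta> \<in> \<Phi>" for \<beta> using fun_cong[OF *, of \<beta>] that by simp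
    qed (auto simp: assms(2))
    then show "x = y" using matrix_eq by blast
  qed
  ultimately show ?thesis by (rule finite_imageD)
qed

text \<open>Words in the generators of the cover are compared with words in the simple reflections by
dropping the letters for \<open>z\<close> (\<open>erase_z\<close>) and by relabelling (\<open>t_word\<close>).\<close>

definition erase_z :: "'n cover_gen word \<Rightarrow> 'n word" where
  "erase_z w = concat (map (\<lambda>(x, e). case x of Z \<Rightarrow> [] | T i \<Rightarrow> [(i, e)]) w)"

definition t_word :: "'n word \<Rightarrow> 'n cover_gen word" where
  "t_word u = map (\<lambda>(i, e). (T i, e)) u"

locale weyl_cover =
  fixes \<Phi> :: "(real^'n::finite) set" and \<alpha> :: "'n \<Rightarrow> real^'n" and m :: "'n \<Rightarrow> 'n \<Rightarrow> nat"
  assumes datum: "weyl_datum \<Phi> \<alpha> m"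
begin

abbreviation "W \<equiv> weyl_group \<Phi>"
abbreviation "D \<equiv> double_cover m"
abbreviation "s i \<equiv> reflection (\<alpha> i)"
abbreviation "s' x \<equiv> (case x of Z \<Rightarrow> mat 1 | T i \<Rightarrow> reflection (\<alpha> i))"
abbreviation "z \<equiv> cover_z m"
abbreviation "t \<equiv> cover_t m"
abbreviation "\<theta> \<equiv> theta \<Phi> \<alpha>"
abbreviation "parity \<equiv> weyl_parity \<Phi> \<alpha>"
abbreviation "cls w \<equiv> word_class (cover_relations m) w"

sublocale D: group D unfolding double_cover_def by (rule group_presented_group)
sublocale W: group W unfolding weyl_group_def
  by (rule group.group_subgroup_generated[OF group_general_linear])

lemma W_mult: "x \<otimes>\<^bsub>W\<^esub> y = x ** y" and W_one: "\<one>\<^bsub>W\<^esub> = mat 1"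
  by (simp_all add: weyl_group_def general_linear_def subgroup_generated_def)

lemma roots: "root_system \<Phi>" and coxeter: "coxeter_matrix m"
  and presentation: "has_presentation W s (coxeter_relations m)"
  using datum by (auto simp: weyl_datum_def)

lemma W_stabilizes:
  assumes "x \<in> carrier W"
  shows "orthogonal_matrix x" "\<forall>\<beta>\<in>\<Phi>. x *v \<beta> \<in> \<Phi>"
proof -
  let ?K = "{x :: real^'n^'n. orthogonal_matrix x \<and> (\<forall>\<beta>\<in>\<Phi>. x *v \<beta> \<in> \<Phi>)}"
  have sub: "reflection ` \<Phi> \<subseteq> ?K"
  proof (intro image_subsetI CollectI conjI)
    fix \<beta> assume \<beta>: "\<beta> \<in> \<Phi>"
    then have "\<beta> \<noteq> 0" using roots by (auto simp: root_system_def)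
    then show "orthogonal_matrix (reflection \<beta>)" by (rule orthogonal_matrix_reflection)
    show "\<forall>\<gamma>\<in>\<Phi>. reflection \<beta> *v \<gamma> \<in> \<Phi>" using roots \<beta> by (simp add: root_system_def)
  qed
  have "carrier W \<subseteq> ?K"
    unfolding weyl_group_def
    by (rule group.subgroup_generated_minimal[OF group_general_linear root_stabilizer_subgroup sub])
      (use roots in \<open>simp add: root_system_def\<close>)
  then show "orthogonal_matrix x" "\<forall>\<beta>\<in>\<Phi>. x *v \<beta> \<in> \<Phi>" using assms by auto
qed

lemma finite_W: "finite (carrier W)"
proof (rule finite_subset)
  show "carrier W \<subseteq> {x. \<forall>\<beta>\<in>\<Phi>. x *v \<beta> \<in> \<Phi>}" using W_stabilizes by auto
  show "finite {x. \<forall>\<beta>\<in>\<Phi>. x *v \<beta> \<in> \<Phi>}"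
    using roots by (intro finite_root_preserving) (auto simp: root_system_def)
qed

lemma W_inv: "x \<in> carrier W \<Longrightarrow> inv\<^bsub>W\<^esub> x = transpose x"
proof -
  assume x: "x \<in> carrier W"
  have "transpose x = transpose x ** (x ** inv\<^bsub>W\<^esub> x)"
    using W.r_inv[OF x] by (simp add: W_mult W_one)
  also have "\<dots> = inv\<^bsub>W\<^esub> x"
    using W_stabilizes(1)[OF x] by (simp add: matrix_mul_assoc orthogonal_matrix_def)
  finally show ?thesis by simp
qed

lemma range_s: "range s \<subseteq> carrier W"
  using presentation by (simp add: has_presentation_def)

lemma range_s': "range s' \<subseteq> carrier W"
  using range_s W.one_closed by (auto simp: W_one image_subset_iff split: cover_gen.splits)

lemma W_words: "carrier W = range (word_eval W s)"
  using presentation W.generate_range_eq_words[OF range_s] by (auto simp: has_presentation_def)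

lemma W_word_eq: "word_eval W s u = word_eval W s v \<longleftrightarrow> pres_eq (coxeter_relations m) u v"
  using presentation by (auto simp: has_presentation_def)

lemma eval_t_word: "word_eval W s' (t_word u) = word_eval W s u"
proof (induction u)
  case (Cons a u)
  then show ?case by (cases a) (simp add: t_word_def W.word_eval_Cons)
qed (simp add: t_word_def W.word_eval_Nil)

lemma eval_erase: "word_eval W s (erase_z w) = word_eval W s' w"
proof (induction w)
  case (Cons a w)
  obtain x e where a: "a = (x, e)" by fastforce
  have "word_eval W s' w \<in> carrier W" by (rule W.word_eval_closed[OF range_s'])
  with Cons show ?case
    using W.inv_one W.l_one[of "word_eval W s' w"]
    by (auto simp: a erase_z_def W.word_eval_Cons W_one split: cover_gen.splits)
qed (simp add: erase_z_def W.word_eval_Nil)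

lemma eval_relations:
  assumes "(u, v) \<in> cover_relations m"
  shows "word_eval W s' u = word_eval W s' v"
proof -
  have Zs: "erase_z (replicate k (Z, True)) = []" for k
    by (induction k) (auto simp: erase_z_def)
  have Ts: "erase_z (concat (replicate k [(T i, True), (T j, True)])) =
      concat (replicate k [(i, True), (j, True)])" for k i j
    by (induction k) (auto simp: erase_z_def)
  have "pres_eq (coxeter_relations m) (erase_z u) (erase_z v)"
    using assms unfolding cover_relations_def
  proof (elim UnE)
    assume "(u, v) \<in> {(concat (replicate (m i j) [(T i, True), (T j, True)]),
       replicate (m i j + 1) (Z, True)) |i j. True}"
    then obtain i j where uv: "u = concat (replicate (m i j) [(T i, True), (T j, True)])"
      "v = replicate (m i j + 1) (Z, True)" by blast
    have "(concat (replicate (m i j) [(i, True), (j, True)]), []) \<in> coxeter_relations m"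
      unfolding coxeter_relations_def by blast
    then show ?thesis unfolding uv Ts Zs by (rule pres_eq.relator)
  qed (auto simp: erase_z_def pres_eq.refl)
  then have "word_eval W s (erase_z u) = word_eval W s (erase_z v)" by (simp add: W_word_eq)
  then show ?thesis by (simp add: eval_erase)
qed

lemma D_carrier: "carrier D = range (\<lambda>w. cls w)"
  by (simp add: double_cover_def presented_carrier)

lemma D_mult: "cls u \<otimes>\<^bsub>D\<^esub> cls v = cls (u @ v)"
  by (simp add: double_cover_def presented_mult)

lemma D_one: "\<one>\<^bsub>D\<^esub> = cls []"
  by (simp add: double_cover_def presented_one)

lemma cls_in_D: "cls w \<in> carrier D"
  by (simp add: D_carrier)

lemma theta_cls: "\<theta> (cls w) = word_eval W s' w"
proof -
  have "word_eval W s' v \<in> {word_eval W s' w}" if "v \<in> cls w" for v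
  proof -
    have v: "pres_eq (cover_relations m) w v" using that by (simp add: word_class_def)
    have "word_eval W s' w = word_eval W s' v"
      by (rule W.word_eval_pres_eq[OF range_s' _ v]) (rule eval_relations)
    then show ?thesis by (simp only: singleton_iff)
  qed
  then have "word_eval W s' ` cls w \<subseteq> {word_eval W s' w}" by (rule image_subsetI)
  moreover have "word_eval W s' w \<in> word_eval W s' ` cls w"
    by (rule imageI[OF word_class_self])
  ultimately have "word_eval W s' ` cls w = {word_eval W s' w}" by blast
  then show ?thesis by (simp add: theta_def)
qed

lemma theta_hom:
  "g \<in> carrier D \<Longrightarrow> h \<in> carrier D \<Longrightarrow> \<theta> (g \<otimes>\<^bsub>D\<^esub> h) = \<theta> g \<otimes>\<^bsub>W\<^esub> \<theta> h"
  by (auto simp: D_carrier D_mult theta_cls W.word_eval_append[OF range_s'])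

lemma theta_in_W: "g \<in> carrier D \<Longrightarrow> \<theta> g \<in> carrier W"
  by (auto simp: D_carrier theta_cls W.word_eval_closed[OF range_s'])

sublocale \<theta>: group_hom D W \<theta>
  by unfold_locales (auto simp: hom_def theta_hom theta_in_W)

lemma theta_onto: "x \<in> carrier W \<Longrightarrow> \<exists>g\<in>carrier D. \<theta> g = x"
proof -
  assume "x \<in> carrier W"
  then obtain u where "x = word_eval W s u" by (auto simp: W_words)
  then have "\<theta> (cls (t_word u)) = x" by (simp add: theta_cls eval_t_word)
  then show ?thesis using cls_in_D by blast
qed

lemma z_in_D: "z \<in> carrier D" and t_in_D: "t i \<in> carrier D"
  by (simp_all add: cover_z_def cover_t_def cls_in_D)

lemma theta_z: "\<theta> z = mat 1" and theta_t: "\<theta> (t i) = s i"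
  using W.one_closed range_s
  by (auto simp: cover_z_def cover_t_def theta_cls W.word_eval_Cons W.word_eval_Nil W_one W_mult)

lemma cls_relation: "(u, v) \<in> cover_relations m \<Longrightarrow> cls u = cls v"
  by (simp add: word_class_eq_iff pres_eq.relator)

lemma z_square: "z \<otimes>\<^bsub>D\<^esub> z = \<one>\<^bsub>D\<^esub>"
  unfolding cover_z_def D_mult D_one by (rule cls_relation) (auto simp: cover_relations_def)

lemma t_square: "t i \<otimes>\<^bsub>D\<^esub> t i = \<one>\<^bsub>D\<^esub>"
proof -
  have "m i i = 1" using coxeter by (simp add: coxeter_matrix_def)
  then have "([(T i, True), (T i, True)], [(Z, True), (Z, True)]) \<in> cover_relations m"
    unfolding cover_relations_def by (intro UnI2 CollectI exI[of _ i]) simp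
  from cls_relation[OF this] show ?thesis
    using z_square by (simp add: cover_t_def cover_z_def D_mult)
qed

lemma cls_letter: "cls [(Z, e)] = z" "cls [(T i, e)] = t i"
proof -
  have z: "inv\<^bsub>D\<^esub> z = z" by (rule D.inv_equality[OF z_square z_in_D z_in_D])
  have t: "inv\<^bsub>D\<^esub> (t i) = t i" by (rule D.inv_equality[OF t_square t_in_D t_in_D])
  show "cls [(Z, e)] = z"
    using z presented_inv_letter[of "cover_relations m" Z]
    by (cases e) (auto simp: cover_z_def double_cover_def)
  show "cls [(T i, e)] = t i"
    using t presented_inv_letter[of "cover_relations m" "T i"]
    by (cases e) (auto simp: cover_t_def double_cover_def)
qed

lemma cls_Cons: "cls ((Z, e) # w) = z \<otimes>\<^bsub>D\<^esub> cls w" "cls ((T i, e) # w) = t i \<otimes>\<^bsub>D\<^esub> cls w"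
  using D_mult[of "[(Z, e)]" w] D_mult[of "[(T i, e)]" w] by (simp_all add: cls_letter)

text \<open>The generators are involutions, so every element is a product of generators without inverses.\<close>

lemma D_induct [consumes 1, case_names one z t]:
  assumes "g \<in> carrier D" and one: "P \<one>\<^bsub>D\<^esub>"
    and z: "\<And>g. g \<in> carrier D \<Longrightarrow> P g \<Longrightarrow> P (z \<otimes>\<^bsub>D\<^esub> g)"
    and t: "\<And>i g. g \<in> carrier D \<Longrightarrow> P g \<Longrightarrow> P (t i \<otimes>\<^bsub>D\<^esub> g)"
  shows "P g"
proof -
  obtain w where w: "g = cls w" using assms(1) by (auto simp: D_carrier)
  have "P (cls w)"
  proof (induction w)
    case Nil
    show ?case using one by (simp add: D_one)
  next
    case (Cons a w)
    obtain x e where a: "a = (x, e)" by fastforce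
    show ?case using Cons z t cls_in_D by (cases x) (simp_all add: a cls_Cons)
  qed
  then show ?thesis by (simp add: w)
qed

lemma z_central: "g \<in> carrier D \<Longrightarrow> z \<otimes>\<^bsub>D\<^esub> g = g \<otimes>\<^bsub>D\<^esub> z"
proof (induction rule: D_induct)
  case one
  show ?case using z_in_D by simp
next
  case (z g)
  have "z \<otimes>\<^bsub>D\<^esub> g \<otimes>\<^bsub>D\<^esub> z = z \<otimes>\<^bsub>D\<^esub> (g \<otimes>\<^bsub>D\<^esub> z)"
    using z(1) z_in_D by (simp add: D.m_assoc)
  then show ?case using z(2) by simp
next
  case (t i g)
  have "z \<otimes>\<^bsub>D\<^esub> t i = t i \<otimes>\<^bsub>D\<^esub> z"
    unfolding cover_z_def cover_t_def D_mult by (rule cls_relation) (auto simp: cover_relations_def)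
  then have "z \<otimes>\<^bsub>D\<^esub> (t i \<otimes>\<^bsub>D\<^esub> g) = t i \<otimes>\<^bsub>D\<^esub> (z \<otimes>\<^bsub>D\<^esub> g)"
    using t(1) z_in_D t_in_D by (simp add: D.m_assoc[symmetric])
  then show ?case using t z_in_D t_in_D by (simp add: D.m_assoc)
qed

text \<open>By \<open>theta_eq_iff\<close> the classes of this relation are the fibres of \<open>\<theta>\<close>. It is introduced first because
it is a congruence, hence can be followed along a derivation from the Coxeter relations.\<close>

definition eq_mod_z where
  "eq_mod_z g h \<longleftrightarrow> g \<in> carrier D \<and> h \<in> carrier D \<and> (g = h \<or> g = z \<otimes>\<^bsub>D\<^esub> h)"

lemma z_z: "g \<in> carrier D \<Longrightarrow> z \<otimes>\<^bsub>D\<^esub> (z \<otimes>\<^bsub>D\<^esub> g) = g"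
  using z_in_D by (simp add: D.m_assoc[symmetric] z_square)

lemma eq_mod_z_refl: "g \<in> carrier D \<Longrightarrow> eq_mod_z g g"
  by (simp add: eq_mod_z_def)

lemma eq_mod_z_sym: "eq_mod_z g h \<Longrightarrow> eq_mod_z h g"
  using z_z by (auto simp: eq_mod_z_def)

lemma eq_mod_z_trans: "eq_mod_z g h \<Longrightarrow> eq_mod_z h k \<Longrightarrow> eq_mod_z g k"
  using z_z by (auto simp: eq_mod_z_def)

lemma eq_mod_z_mult:
  assumes "eq_mod_z g g'" "eq_mod_z h h'"
  shows "eq_mod_z (g \<otimes>\<^bsub>D\<^esub> h) (g' \<otimes>\<^bsub>D\<^esub> h')"
proof -
  have D: "g' \<in> carrier D" "h' \<in> carrier D" using assms by (auto simp: eq_mod_z_def)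
  have "g' \<otimes>\<^bsub>D\<^esub> (z \<otimes>\<^bsub>D\<^esub> h') = z \<otimes>\<^bsub>D\<^esub> (g' \<otimes>\<^bsub>D\<^esub> h')"
    by (simp only: D.m_assoc[symmetric] D z_in_D z_central[OF D(1)])
  then show ?thesis
    using assms D z_in_D z_z[of "g' \<otimes>\<^bsub>D\<^esub> h'"] by (auto simp: eq_mod_z_def D.m_assoc)
qed

lemma cls_eq_erase: "eq_mod_z (cls w) (cls (t_word (erase_z w)))"
proof (induction w)
  case Nil
  show ?case by (simp add: eq_mod_z_def erase_z_def t_word_def cls_in_D)
next
  case (Cons a w)
  obtain x e where a: "a = (x, e)" by fastforce
  show ?case
  proof (cases x)
    case Z
    have "eq_mod_z (z \<otimes>\<^bsub>D\<^esub> cls w) (cls w)" by (simp add: eq_mod_z_def cls_in_D z_in_D)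
    then show ?thesis
      using eq_mod_z_trans[OF _ Cons] by (simp add: a Z cls_Cons erase_z_def)
  next
    case (T i)
    then show ?thesis
      using eq_mod_z_mult[OF eq_mod_z_refl[OF t_in_D[of i]] Cons]
      by (simp add: a cls_Cons erase_z_def t_word_def)
  qed
qed

text \<open>Every Coxeter relation holds in the cover up to a power of \<open>z\<close>.\<close>

lemma coxeter_eq_mod_z:
  assumes "pres_eq (coxeter_relations m) u v"
  shows "eq_mod_z (cls (t_word u)) (cls (t_word v))"
  using assms
proof (induction rule: pres_eq.induct)
  case (refl u)
  show ?case by (rule eq_mod_z_refl[OF cls_in_D])
next
  case (sym u v)
  then show ?case by (simp add: eq_mod_z_sym)
next
  case (trans u v w)
  then show ?case using eq_mod_z_trans by blast
next
  case (congr u v a b)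
  have "cls (t_word (a @ u @ b)) = cls (t_word a) \<otimes>\<^bsub>D\<^esub> cls (t_word u) \<otimes>\<^bsub>D\<^esub> cls (t_word b)" for u
    by (simp add: t_word_def D_mult)
  then show ?case
    using congr by (simp add: eq_mod_z_mult eq_mod_z_refl cls_in_D)
next
  case (cancel x e)
  have "cls (t_word [(x, e), (x, \<not> e)]) = cls (t_word [])"
    using t_square[of x] t_in_D[of x] by (simp add: t_word_def cls_Cons D_one[symmetric])
  then show ?case by (simp add: eq_mod_z_refl cls_in_D)
next
  case (relator u v)
  then obtain i j where uv: "u = concat (replicate (m i j) [(i, True), (j, True)])" "v = []"
    by (auto simp: coxeter_relations_def)
  have "t_word (concat (replicate k [(i, True), (j, True)])) =
      concat (replicate k [(T i, True), (T j, True)])" for k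
    by (induction k) (auto simp: t_word_def)
  moreover have "cls (concat (replicate (m i j) [(T i, True), (T j, True)])) =
      cls (replicate (m i j + 1) (Z, True))"
    by (rule cls_relation) (auto simp: cover_relations_def)
  ultimately have u: "cls (t_word u) = cls (replicate (m i j + 1) (Z, True))" by (simp add: uv)
  have "eq_mod_z (cls (replicate k (Z, True))) (cls [])" for k
  proof (induction k)
    case (Suc k)
    have "eq_mod_z (z \<otimes>\<^bsub>D\<^esub> cls (replicate k (Z, True))) (cls (replicate k (Z, True)))"
      by (simp add: eq_mod_z_def cls_in_D z_in_D)
    then show ?case using eq_mod_z_trans[OF _ Suc] by (simp add: cls_Cons)
  qed (simp add: eq_mod_z_refl cls_in_D)
  then show ?case unfolding u uv(2) by (simp add: t_word_def del: replicate_Suc)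
qed

text \<open>The kernel of \<open>\<theta>\<close> is \<open>{1, z}\<close>: an equality in \<open>W\<close> is a consequence of the Coxeter relations,
because these present \<open>W\<close>, and such a consequence lifts to the cover up to \<open>z\<close>.\<close>

lemma theta_eq_iff:
  assumes "g \<in> carrier D" "h \<in> carrier D"
  shows "\<theta> g = \<theta> h \<longleftrightarrow> eq_mod_z g h"
proof
  obtain w v where w: "g = cls w" and v: "h = cls v" using assms by (auto simp: D_carrier)
  assume "\<theta> g = \<theta> h"
  then have "pres_eq (coxeter_relations m) (erase_z w) (erase_z v)"
    by (simp add: w v theta_cls eval_erase[symmetric] W_word_eq)
  from coxeter_eq_mod_z[OF this] show "eq_mod_z g h"
    unfolding w v using cls_eq_erase eq_mod_z_sym eq_mod_z_trans by blast
next
  assume "eq_mod_z g h"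
  then show "\<theta> g = \<theta> h"
    using theta_hom[OF z_in_D assms(2)] theta_in_W[OF assms(2)]
    by (auto simp: eq_mod_z_def theta_z W_mult)
qed

lemma theta_fibre: "g \<in> carrier D \<Longrightarrow> {h \<in> carrier D. \<theta> h = \<theta> g} = {g, z \<otimes>\<^bsub>D\<^esub> g}"
  using theta_eq_iff z_in_D by (auto simp: eq_mod_z_def theta_z[folded W_one])

lemma finite_D: "finite (carrier D)"
proof -
  have "carrier D = (\<Union>x\<in>carrier W. {g \<in> carrier D. \<theta> g = x})" using theta_in_W by auto
  moreover have "finite {g \<in> carrier D. \<theta> g = x}" if "x \<in> carrier W" for x
    using theta_onto[OF that] theta_fibre by auto
  ultimately show ?thesis using finite_W by (metis (no_types, lifting) finite_UN_I)
qed

text \<open>The relators have length \<open>2 m\<^sub>i\<^sub>j\<close>, so the parity of the length of a word depends only on the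
element of \<open>W\<close> that it represents.\<close>

lemma even_length_relation:
  assumes "pres_eq (coxeter_relations m) u v"
  shows "(of_nat (length u) :: bit) = of_nat (length v)"
  using assms
proof (induction rule: pres_eq.induct)
  case (relator u v)
  have "length (concat (replicate k [(i, True), (j, True)])) = k + k" for k and i j :: 'n
    by (induction k) auto
  then show ?case using relator by (auto simp: coxeter_relations_def)
qed auto

lemma parity_word: "parity (word_eval W s u) = of_nat (length u)"
  unfolding weyl_parity_def
proof (rule the_equality)
  show "\<exists>w. word_eval W s w = word_eval W s u \<and> (of_nat (length u) :: bit) = of_nat (length w)"
    by blast
  fix p :: bit assume "\<exists>w. word_eval W s w = word_eval W s u \<and> p = of_nat (length w)"
  then show "p = of_nat (length u)" unfolding W_word_eq using even_length_relation by blast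
qed

lemma parity_mult:
  assumes "x \<in> carrier W" "y \<in> carrier W"
  shows "parity (x \<otimes>\<^bsub>W\<^esub> y) = parity x + parity y"
proof -
  obtain u v where u: "x = word_eval W s u" and v: "y = word_eval W s v"
    using assms by (auto simp: W_words)
  have "x \<otimes>\<^bsub>W\<^esub> y = word_eval W s (u @ v)" by (simp add: u v W.word_eval_append[OF range_s])
  then show ?thesis by (simp only: parity_word u v) simp
qed

lemma parity_one: "parity \<one>\<^bsub>W\<^esub> = 0"
  using parity_word[of "[]"] by (simp add: W.word_eval_Nil)

lemma parity_s: "parity (s i) = 1"
proof -
  have "s i \<in> carrier W" using range_s by auto
  then show ?thesis using parity_word[of "[(i, True)]"] by (simp add: W.word_eval_Nil W.word_eval_Cons)
qed

lemma parity_conj: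
  assumes "g \<in> carrier W" "x \<in> carrier W"
  shows "parity (g \<otimes>\<^bsub>W\<^esub> x \<otimes>\<^bsub>W\<^esub> inv\<^bsub>W\<^esub> g) = parity x"
proof -
  have "parity g + parity (inv\<^bsub>W\<^esub> g) = 0"
    using parity_mult[of g "inv\<^bsub>W\<^esub> g"] assms by (simp add: parity_one)
  moreover have "parity (g \<otimes>\<^bsub>W\<^esub> x \<otimes>\<^bsub>W\<^esub> inv\<^bsub>W\<^esub> g) =
      parity x + (parity g + parity (inv\<^bsub>W\<^esub> g))"
    by (simp only: parity_mult assms W.m_closed W.inv_closed ac_simps)
  ultimately show ?thesis by (simp only: add_0_right)
qed

lemma preimage_conj_class:
  assumes g: "g \<in> carrier D"
  shows "{h \<in> carrier D. \<theta> h \<in> conj_class W (\<theta> g)} =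
    conj_class D g \<union> conj_class D (z \<otimes>\<^bsub>D\<^esub> g)"
proof (intro Set.set_eqI iffI)
  fix h assume "h \<in> {h \<in> carrier D. \<theta> h \<in> conj_class W (\<theta> g)}"
  then obtain x where h: "h \<in> carrier D" and x: "x \<in> carrier W"
    "\<theta> h = x \<otimes>\<^bsub>W\<^esub> \<theta> g \<otimes>\<^bsub>W\<^esub> inv\<^bsub>W\<^esub> x"
    by (auto simp: conj_class_def)
  obtain k where k: "k \<in> carrier D" "\<theta> k = x" using theta_onto[OF x(1)] by auto
  have "\<theta> (k \<otimes>\<^bsub>D\<^esub> g \<otimes>\<^bsub>D\<^esub> inv\<^bsub>D\<^esub> k) = \<theta> h"
    using g k x by (simp add: theta_hom)
  then have "eq_mod_z h (k \<otimes>\<^bsub>D\<^esub> g \<otimes>\<^bsub>D\<^esub> inv\<^bsub>D\<^esub> k)"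
    using theta_eq_iff[OF h, of "k \<otimes>\<^bsub>D\<^esub> g \<otimes>\<^bsub>D\<^esub> inv\<^bsub>D\<^esub> k"] g k by simp
  moreover have "z \<otimes>\<^bsub>D\<^esub> (k \<otimes>\<^bsub>D\<^esub> g \<otimes>\<^bsub>D\<^esub> inv\<^bsub>D\<^esub> k) =
      k \<otimes>\<^bsub>D\<^esub> (z \<otimes>\<^bsub>D\<^esub> g) \<otimes>\<^bsub>D\<^esub> inv\<^bsub>D\<^esub> k"
    by (simp only: D.m_assoc[symmetric] D.m_closed D.inv_closed g k(1) z_in_D z_central[OF k(1)])
  ultimately show "h \<in> conj_class D g \<union> conj_class D (z \<otimes>\<^bsub>D\<^esub> g)"
    using k(1) by (auto simp: eq_mod_z_def conj_class_def)
next
  fix h assume "h \<in> conj_class D g \<union> conj_class D (z \<otimes>\<^bsub>D\<^esub> g)"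
  then obtain g' k where k: "k \<in> carrier D" "h = k \<otimes>\<^bsub>D\<^esub> g' \<otimes>\<^bsub>D\<^esub> inv\<^bsub>D\<^esub> k"
    "g' = g \<or> g' = z \<otimes>\<^bsub>D\<^esub> g"
    by (auto simp: conj_class_def)
  have g': "g' \<in> carrier D" "\<theta> g' = \<theta> g"
    using k(3) g z_in_D theta_eq_iff[of g' g] by (auto simp: eq_mod_z_def)
  then show "h \<in> {h \<in> carrier D. \<theta> h \<in> conj_class W (\<theta> g)}"
    using k by (auto simp: theta_hom conj_class_def)
qed

text \<open>The preimage of the class of \<open>\<theta> g\<close> is the union of the classes of \<open>g\<close> and \<open>z g\<close>, so it is not a union of
two distinct classes only if these two coincide.\<close>

lemma nonsplit_conj:
  assumes g: "g \<in> carrier D" and "\<not> split_class \<Phi> \<alpha> m (conj_class W (\<theta> g))"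
  obtains k where "k \<in> carrier D" "z \<otimes>\<^bsub>D\<^esub> g = k \<otimes>\<^bsub>D\<^esub> g \<otimes>\<^bsub>D\<^esub> inv\<^bsub>D\<^esub> k"
proof -
  have zg: "z \<otimes>\<^bsub>D\<^esub> g \<in> carrier D" using g z_in_D by simp
  have "conj_class D g = conj_class D (z \<otimes>\<^bsub>D\<^esub> g)"
    using assms(2) preimage_conj_class[OF g] g zg unfolding split_class_def conj_classes_def by blast
  then have "z \<otimes>\<^bsub>D\<^esub> g \<in> conj_class D g" using D.conj_class_self[OF zg] by simp
  then show ?thesis using that by (auto simp: conj_class_def)
qed

text \<open>By invariance under \<open>z\<close> the function descends to a class function on \<open>W\<close>. Fibres of \<open>\<theta>\<close> have two
elements, so both averages agree, and only the even split classes contribute to the average over \<open>W\<close>.\<close>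

lemma sum_over_double_cover:
  fixes F :: "'n cover_elt \<Rightarrow> complex"
  assumes z1: "z \<noteq> \<one>\<^bsub>D\<^esub>"
    and conj: "\<And>g k. g \<in> carrier D \<Longrightarrow> k \<in> carrier D \<Longrightarrow> F (k \<otimes>\<^bsub>D\<^esub> g \<otimes>\<^bsub>D\<^esub> inv\<^bsub>D\<^esub> k) = F g"
    and z: "\<And>g. g \<in> carrier D \<Longrightarrow> F (z \<otimes>\<^bsub>D\<^esub> g) = F g"
    and odd: "\<And>g. g \<in> carrier D \<Longrightarrow> parity (\<theta> g) \<noteq> 0 \<Longrightarrow> F g = 0"
    and nonsplit: "\<And>g. g \<in> carrier D \<Longrightarrow> \<not> split_class \<Phi> \<alpha> m (conj_class W (\<theta> g)) \<Longrightarrow> F g = 0"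
    and lift: "\<And>C. C \<in> even_split_classes \<Phi> \<alpha> m \<Longrightarrow> lift C \<in> carrier D \<and> \<theta> (lift C) \<in> C"
  shows "(\<Sum>g\<in>carrier D. F g) / of_nat (card (carrier D)) =
    (\<Sum>C\<in>even_split_classes \<Phi> \<alpha> m.
      F (lift C) / of_nat (card (centralizer W (\<theta> (lift C)))))"
proof -
  define \<sigma> where "\<sigma> x = (SOME g. g \<in> carrier D \<and> \<theta> g = x)" for x
  have \<sigma>: "\<sigma> x \<in> carrier D" "\<theta> (\<sigma> x) = x" if "x \<in> carrier W" for x
    using someI_ex[of "\<lambda>g. g \<in> carrier D \<and> \<theta> g = x"] theta_onto[OF that] by (auto simp: \<sigma>_def)
  have F\<theta>: "F g = F h" if "g \<in> carrier D" "h \<in> carrier D" "\<theta> g = \<theta> h" for g h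
    using that theta_eq_iff[of g h] z by (auto simp: eq_mod_z_def)
  have z_neq: "z \<otimes>\<^bsub>D\<^esub> g \<noteq> g" if "g \<in> carrier D" for g
    using z1 that z_in_D by simp
  have fibre: "card {g \<in> carrier D. \<theta> g = x} = 2" if "x \<in> carrier W" for x
  proof -
    have "{g \<in> carrier D. \<theta> g = x} = {\<sigma> x, z \<otimes>\<^bsub>D\<^esub> \<sigma> x}"
      using theta_fibre[OF \<sigma>(1)[OF that]] by (simp add: \<sigma>(2)[OF that])
    moreover have "\<sigma> x \<noteq> z \<otimes>\<^bsub>D\<^esub> \<sigma> x" using z_neq[OF \<sigma>(1)[OF that]] by (rule not_sym)
    ultimately show ?thesis by simp
  qed
  have sums: "(\<Sum>g\<in>carrier D. F' g) = (\<Sum>x\<in>carrier W. 2 * F' (\<sigma> x))"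
    if F': "\<And>g h. g \<in> carrier D \<Longrightarrow> h \<in> carrier D \<Longrightarrow> \<theta> g = \<theta> h \<Longrightarrow> F' g = F' h"
    for F' :: "'n cover_elt \<Rightarrow> complex"
  proof -
    have "(\<Sum>g\<in>carrier D. F' g) = (\<Sum>x\<in>carrier W. \<Sum>g | g \<in> carrier D \<and> \<theta> g = x. F' g)"
      using finite_D finite_W theta_in_W by (intro sum.group[symmetric]) auto
    also have "\<dots> = (\<Sum>x\<in>carrier W. of_nat (card {g \<in> carrier D. \<theta> g = x}) * F' (\<sigma> x))"
    proof (rule sum.cong[OF HOL.refl])
      fix x assume x: "x \<in> carrier W"
      have "(\<Sum>g | g \<in> carrier D \<and> \<theta> g = x. F' g) = (\<Sum>g | g \<in> carrier D \<and> \<theta> g = x. F' (\<sigma> x))"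
        using \<sigma>[OF x] by (intro sum.cong F') auto
      then show "(\<Sum>g | g \<in> carrier D \<and> \<theta> g = x. F' g) =
          of_nat (card {g \<in> carrier D. \<theta> g = x}) * F' (\<sigma> x)" by simp
    qed
    finally show ?thesis by (simp add: fibre)
  qed
  have cardD: "(of_nat (card (carrier D)) :: complex) = 2 * of_nat (card (carrier W))"
    using sums[of "\<lambda>_. 1"] by simp
  \<comment> \<open>the prescribed representatives, completed arbitrarily to a choice for all classes\<close>
  define r where "r C = (if C \<in> even_split_classes \<Phi> \<alpha> m then \<theta> (lift C) else (SOME x. x \<in> C))" for C
  have rC: "r C \<in> C" if "C \<in> conj_classes W" for C
  proof -
    have "\<exists>x. x \<in> C" using that W.conj_class_self by (auto simp: conj_classes_def)
    then show ?thesis using lift someI_ex[of "\<lambda>x. x \<in> C"] by (simp add: r_def)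
  qed
  have "(\<Sum>g\<in>carrier D. F g) / of_nat (card (carrier D)) =
      (\<Sum>x\<in>carrier W. F (\<sigma> x)) / of_nat (card (carrier W))"
    using sums[OF F\<theta>] by (simp add: cardD sum_distrib_left[symmetric])
  also have "\<dots> = (\<Sum>C\<in>conj_classes W. F (\<sigma> (r C)) / of_nat (card (centralizer W (r C))))"
  proof (rule W.sum_class_function[OF finite_W _ rC])
    fix y x assume y: "y \<in> carrier W" and x: "x \<in> carrier W"
    have "F (\<sigma> (y \<otimes>\<^bsub>W\<^esub> x \<otimes>\<^bsub>W\<^esub> inv\<^bsub>W\<^esub> y)) = F (\<sigma> y \<otimes>\<^bsub>D\<^esub> \<sigma> x \<otimes>\<^bsub>D\<^esub> inv\<^bsub>D\<^esub> (\<sigma> y))"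
      using x y \<sigma> by (intro F\<theta>) (simp_all add: theta_hom)
    then show "F (\<sigma> (y \<otimes>\<^bsub>W\<^esub> x \<otimes>\<^bsub>W\<^esub> inv\<^bsub>W\<^esub> y)) = F (\<sigma> x)" using x y \<sigma> conj by simp
  qed
  also have "\<dots> = (\<Sum>C\<in>even_split_classes \<Phi> \<alpha> m. F (\<sigma> (r C)) / of_nat (card (centralizer W (r C))))"
  proof (rule sum.mono_neutral_right)
    show "finite (conj_classes W)" using finite_W by (simp add: conj_classes_def)
    show "even_split_classes \<Phi> \<alpha> m \<subseteq> conj_classes W" by (auto simp: even_split_classes_def)
    show "\<forall>C\<in>conj_classes W - even_split_classes \<Phi> \<alpha> m.
        F (\<sigma> (r C)) / of_nat (card (centralizer W (r C))) = 0"
    proof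
      fix C assume C: "C \<in> conj_classes W - even_split_classes \<Phi> \<alpha> m"
      then obtain y where y: "y \<in> carrier W" "C = conj_class W y" by (auto simp: conj_classes_def)
      have r: "r C \<in> carrier W" "r C \<in> conj_class W y" "conj_class W (r C) = C"
        using rC[of C] C W.conj_class_subset[OF y(1)] W.conj_class_eq[OF y(1)] y(2) by auto
      have par: "parity x = parity (r C)" if "x \<in> C" for x
        using that r parity_conj[of _ y] y by (auto simp: conj_class_def)
      have "F (\<sigma> (r C)) = 0"
      proof (cases "split_class \<Phi> \<alpha> m C")
        case True
        then have "parity (r C) \<noteq> 0" using C par by (auto simp: even_split_classes_def)
        then show ?thesis using odd \<sigma> r by simp
      next
        case False
        then show ?thesis using nonsplit \<sigma> r by simp
      qed
      then show "F (\<sigma> (r C)) / of_nat (card (centralizer W (r C))) = 0" by simp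
    qed
  qed
  also have "\<dots> = (\<Sum>C\<in>even_split_classes \<Phi> \<alpha> m.
      F (lift C) / of_nat (card (centralizer W (\<theta> (lift C)))))"
  proof (rule sum.cong[OF HOL.refl])
    fix C assume C: "C \<in> even_split_classes \<Phi> \<alpha> m"
    then have "r C = \<theta> (lift C)" by (simp add: r_def)
    moreover have "F (\<sigma> (\<theta> (lift C))) = F (lift C)"
      using lift[OF C] \<sigma>[OF theta_in_W] by (intro F\<theta>) auto
    ultimately show "F (\<sigma> (r C)) / of_nat (card (centralizer W (r C))) =
        F (lift C) / of_nat (card (centralizer W (\<theta> (lift C))))" by simp
  qed
  finally show ?thesis .
qed

end


section \<open>Spin modules\<close>

context weyl_cover
begin

abbreviation "cover_parity g \<equiv> parity (\<theta> g)"
abbreviation "CA \<equiv> monoid_superalgebra D cover_parity"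

lemma ring_CA: "ring CA" by (rule D.ring_alg)

lemma spin_ideal_eq: "spin_ideal \<Phi> \<alpha> m = Idl\<^bsub>CA\<^esub> {\<lambda>g. delta z g + delta \<one>\<^bsub>D\<^esub> g}"
  by (simp add: spin_ideal_def cover_algebra_def D.alg_add D.alg_one Let_def)

lemma spin_generator: "(\<lambda>g. delta z g + delta \<one>\<^bsub>D\<^esub> g) \<in> carrier CA"
  using z_in_D by (intro D.alg_add_closed D.delta_carrier) auto

lemma ideal_spin_ideal: "ideal (spin_ideal \<Phi> \<alpha> m) CA"
  unfolding spin_ideal_eq using spin_generator by (intro ring.genideal_ideal[OF ring_CA]) auto

lemma spin_generator_in_ideal: "(\<lambda>g. delta z g + delta \<one>\<^bsub>D\<^esub> g) \<in> spin_ideal \<Phi> \<alpha> m"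
  unfolding spin_ideal_eq using ring.genideal_self[OF ring_CA] spin_generator by blast

lemma spin_algebra_eq:
  "spin_algebra \<Phi> \<alpha> m = quotient_superalgebra CA (spin_ideal \<Phi> \<alpha> m)"
  by (simp add: spin_algebra_def cover_algebra_def)

lemma spin_image_eq: "spin_image \<Phi> \<alpha> m g = spin_ideal \<Phi> \<alpha> m +>\<^bsub>CA\<^esub> delta g"
  by (simp add: spin_image_def cover_algebra_def)

text \<open>The elements that act as zero form a two-sided ideal, and this ideal contains the generator
\<open>z + 1\<close> of the spin ideal.\<close>

lemma spin_ideal_acts_by_zero:
  assumes rep: "group_rep D sc U \<tau>" and U: "vector_space sc" "module.subspace sc U"
    and neg: "\<And>x. x \<in> U \<Longrightarrow> \<tau> z x = - x"
    and f: "f \<in> spin_ideal \<Phi> \<alpha> m" and x: "x \<in> U"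
  shows "linear_extension sc (\<lambda>g. \<tau> g x) f = 0"
proof -
  interpret complex_vector_space sc by (rule complex_vector_space.intro) fact
  let ?L = "\<lambda>f x. linear_extension sc (\<lambda>g. \<tau> g x) f"
  let ?K = "{f \<in> carrier CA. \<forall>x\<in>U. ?L f x = 0}"
  note lin = linear_betweenD[OF group_repD(1)[OF rep]]
  have LU: "?L f x \<in> U" if "f \<in> carrier CA" "x \<in> U" for f x
    using that lin(1) by (intro linear_extension_in_subspace[OF U(2)]) (auto simp: D.alg_carrier)
  have L_mult: "?L (f \<otimes>\<^bsub>CA\<^esub> h) x = ?L f (?L h x)"
    if f: "f \<in> carrier CA" and h: "h \<in> carrier CA" and x: "x \<in> U" for f h x
  proof -
    have fin: "finite (support f)" "finite (support h)" and
      sup: "support f \<subseteq> carrier D" "support h \<subseteq> carrier D"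
      using f h by (auto simp: D.alg_carrier)
    have "?L (f \<otimes>\<^bsub>CA\<^esub> h) x =
        linear_extension sc (\<lambda>g. linear_extension sc (\<lambda>k. \<tau> (g \<otimes>\<^bsub>D\<^esub> k) x) h) f"
      by (rule D.linear_extension_alg_mult[OF U(1) fin])
    also have "\<dots> = ?L f (?L h x)"
    proof (rule linear_extension_cong)
      fix g assume "g \<in> support f"
      then have g: "g \<in> carrier D" using sup by auto
      have "linear_extension sc (\<lambda>k. \<tau> (g \<otimes>\<^bsub>D\<^esub> k) x) h = (\<Sum>k\<in>support h. \<tau> g (sc (h k) (\<tau> k x)))"
        unfolding linear_extension_def
        using sup(2) x g by (intro sum.cong) (auto simp: group_repD(2)[OF rep] lin subset_iff)
      also have "\<dots> = \<tau> g (?L h x)"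
        unfolding linear_extension_def
        using sup(2) x lin(1)
        by (intro linear_between_sum[OF group_repD(1)[OF rep g] U, symmetric] subspace_scale[OF U(2)]) auto
      finally show "linear_extension sc (\<lambda>k. \<tau> (g \<otimes>\<^bsub>D\<^esub> k) x) h = \<tau> g (?L h x)" .
    qed
    finally show ?thesis .
  qed
  have L_zero: "?L f 0 = 0" if "f \<in> carrier CA" for f
    unfolding linear_extension_def
    using that linear_between_zero[OF group_repD(1)[OF rep] subspace_0[OF U(2)]]
    by (intro sum.neutral) (auto simp: D.alg_carrier subset_iff)
  interpret R: ring CA by (rule ring_CA)
  have K: "ideal ?K CA"
  proof (rule idealI[OF ring_CA])
    show "subgroup ?K (add_monoid CA)"
    proof (rule R.add.subgroupI)
      have "(\<lambda>_. 0) \<in> ?K"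
        by (simp add: D.alg_carrier support_def linear_extension_zero)
      then show "?K \<noteq> {}" by blast
      fix f assume f: "f \<in> ?K"
      have e: "\<ominus>\<^bsub>CA\<^esub> f = (\<lambda>x. (-1) * f x)"
      proof (rule R.minus_equality)
        show "(\<lambda>x. (-1) * f x) \<in> carrier CA" using f by (auto simp: D.alg_carrier support_def)
      qed (use f in \<open>auto simp: D.alg_add D.alg_zero\<close>)
      have fin: "finite (support f)" using f by (auto simp: D.alg_carrier)
      have "\<ominus>\<^bsub>CA\<^esub> f \<in> carrier CA" using f by (auto intro: R.a_inv_closed)
      moreover have "?L (\<ominus>\<^bsub>CA\<^esub> f) x = 0" if "x \<in> U" for x
        unfolding e linear_extension_scale[OF fin] using f that by simp
      ultimately show "\<ominus>\<^bsub>CA\<^esub> f \<in> ?K" by simp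
      fix h assume h: "h \<in> ?K"
      show "f \<oplus>\<^bsub>CA\<^esub> h \<in> ?K"
        using f h D.alg_add_closed[of f cover_parity h]
        by (auto simp: D.alg_add linear_extension_add D.alg_carrier)
    qed auto
    fix a b assume "a \<in> ?K" "b \<in> carrier CA"
    then show "b \<otimes>\<^bsub>CA\<^esub> a \<in> ?K" "a \<otimes>\<^bsub>CA\<^esub> b \<in> ?K"
      using LU by (auto simp: L_mult L_zero)
  qed
  have "?L (\<lambda>g. delta z g + delta \<one>\<^bsub>D\<^esub> g) x = 0" if x: "x \<in> U" for x
    using neg[OF x] group_repD(3)[OF rep x]
    by (simp add: linear_extension_add support_delta linear_extension_delta)
  then have "{\<lambda>g. delta z g + delta \<one>\<^bsub>D\<^esub> g} \<subseteq> ?K" using spin_generator by simp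
  then have "spin_ideal \<Phi> \<alpha> m \<subseteq> ?K"
    unfolding spin_ideal_eq by (rule ring.genideal_minimal[OF ring_CA K])
  then show ?thesis using f x by blast
qed

end

locale spin_module = weyl_cover \<Phi> \<alpha> m
  for \<Phi> :: "(real^'n::finite) set" and \<alpha> :: "'n \<Rightarrow> real^'n" and m :: "'n \<Rightarrow> 'n \<Rightarrow> nat" +
  fixes M :: "('n spin_elt, 'm::ab_group_add) supermod"
  assumes spin_supermodule: "supermodule (spin_algebra \<Phi> \<alpha> m) M"
begin

sublocale M: quotient_module D cover_parity "spin_ideal \<Phi> \<alpha> m" M
  by (rule quotient_module.intro[OF D.monoid_axioms ideal_spin_ideal
        spin_supermodule[unfolded spin_algebra_eq]])

lemma op_spin: "act M (spin_image \<Phi> \<alpha> m g) = M.op g"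
  by (simp add: spin_image_eq M.op_def)

text \<open>The element \<open>z + 1\<close> lies in the spin ideal, so it acts as zero.\<close>

lemma op_z: "x \<in> vectors M \<Longrightarrow> M.op z x = - x"
proof -
  assume x: "x \<in> vectors M"
  let ?d = "\<lambda>g. delta z g + delta \<one>\<^bsub>D\<^esub> g"
  interpret I: ideal "spin_ideal \<Phi> \<alpha> m" CA by (rule ideal_spin_ideal)
  have 0: "(\<lambda>_. 0) \<in> carrier CA" by (simp add: D.alg_carrier support_def)
  have "M.coset ?d = spin_ideal \<Phi> \<alpha> m" by (rule I.a_rcos_const[OF spin_generator_in_ideal])
  moreover have "M.coset (\<lambda>_. 0) = spin_ideal \<Phi> \<alpha> m"
    using I.a_rcos_const[OF additive_subgroup.zero_closed[OF I.is_additive_subgroup]] by (simp add: D.alg_zero)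
  ultimately have "act M (M.coset ?d) x = act M (M.coset (\<lambda>_. 0)) x" by simp
  then have "M.op z x + M.op \<one>\<^bsub>D\<^esub> x = 0"
    using M.act_coset[OF spin_generator x] M.act_coset[OF 0 x]
    by (simp add: M.linear_extension_add support_delta M.linear_extension_delta M.linear_extension_zero)
  then show ?thesis using M.op_one[OF x] by (simp add: eq_neg_iff_add_eq_0)
qed

lemma op_z_mult: "g \<in> carrier D \<Longrightarrow> x \<in> vectors M \<Longrightarrow> M.op (z \<otimes>\<^bsub>D\<^esub> g) x = - M.op g x"
  using linear_betweenD(1)[OF M.op_linear] by (simp add: M.op_mult z_in_D op_z)

lemma trace_z_mult:
  assumes F: "frame (scal M) (vectors M) J e c" and g: "g \<in> carrier D"
  shows "frame_trace J e c (M.op (z \<otimes>\<^bsub>D\<^esub> g)) = - frame_trace J e c (M.op g)"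
  unfolding frame_trace_def sum_negf[symmetric]
proof (rule sum.cong[OF HOL.refl])
  fix j assume j: "j \<in> J"
  note V = frameD(4)[OF F j]
  show "c j (M.op (z \<otimes>\<^bsub>D\<^esub> g) (e j)) = - c j (M.op g (e j))"
    using linear_betweenD(3)[OF frameD(5)[OF F j] linear_betweenD(1)[OF M.op_linear[OF g] V], of "-1"]
    by (simp add: op_z_mult[OF g V])
qed

lemma trace_nonsplit:
  assumes F: "frame (scal M) (vectors M) J e c" and g: "g \<in> carrier D"
    and "\<not> split_class \<Phi> \<alpha> m (conj_class W (\<theta> g))"
  shows "frame_trace J e c (M.op g) = 0"
proof -
  obtain k where k: "k \<in> carrier D" "z \<otimes>\<^bsub>D\<^esub> g = k \<otimes>\<^bsub>D\<^esub> g \<otimes>\<^bsub>D\<^esub> inv\<^bsub>D\<^esub> k"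
    using nonsplit_conj[OF g assms(3)] .
  have "frame_trace J e c (M.op g) = frame_trace J e c (M.op (z \<otimes>\<^bsub>D\<^esub> g))"
    unfolding k(2) by (rule frame_trace_conj[OF F M.op_group_rep D.group_axioms g k(1), symmetric])
  then show ?thesis using trace_z_mult[OF F g] by simp
qed

lemma spin_character_eq:
  assumes F: "frame (scal M) (vectors M) J e c" and g: "g \<in> carrier D"
  shows "spin_character \<Phi> \<alpha> m M g = frame_trace J e c (M.op g)"
  unfolding spin_character_def op_spin by (rule mod_trace_eq_frame_trace[OF F M.op_linear[OF g]])

text \<open>On a spin module \<open>z\<close> acts as \<open>-1\<close> and the identity as \<open>1\<close>.\<close>

lemma z_neq_one:
  assumes "vectors M \<noteq> {0}"
  shows "z \<noteq> \<one>\<^bsub>D\<^esub>"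
proof
  assume *: "z = \<one>\<^bsub>D\<^esub>"
  have "x = 0" if x: "x \<in> vectors M" for x
  proof -
    have "- x = x" using op_z[OF x] M.op_one[OF x] by (simp add: *)
    then have "x + x = 0" by (metis add.right_inverse)
    then have "scal M 2 x = 0" using M.scale_left_distrib[of 1 1 x] by simp
    then show ?thesis by simp
  qed
  then show False using assms M.subspace_0[OF M.vectors_subspace] by blast
qed

end


section \<open>Molien's formula for matrices of finite order\<close>

abbreviation "lookup \<equiv> Poly_Mapping.lookup"
abbreviation "single \<equiv> Poly_Mapping.single"
abbreviation "keys \<equiv> Poly_Mapping.keys"

text \<open>The image of the \<open>j\<close>-th variable under \<open>A\<close>, that is, the \<open>j\<close>-th column of \<open>A\<close> read as a linear
polynomial. The algebra endomorphism \<open>subst A\<close> of the symmetric algebra extends these assignments.\<close>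

definition linear_form :: "complex^'n^'n \<Rightarrow> 'n::finite \<Rightarrow> 'n symalg" where
  "linear_form A j = (\<Sum>i\<in>UNIV. single (single i 1) (A $ i $ j))"

definition subst_monomial :: "complex^'n^'n \<Rightarrow> ('n::finite \<Rightarrow>\<^sub>0 nat) \<Rightarrow> 'n symalg" where
  "subst_monomial A \<mu> = (\<Prod>j\<in>UNIV. linear_form A j ^ lookup \<mu> j)"

definition subst :: "complex^'n^'n \<Rightarrow> 'n::finite symalg \<Rightarrow> 'n symalg" where
  "subst A p = (\<Sum>\<mu>\<in>keys p. single 0 (lookup p \<mu>) * subst_monomial A \<mu>)"

definition monomials :: "nat \<Rightarrow> ('n::finite \<Rightarrow>\<^sub>0 nat) set" where
  "monomials k = {\<mu>. (\<Sum>j\<in>UNIV. lookup \<mu> j) = k}"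

text \<open>The matrix of the symmetric powers of \<open>A\<close> in the basis of monomials.\<close>

definition sym_coeff :: "complex^'n^'n \<Rightarrow> ('n::finite \<Rightarrow>\<^sub>0 nat) \<Rightarrow> ('n \<Rightarrow>\<^sub>0 nat) \<Rightarrow> complex" where
  "sym_coeff A \<nu> \<mu> = lookup (subst_monomial A \<mu>) \<nu>"

definition sym_trace :: "nat \<Rightarrow> complex^'n^'n::finite \<Rightarrow> complex" where
  "sym_trace k A = (\<Sum>\<mu>\<in>monomials k. sym_coeff A \<mu> \<mu>)"

lemma sym_act_eq_subst: "sym_act x p = subst (cmat x) p"
  by (simp add: sym_act_def subst_def subst_monomial_def linear_form_def)

lemma lookup_const_mult: "lookup (single 0 (c::complex) * p) \<nu> = c * lookup p \<nu>"
  by (simp add: mult_map_scale_conv_mult[symmetric] Poly_Mapping.map.rep_eq when_def)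

lemma poly_mapping_eq_sum_single: "p = (\<Sum>\<mu>\<in>keys p. single \<mu> (lookup p \<mu>))"
  by (rule poly_mapping_eqI)
    (auto simp: lookup_sum lookup_single when_def in_keys_iff cong: if_cong)

lemma subst_superset:
  assumes "finite S" "keys p \<subseteq> S"
  shows "subst A p = (\<Sum>\<mu>\<in>S. single 0 (lookup p \<mu>) * subst_monomial A \<mu>)"
  unfolding subst_def by (rule sum.mono_neutral_left) (use assms in \<open>auto simp: in_keys_iff\<close>)

lemma subst_add: "subst A (p + q) = subst A p + subst A q"
proof -
  have "keys (p + q) \<subseteq> keys p \<union> keys q" by (rule keys_add)
  then show ?thesis
    by (simp add: subst_superset[of "keys p \<union> keys q"] lookup_add single_add distrib_right sum.distrib)
qed

lemma subst_zero: "subst A 0 = 0"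
  by (simp add: subst_def)

lemma subst_sum: "subst A (\<Sum>i\<in>S. p i) = (\<Sum>i\<in>S. subst A (p i))"
  by (induction S rule: infinite_finite_induct) (simp_all add: subst_zero subst_add)

lemma subst_single: "subst A (single \<mu> c) = single 0 c * subst_monomial A \<mu>"
  by (subst subst_superset[of "{\<mu>}"]) auto

lemma subst_monomial_add: "subst_monomial A (\<mu> + \<nu>) = subst_monomial A \<mu> * subst_monomial A \<nu>"
  by (simp add: subst_monomial_def lookup_add power_add prod.distrib)

lemma subst_mult: "subst A (p * q) = subst A p * subst A q"
proof -
  have "p * q = (\<Sum>\<mu>\<in>keys p. \<Sum>\<nu>\<in>keys q. single (\<mu> + \<nu>) (lookup p \<mu> * lookup q \<nu>))"
  proof -
    have "p * q = (\<Sum>\<mu>\<in>keys p. single \<mu> (lookup p \<mu>)) * (\<Sum>\<nu>\<in>keys q. single \<nu> (lookup q \<nu>))"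
      by (simp only: poly_mapping_eq_sum_single[symmetric])
    then show ?thesis by (simp only: sum_product mult_single)
  qed
  moreover have "single 0 (a * b) * (subst_monomial A \<mu> * subst_monomial A \<nu>) =
      (single 0 a * subst_monomial A \<mu>) * (single 0 b * subst_monomial A \<nu>)" for a b \<mu> \<nu>
  proof -
    have "single 0 (a * b) = (single 0 a * single 0 b :: 'a symalg)" by (simp add: mult_single)
    then show ?thesis by (simp only: mult_ac)
  qed
  ultimately have "subst A (p * q) = (\<Sum>\<mu>\<in>keys p. \<Sum>\<nu>\<in>keys q.
      (single 0 (lookup p \<mu>) * subst_monomial A \<mu>) * (single 0 (lookup q \<nu>) * subst_monomial A \<nu>))"
    by (simp only: subst_sum subst_single subst_monomial_add)
  then show ?thesis by (simp add: subst_def sum_product)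
qed

lemma subst_one: "subst A 1 = 1"
proof -
  have "subst A (single 0 1) = 1" unfolding subst_single by (simp add: subst_monomial_def)
  then show ?thesis by simp
qed

lemma subst_power: "subst A (p ^ k) = subst A p ^ k"
  by (induction k) (simp_all add: subst_one subst_mult)

lemma subst_prod: "subst A (\<Prod>i\<in>S. p i) = (\<Prod>i\<in>S. subst A (p i))"
  by (induction S rule: infinite_finite_induct) (simp_all add: subst_one subst_mult)

lemma subst_monomial_variable: "subst_monomial A (single i 1) = linear_form A i"
proof -
  have "subst_monomial A (single i 1) = (\<Prod>j\<in>UNIV. if j = i then linear_form A j else 1)"
    unfolding subst_monomial_def by (intro prod.cong) (auto simp: lookup_single when_def)
  then show ?thesis by simp
qed

lemma single_sum: "single \<mu> (\<Sum>i\<in>S. c i) = (\<Sum>i\<in>S. single \<mu> (c i))"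
  by (induction S rule: infinite_finite_induct) (simp_all add: single_add)

lemma subst_linear_form: "subst A (linear_form B j) = linear_form (A ** B) j"
proof -
  have "subst A (linear_form B j) =
      (\<Sum>i\<in>UNIV. \<Sum>l\<in>UNIV. single (single l 1) (A $ l $ i * B $ i $ j))"
    unfolding linear_form_def[of B] subst_sum subst_single subst_monomial_variable
    unfolding linear_form_def by (simp add: sum_distrib_left mult_single mult.commute)
  also have "\<dots> = (\<Sum>l\<in>UNIV. \<Sum>i\<in>UNIV. single (single l 1) (A $ l $ i * B $ i $ j))"
    by (rule sum.swap)
  also have "\<dots> = linear_form (A ** B) j"
    by (simp add: linear_form_def matrix_matrix_mult_def single_sum)
  finally show ?thesis .
qed

lemma subst_subst_monomial: "subst A (subst_monomial B \<mu>) = subst_monomial (A ** B) \<mu>"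
  by (simp add: subst_monomial_def subst_prod subst_power subst_linear_form)

lemma sym_power_mult: "p \<in> sym_power a \<Longrightarrow> q \<in> sym_power b \<Longrightarrow> p * q \<in> sym_power (a + b)"
  unfolding sym_power_def using keys_mult[of p q]
  by (fastforce simp: lookup_add sum.distrib)

lemma sym_power_one: "1 \<in> sym_power 0"
  by (simp add: sym_power_def)

lemma sym_power_power: "p \<in> sym_power 1 \<Longrightarrow> p ^ k \<in> sym_power k"
  using sym_power_mult[of p 1] by (induction k) (auto simp: sym_power_one)

lemma sym_power_prod:
  "(\<And>i. i \<in> S \<Longrightarrow> p i \<in> sym_power (d i)) \<Longrightarrow> (\<Prod>i\<in>S. p i) \<in> sym_power (\<Sum>i\<in>S. d i)"
  by (induction S rule: infinite_finite_induct) (auto simp: sym_power_one sym_power_mult)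

lemma linear_form_sym_power: "linear_form A j \<in> sym_power 1"
proof -
  have "keys (linear_form A j) \<subseteq> (\<Union>i\<in>UNIV. keys (single (single i 1) (A $ i $ j)))"
    unfolding linear_form_def by (rule keys_sum)
  also have "\<dots> \<subseteq> range (\<lambda>i. single i 1)" by auto
  finally show ?thesis
    by (auto simp: sym_power_def lookup_single when_def subset_iff)
qed

lemma subst_monomial_sym_power:
  "\<mu> \<in> monomials k \<Longrightarrow> subst_monomial A \<mu> \<in> sym_power k"
  unfolding subst_monomial_def monomials_def
  using sym_power_prod[of UNIV "\<lambda>j. linear_form A j ^ lookup \<mu> j" "lookup \<mu>"]
    sym_power_power[OF linear_form_sym_power] by auto

lemma subst_monomial_keys: "\<mu> \<in> monomials k \<Longrightarrow> keys (subst_monomial A \<mu>) \<subseteq> monomials k"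
  using subst_monomial_sym_power[of \<mu> k A] by (auto simp: sym_power_def monomials_def)

lemma finite_monomials: "finite (monomials k :: ('n::finite \<Rightarrow>\<^sub>0 nat) set)"
proof (rule finite_imageD)
  have "lookup \<mu> j \<le> k" if "\<mu> \<in> monomials k" for \<mu> :: "'n \<Rightarrow>\<^sub>0 nat" and j
    using that member_le_sum[of j UNIV "lookup \<mu>"] by (auto simp: monomials_def)
  then have "lookup ` (monomials k :: ('n \<Rightarrow>\<^sub>0 nat) set) \<subseteq> UNIV \<rightarrow>\<^sub>E {..k}"
    by (auto simp: PiE_def Pi_def)
  then show "finite (lookup ` (monomials k :: ('n \<Rightarrow>\<^sub>0 nat) set))"
    using finite_PiE[of "UNIV :: 'n set" "\<lambda>_. {..k}"] finite_subset by auto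
  show "inj_on lookup (monomials k :: ('n \<Rightarrow>\<^sub>0 nat) set)"
    by (auto intro: inj_onI poly_mapping_eqI)
qed

lemma sym_coeff_outside:
  "\<mu> \<in> monomials k \<Longrightarrow> \<nu> \<notin> monomials k \<Longrightarrow> sym_coeff A \<nu> \<mu> = 0"
  using subst_monomial_keys[of \<mu> k A] by (auto simp: sym_coeff_def in_keys_iff subset_iff)

text \<open>Symmetric powers are functorial. Only monomials of the degree of \<open>\<mu>\<close> contribute, because
substitution preserves the degree.\<close>

lemma sym_coeff_mult:
  assumes "\<mu> \<in> monomials k"
  shows "sym_coeff (A ** B) \<nu> \<mu> = (\<Sum>\<kappa>\<in>monomials k. sym_coeff A \<nu> \<kappa> * sym_coeff B \<kappa> \<mu>)"
proof -
  have "sym_coeff (A ** B) \<nu> \<mu> = lookup (subst A (subst_monomial B \<mu>)) \<nu>"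
    by (simp add: sym_coeff_def subst_subst_monomial)
  also have "\<dots> = (\<Sum>\<kappa>\<in>monomials k. sym_coeff B \<kappa> \<mu> * sym_coeff A \<nu> \<kappa>)"
    unfolding subst_superset[OF finite_monomials subst_monomial_keys[OF assms]]
    by (simp add: lookup_sum lookup_const_mult sym_coeff_def)
  finally show ?thesis by (simp add: mult.commute)
qed

lemma sym_trace_commute:
  fixes A B :: "complex^'n^'n::finite"
  shows "sym_trace k (A ** B) = sym_trace k (B ** A)"
proof -
  have "sym_trace k (A ** B) =
      (\<Sum>\<mu>\<in>monomials k. \<Sum>\<kappa>\<in>monomials k. sym_coeff A \<mu> \<kappa> * sym_coeff B \<kappa> \<mu>)"
    by (simp add: sym_trace_def sym_coeff_mult)
  also have "\<dots> = (\<Sum>\<kappa>\<in>monomials k. \<Sum>\<mu>\<in>monomials k. sym_coeff B \<kappa> \<mu> * sym_coeff A \<mu> \<kappa>)"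
    by (subst sum.swap) (simp add: mult.commute)
  also have "\<dots> = sym_trace k (B ** A)"
    by (simp add: sym_trace_def sym_coeff_mult)
  finally show ?thesis .
qed

definition diag :: "('n \<Rightarrow> 'a::zero) \<Rightarrow> 'a^'n^'n::finite" where
  "diag d = (\<chi> i j. if i = j then d j else 0)"

lemma sum_single_lookup: "(\<Sum>j\<in>UNIV. single j (lookup \<mu> j)) = (\<mu> :: 'n::finite \<Rightarrow>\<^sub>0 nat)"
  by (rule poly_mapping_eqI) (simp add: lookup_sum lookup_single when_def)

lemma prod_single: "(\<Prod>j\<in>S. single (a j) (c j)) = single (\<Sum>j\<in>S. a j) (\<Prod>j\<in>S. c j)"
  for c :: "_ \<Rightarrow> complex"
  by (induction S rule: infinite_finite_induct) (simp_all add: mult_single)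

lemma power_single: "single (single j (1::nat)) (c :: complex) ^ k = single (single j k) (c ^ k)"
  by (induction k) (simp_all add: mult_single single_add[symmetric])

lemma linear_form_diag: "linear_form (diag d) j = single (single j 1) (d j)"
proof -
  have "linear_form (diag d) j = (\<Sum>i\<in>UNIV. if i = j then single (single i 1) (d j) else 0)"
    unfolding linear_form_def diag_def by (intro sum.cong) auto
  then show ?thesis by simp
qed

lemma subst_monomial_diag:
  "subst_monomial (diag d) \<mu> = single \<mu> (\<Prod>j\<in>UNIV. d j ^ lookup \<mu> j)"
  unfolding subst_monomial_def linear_form_diag power_single prod_single sum_single_lookup ..

lemma sym_trace_diag: "sym_trace k (diag d) = (\<Sum>\<mu>\<in>monomials k. \<Prod>j\<in>UNIV. d j ^ lookup \<mu> j)"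
  by (simp add: sym_trace_def sym_coeff_def subst_monomial_diag)

definition geometric :: "complex \<Rightarrow> complex fps" where
  "geometric c = Abs_fps (\<lambda>k. c ^ k)"

lemma geometric_nth: "fps_nth (geometric c) k = c ^ k"
  by (simp add: geometric_def)

lemma geometric_inverse: "(1 - fps_X * fps_const c) * geometric c = 1"
proof (rule fps_ext)
  fix n
  show "fps_nth ((1 - fps_X * fps_const c) * geometric c) n = fps_nth 1 n"
    by (cases n) (simp_all add: geometric_def algebra_simps)
qed

text \<open>Splitting off the exponent of one variable corresponds to multiplying by one more geometric
series.\<close>

lemma prod_geometric_nth:
  fixes d :: "'n \<Rightarrow> complex"
  assumes "finite S"
  shows "fps_nth (\<Prod>j\<in>S. geometric (d j)) k =
    (\<Sum>f | (\<forall>j. j \<notin> S \<longrightarrow> f j = 0) \<and> (\<Sum>j\<in>S. f j) = k. \<Prod>j\<in>S. d j ^ f j)"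
  using assms
proof (induction S arbitrary: k)
  case empty
  have "{f :: 'n \<Rightarrow> nat. (\<forall>j. f j = 0) \<and> 0 = k} = (if k = 0 then {\<lambda>_. 0} else {})" by auto
  then show ?case by simp
next
  case (insert a S)
  let ?F = "\<lambda>S k. {f :: 'n \<Rightarrow> nat. (\<forall>j. j \<notin> S \<longrightarrow> f j = 0) \<and> (\<Sum>j\<in>S. f j) = k}"
  have fin: "finite (?F S k)" for k
  proof (rule finite_subset)
    show "?F S k \<subseteq> {f. \<forall>j. (j \<in> S \<longrightarrow> f j \<in> {..k}) \<and> (j \<notin> S \<longrightarrow> f j = 0)}"
      using insert.hyps member_le_sum[of _ S] by fastforce
    show "finite {f. \<forall>j. (j \<in> S \<longrightarrow> f j \<in> {..k}) \<and> (j \<notin> S \<longrightarrow> f j = (0::nat))}"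
      using insert.hyps by (intro finite_set_of_finite_funs) auto
  qed
  have "fps_nth (\<Prod>j\<in>insert a S. geometric (d j)) k =
      (\<Sum>i\<in>{0..k}. d a ^ i * (\<Sum>f\<in>?F S (k - i). \<Prod>j\<in>S. d j ^ f j))"
    using insert.hyps by (simp add: fps_mult_nth insert.IH geometric_nth)
  also have "\<dots> = (\<Sum>(i, f)\<in>(SIGMA i:{0..k}. ?F S (k - i)). d a ^ i * (\<Prod>j\<in>S. d j ^ f j))"
    using fin by (simp add: sum_distrib_left sum.Sigma)
  also have "\<dots> = (\<Sum>f\<in>?F (insert a S) k. \<Prod>j\<in>insert a S. d j ^ f j)"
  proof (rule sum.reindex_bij_witness[of _ "\<lambda>f. (f a, f(a := 0))" "\<lambda>(i, f). f(a := i)"])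
    fix p assume "p \<in> (SIGMA i:{0..k}. ?F S (k - i))"
    then obtain i f where p: "p = (i, f)" "i \<le> k" "\<forall>j. j \<notin> S \<longrightarrow> f j = 0" "(\<Sum>j\<in>S. f j) = k - i"
      by auto
    have S: "(\<Sum>j\<in>S. (f(a := i)) j) = (\<Sum>j\<in>S. f j)"
      "(\<Prod>j\<in>S. d j ^ (f(a := i)) j) = (\<Prod>j\<in>S. d j ^ f j)"
      using insert.hyps(2) by (auto intro!: sum.cong prod.cong)
    show "((case p of (i, f) \<Rightarrow> f(a := i)) a, (case p of (i, f) \<Rightarrow> f(a := i))(a := 0)) = p"
      using p insert.hyps(2) by (auto simp: fun_eq_iff)
    show "(case p of (i, f) \<Rightarrow> f(a := i)) \<in> ?F (insert a S) k"
      using p insert.hyps S(1) by auto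
    show "(\<Prod>j\<in>insert a S. d j ^ (case p of (i, f) \<Rightarrow> f(a := i)) j) =
        (case p of (i, f) \<Rightarrow> d a ^ i * (\<Prod>j\<in>S. d j ^ f j))"
      using p insert.hyps S(2) by simp
  next
    fix f assume f: "f \<in> ?F (insert a S) k"
    have S: "(\<Sum>j\<in>S. (f(a := 0)) j) = (\<Sum>j\<in>S. f j)"
      using insert.hyps(2) by (auto intro!: sum.cong)
    show "(f a, f(a := 0)) \<in> (SIGMA i:{0..k}. ?F S (k - i))"
      using f insert.hyps S by auto
  qed simp
  finally show ?case .
qed

lemma sym_trace_diag_generating: "Abs_fps (\<lambda>k. sym_trace k (diag d)) = (\<Prod>j\<in>UNIV. geometric (d j))"
proof (rule fps_ext)
  fix k
  have "(\<Sum>\<mu>\<in>monomials k. \<Prod>j\<in>UNIV. d j ^ lookup \<mu> j) =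
      (\<Sum>f | (\<Sum>j\<in>UNIV. f j) = k. \<Prod>j\<in>UNIV. d j ^ f j)"
    by (rule sum.reindex_bij_witness[of _ Abs_poly_mapping lookup])
      (auto simp: monomials_def intro: lookup_inverse)
  then show "fps_nth (Abs_fps (\<lambda>k. sym_trace k (diag d))) k = fps_nth (\<Prod>j\<in>UNIV. geometric (d j)) k"
    by (simp add: prod_geometric_nth sym_trace_diag)
qed

definition const_matrix :: "complex^'n^'n \<Rightarrow> complex fps^'n^'n::finite" where
  "const_matrix A = (\<chi> i j. fps_const (A $ i $ j))"

lemma fps_const_sum: "fps_const (\<Sum>i\<in>S. c i) = (\<Sum>i\<in>S. fps_const (c i :: complex))"
  by (induction S rule: infinite_finite_induct) (simp_all add: fps_const_add[symmetric] del: fps_const_add)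

lemma const_matrix_mult: "const_matrix (A ** B) = const_matrix A ** const_matrix B"
  by (simp add: const_matrix_def matrix_matrix_mult_def vec_eq_iff fps_const_sum)

lemma const_matrix_one: "const_matrix (mat 1) = mat 1"
  by (simp add: const_matrix_def mat_def vec_eq_iff)

lemma scalar_matrix_commute: "mat c ** A = A ** mat c"
  for A :: "'a::comm_ring_1^'n^'n::finite"
  by (simp add: vec_eq_iff matrix_matrix_mult_def mat_def if_distrib if_distribR mult.commute cong: if_cong)

lemma mat_mult_nth: "(mat c ** A) $ i $ j = c * A $ i $ j"
  for A :: "'a::comm_ring_1^'n^'n::finite"
  by (simp add: matrix_matrix_mult_def mat_def if_distrib if_distribR cong: if_cong)

text \<open>The power series \<open>det(1 - tA)\<close>, written with matrix products so that conjugating \<open>A\<close> can be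
carried through.\<close>

definition char_det :: "complex^'n^'n::finite \<Rightarrow> complex fps" where
  "char_det A = det (mat 1 - mat fps_X ** const_matrix A)"

lemma det_one_minus_t_eq: "det_one_minus_t x = char_det (cmat x)"
  unfolding det_one_minus_t_def char_det_def
  by (intro arg_cong[of _ _ det]) (simp add: vec_eq_iff mat_mult_nth const_matrix_def)

lemma matrix_diff_mult: "(A - B) ** C = A ** C - B ** C" "C ** (A - B) = C ** A - C ** B"
  for A B C :: "'a::comm_ring_1^'n^'n::finite"
  by (simp_all add: vec_eq_iff matrix_matrix_mult_def algebra_simps sum_subtractf)

lemma char_det_similar:
  fixes A P Q :: "complex^'n^'n::finite"
  assumes "P ** Q = mat 1"
  shows "char_det (P ** A ** Q) = char_det A"
proof -
  let ?P = "const_matrix P" and ?Q = "const_matrix Q" and ?A = "const_matrix A"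
  have PQ: "?P ** ?Q = mat 1" by (simp add: const_matrix_mult[symmetric] assms const_matrix_one)
  have "mat fps_X ** const_matrix (P ** A ** Q) = ?P ** (mat fps_X ** ?A) ** ?Q"
    by (simp add: const_matrix_mult matrix_mul_assoc scalar_matrix_commute[of fps_X ?P])
  then have "mat 1 - mat fps_X ** const_matrix (P ** A ** Q) = ?P ** (mat 1 - mat fps_X ** ?A) ** ?Q"
    by (simp add: matrix_diff_mult PQ)
  moreover have "det ?P * det ?Q = 1" by (metis PQ det_I det_mul)
  ultimately show ?thesis by (simp add: char_det_def det_mul mult.commute mult.left_commute)
qed

lemma char_det_diag: "char_det (diag d) = (\<Prod>j\<in>UNIV. 1 - fps_X * fps_const (d j))"
proof -
  have "char_det (diag d) = (\<Prod>j\<in>UNIV. (mat 1 - mat fps_X ** const_matrix (diag d)) $ j $ j)"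
    unfolding char_det_def
    by (rule det_diagonal) (simp add: mat_mult_nth const_matrix_def diag_def, simp add: mat_def)
  also have "\<dots> = (\<Prod>j\<in>UNIV. 1 - fps_X * fps_const (d j))"
    by (intro prod.cong) (simp_all add: mat_mult_nth const_matrix_def diag_def, simp_all add: mat_def)
  finally show ?thesis .
qed

text \<open>Both factors are invariant under conjugation, and for a diagonal matrix the trace on the
\<open>k\<close>-th symmetric power is the complete homogeneous symmetric polynomial in the diagonal entries.\<close>

lemma molien_diagonalizable:
  fixes P Q :: "complex^'n^'n::finite"
  assumes "P ** Q = mat 1" "Q ** P = mat 1"
  shows "char_det (P ** diag d ** Q) * Abs_fps (\<lambda>k. sym_trace k (P ** diag d ** Q)) = 1"
proof -
  have "sym_trace k (P ** diag d ** Q) = sym_trace k (diag d)" for k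
    using sym_trace_commute[of k "P ** diag d" Q] assms by (simp add: matrix_mul_assoc)
  then have "Abs_fps (\<lambda>k. sym_trace k (P ** diag d ** Q)) = (\<Prod>j\<in>UNIV. geometric (d j))"
    by (simp add: sym_trace_diag_generating)
  moreover have "char_det (P ** diag d ** Q) * (\<Prod>j\<in>UNIV. geometric (d j)) = 1"
    by (simp add: char_det_similar[OF assms(1)] char_det_diag prod.distrib[symmetric] geometric_inverse)
  ultimately show ?thesis by simp
qed

lemma root_of_unity_sum:
  fixes N k :: nat
  assumes "k < N"
  defines "\<omega> \<equiv> cis (2 * pi / real N)"
  shows "(\<Sum>j<N. (inverse \<omega> ^ k) ^ j) = (if k = 0 then of_nat N else 0)"
proof (cases "k = 0")
  case False
  have N: "N > 0" using assms by simp
  have pow: "\<omega> ^ i = cis (2 * pi * real i / real N)" for i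
    by (simp add: \<omega>_def Complex.DeMoivre algebra_simps)
  have "inj_on (\<lambda>k. cis (2 * pi * real k / real N)) {..<N}"
    using Complex.bij_betw_roots_unity[OF N] by (simp add: bij_betw_def)
  then have "\<omega> ^ k \<noteq> \<omega> ^ 0"
    unfolding pow using False assms(1) N by (auto dest!: inj_onD[of _ _ k 0])
  then have ne: "inverse \<omega> ^ k \<noteq> 1" by (simp add: power_inverse)
  have "\<omega> ^ N = 1" using N by (simp add: pow)
  then have "(inverse \<omega> ^ k) ^ N = 1"
    by (metis inverse_1 mult.commute power_inverse power_mult power_one)
  then have "(\<Sum>j<N. (inverse \<omega> ^ k) ^ j) = 0"
    using ne by (simp add: sum_gp_strict)
  then show ?thesis using False by simp
qed simp

text \<open>For an \<open>N\<close>-th root of unity \<open>\<zeta>\<close> the vector \<open>w = \<Sum>\<^sub>k \<zeta>\<^sup>-\<^sup>k A\<^sup>k v\<close> satisfies \<open>A w = \<zeta> w\<close>. Summing these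
vectors over all \<open>N\<close>-th roots of unity gives \<open>N v\<close>.\<close>

lemma finite_order_eigenvectors_span:
  fixes A :: "complex^'n^'n::finite"
  assumes N: "N > 0" and order: "\<And>v. (((*v) A) ^^ N) v = v"
  shows "vec.span {v. \<exists>c. A *v v = c *s v} = UNIV"
proof -
  define \<omega> where "\<omega> = cis (2 * pi / real N)"
  have \<omega>0: "\<omega> \<noteq> 0" by (simp add: \<omega>_def)
  have \<omega>N: "\<omega> ^ N = 1" using N by (simp add: \<omega>_def Complex.DeMoivre)
  \<comment> \<open>the terms of \<open>N\<close> times the projection of \<open>v\<close> to the eigenvalue \<open>\<omega>\<^sup>j\<close>, periodic in \<open>k\<close> with period \<open>N\<close>\<close>
  define g where "g j v k = (inverse \<omega> ^ k) ^ j *s ((((*v) A) ^^ k) v)" for j v k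
  have gN: "g j v N = g j v 0" for j v
    by (simp add: g_def order power_inverse \<omega>N)
  have step: "A *v g j v k = \<omega> ^ j *s g j v (Suc k)" for j v k
  proof -
    have "\<omega> ^ j * (inverse \<omega> ^ Suc k) ^ j = (\<omega> * inverse \<omega> ^ Suc k) ^ j"
      by (simp add: power_mult_distrib)
    also have "\<omega> * inverse \<omega> ^ Suc k = inverse \<omega> ^ k" using \<omega>0 by simp
    finally show ?thesis by (simp add: g_def matrix_vector_mult_scaleR vec.scale)
  qed
  have eigen: "A *v (\<Sum>k<N. g j v k) = \<omega> ^ j *s (\<Sum>k<N. g j v k)" for j v
  proof -
    have "(\<Sum>k<N. g j v (Suc k)) + g j v 0 = (\<Sum>k<N. g j v k) + g j v N"
      by (metis add.commute sum.lessThan_Suc sum.lessThan_Suc_shift)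
    then have "(\<Sum>k<N. g j v (Suc k)) = (\<Sum>k<N. g j v k)" by (simp add: gN)
    moreover have "A *v (\<Sum>k<N. g j v k) = (\<Sum>k<N. A *v g j v k)"
      by (rule vec.sum)
    ultimately show ?thesis by (simp add: step vec.scale_sum_right[symmetric])
  qed
  have total: "(\<Sum>j<N. \<Sum>k<N. g j v k) = of_nat N *s v" for v
  proof -
    have "(\<Sum>j<N. \<Sum>k<N. g j v k) = (\<Sum>k<N. (\<Sum>j<N. (inverse \<omega> ^ k) ^ j) *s ((((*v) A) ^^ k) v))"
      unfolding g_def by (subst sum.swap) (simp add: vec.scale_sum_left)
    also have "\<dots> = (\<Sum>k<N. if k = 0 then of_nat N *s v else 0)"
      using root_of_unity_sum[of _ N] by (intro sum.cong) (auto simp: \<omega>_def)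
    also have "\<dots> = of_nat N *s v" using N by (simp add: sum.delta)
    finally show ?thesis .
  qed
  have "v \<in> vec.span {v. \<exists>c. A *v v = c *s v}" for v
  proof -
    have "(\<Sum>j<N. \<Sum>k<N. g j v k) \<in> vec.span {v. \<exists>c. A *v v = c *s v}"
      using eigen by (intro vec.span_sum vec.span_base) blast
    then have "(1 / of_nat N) *s (of_nat N *s v) \<in> vec.span {v. \<exists>c. A *v v = c *s v}"
      unfolding total by (rule vec.span_scale)
    then show ?thesis using N by simp
  qed
  then show ?thesis by blast
qed

lemma finite_order_diagonalizable:
  fixes A :: "complex^'n^'n::finite"
  assumes "N > 0" and "\<And>v. (((*v) A) ^^ N) v = v"
  obtains P Q :: "complex^'n^'n" and d where "A = P ** diag d ** Q" "P ** Q = mat 1" "Q ** P = mat 1"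
proof -
  let ?E = "{v. \<exists>c. A *v v = c *s v}"
  obtain B where B: "B \<subseteq> ?E" "vec.independent B" "?E \<subseteq> vec.span B"
    by (rule vec.maximal_independent_subset)
  have span: "vec.span B = UNIV"
    using vec.span_minimal[OF B(3) vec.subspace_span] finite_order_eigenvectors_span[OF assms] by auto
  have "card B = CARD('n)"
    using vec.dim_eq_card_independent[OF B(2)] vec.dim_span[of B] span vec_dim_card by metis
  moreover have "finite B" using vec.independent_bound_general[OF B(2)] by simp
  ultimately obtain b where b: "bij_betw b (UNIV :: 'n set) B"
    using bij_betw_iff_card[of "UNIV :: 'n set" B] by auto
  define P where "P = (\<chi> i j. b j $ i)"
  have col: "column j P = b j" for j by (simp add: P_def column_def vec_eq_iff)
  then have "columns P = B" using b by (auto simp: columns_def bij_betw_def)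
  then obtain Q where Q: "P ** Q = mat 1"
    using matrix_right_invertible_span_columns[of P] span by auto
  then have Q': "Q ** P = mat 1" by (simp add: matrix_left_right_inverse)
  have "\<exists>c. A *v b j = c *s b j" for j using B(1) b by (auto simp: bij_betw_def)
  then obtain d where d: "A *v b j = d j *s b j" for j by metis
  have "A ** P = P ** diag d"
  proof -
    have "(A ** P) $ i $ j = (P ** diag d) $ i $ j" for i j
    proof -
      have "(A ** P) $ i $ j = (A *v b j) $ i"
        by (simp add: matrix_matrix_mult_def matrix_vector_mult_def P_def)
      also have "\<dots> = (P ** diag d) $ i $ j"
        by (simp add: d matrix_matrix_mult_def P_def diag_def if_distrib cong: if_cong)
      finally show ?thesis .
    qed
    then show ?thesis by (simp add: vec_eq_iff)
  qed
  then have "A = P ** diag d ** Q" by (metis Q matrix_mul_assoc matrix_mul_rid)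
  then show ?thesis by (rule that[OF _ Q Q'])
qed

lemma molien_finite_order:
  fixes A :: "complex^'n^'n::finite"
  assumes "N > 0" and "\<And>v. (((*v) A) ^^ N) v = v"
  shows "char_det A * Abs_fps (\<lambda>k. sym_trace k A) = 1"
proof -
  obtain P Q :: "complex^'n^'n" and d where A: "A = P ** diag d ** Q" "P ** Q = mat 1" "Q ** P = mat 1"
    by (rule finite_order_diagonalizable[OF assms])
  show ?thesis unfolding A(1) by (rule molien_diagonalizable[OF A(2,3)])
qed

lemma char_det_transpose: "char_det (transpose A) = char_det A"
proof -
  have "mat 1 - mat fps_X ** const_matrix (transpose A) =
      transpose (mat 1 - mat fps_X ** const_matrix A)"
    by (simp add: vec_eq_iff mat_mult_nth transpose_def const_matrix_def) (auto simp: mat_def)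
  then show ?thesis by (simp add: char_det_def)
qed


section \<open>Traces in Clifford modules\<close>

text \<open>Proved by induction on the length. Move the first vector \<open>v\<close> of a word \<open>v # vs\<close> step by step to the
end, and in the reversed word move it to the front. Each step exchanges \<open>v\<close> with a neighbour, which changes
the sign and adds a multiple of the trace of a shorter word of even length; by induction these corrections
are the same for the word and its reversal. After an odd number of steps the difference of the two
traces has changed its sign, but by cyclicity it has returned to its initial value.\<close>

lemma clifford_trace_reverse:
  fixes Tr :: "'v list \<Rightarrow> complex"
  assumes cyclic: "\<And>us vs. Tr (us @ vs) = Tr (vs @ us)"
    and anticommute: "\<And>us v w vs. Tr (us @ [v, w] @ vs) = 2 * \<beta> v w * Tr (us @ vs) - Tr (us @ [w, v] @ vs)"
    and symmetric: "\<And>v w. \<beta> v w = \<beta> w v"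
    and "even (length ws)"
  shows "Tr ws = Tr (rev ws)"
  using assms(4)
proof (induction "length ws" arbitrary: ws rule: less_induct)
  case less
  show ?case
  proof (cases ws)
    case (Cons v vs)
    \<comment> \<open>the asymmetry under reversal of the word with \<open>v\<close> placed between \<open>us\<close> and \<open>vs\<close>\<close>
    define E where "E us vs = Tr (us @ [v] @ vs) - Tr (rev vs @ [v] @ rev us)" for us vs
    have move: "E us xs = (-1) ^ length xs * E (us @ xs) []"
      if "length (us @ xs) = length vs" for us xs
      using that
    proof (induction xs arbitrary: us)
      case (Cons w xs)
      have len: "length ws = Suc (Suc (length (us @ xs)))" using Cons.prems \<open>ws = v # vs\<close> by simp
      have "Tr (us @ xs) = Tr (rev (us @ xs))"
        by (rule less.hyps) (use len less.prems in \<open>simp_all only: even_Suc lessI less_SucI\<close>, simp)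
      then have "E us (w # xs) = - E (us @ [w]) xs"
        using anticommute[of us v w xs] anticommute[of "rev xs" w v "rev us"] symmetric[of v w]
        by (simp add: E_def)
      then show ?case using Cons.IH[of "us @ [w]"] Cons.prems by simp
    qed simp
    have "odd (length vs)" using less.prems Cons by simp
    then have "E [] vs = - E vs []" using move[of "[]" vs] by simp
    moreover have "E vs [] = E [] vs"
      using cyclic[of vs "[v]"] cyclic[of "[v]" "rev vs"] by (simp add: E_def)
    ultimately have "E [] vs = 0" by simp
    then show ?thesis by (simp add: E_def Cons)
  qed simp
qed

definition word_monoid :: "'n list monoid" where
  "word_monoid = \<lparr>carrier = UNIV, mult = (@), one = []\<rparr>"

lemma monoid_word_monoid: "Group.monoid word_monoid"
  by unfold_locales (auto simp: word_monoid_def)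

abbreviation "length_parity w \<equiv> (of_nat (length w) :: bit)"

lemma tensor_algebra_eq: "tensor_algebra = monoid_superalgebra word_monoid length_parity"
  by (simp add: tensor_algebra_def word_monoid_def)

lemma tensor_vec_carrier: "tensor_vec v \<in> carrier tensor_algebra"
proof -
  have "support (tensor_vec v) \<subseteq> range (\<lambda>i. [i])"
  proof
    fix w assume "w \<in> support (tensor_vec v)"
    then have "\<exists>i. v $ i * delta [i] w \<noteq> 0"
      unfolding support_def tensor_vec_def by (metis (mono_tags, lifting) mem_Collect_eq sum.neutral)
    then show "w \<in> range (\<lambda>i. [i])" by (auto simp: delta_def split: if_splits)
  qed
  then have "finite (support (tensor_vec v))" by (rule finite_subset) simp
  then show ?thesis
    unfolding tensor_algebra_eq monoid.alg_carrier[OF monoid_word_monoid]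
    by (simp add: word_monoid_def)
qed

lemma ring_tensor_algebra: "ring tensor_algebra"
  unfolding tensor_algebra_eq by (rule monoid.ring_alg[OF monoid_word_monoid])

abbreviation "clifford_relator v \<equiv> tensor_vec v \<otimes>\<^bsub>tensor_algebra\<^esub> tensor_vec v
  \<ominus>\<^bsub>tensor_algebra\<^esub> embed tensor_algebra (bilin v v)"

lemma embed_tensor_carrier: "embed tensor_algebra c \<in> carrier tensor_algebra"
  unfolding tensor_algebra_eq by (rule monoid.embed_carrier[OF monoid_word_monoid])

lemma clifford_relator_carrier: "clifford_relator v \<in> carrier tensor_algebra"
proof -
  interpret ring tensor_algebra by (rule ring_tensor_algebra)
  show ?thesis by (intro minus_closed m_closed tensor_vec_carrier embed_tensor_carrier)
qed

lemma ideal_clifford_ideal: "ideal clifford_ideal tensor_algebra"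
  unfolding clifford_ideal_def
  using clifford_relator_carrier by (intro ring.genideal_ideal[OF ring_tensor_algebra]) auto

lemma clifford_relator_in_ideal: "clifford_relator v \<in> clifford_ideal"
proof -
  have "{clifford_relator v |v. True} \<subseteq> clifford_ideal"
    unfolding clifford_ideal_def
    using clifford_relator_carrier by (intro ring.genideal_self[OF ring_tensor_algebra]) auto
  then show ?thesis by blast
qed

locale clifford_module =
  fixes S :: "(('n::finite list \<Rightarrow> complex) set, 'b::ab_group_add) supermod"
  assumes clifford_supermodule: "supermodule clifford_algebra S"
begin

sublocale S: quotient_module word_monoid length_parity clifford_ideal S
  by (rule quotient_module.intro[OF monoid_word_monoid ideal_clifford_ideal[unfolded tensor_algebra_eq]
        clifford_supermodule[unfolded clifford_algebra_def tensor_algebra_eq]])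

definition "E v = act S (clifford_vec v)"

lemma E_eq: "E v = act S (S.coset (tensor_vec v))"
  by (simp add: E_def clifford_vec_def tensor_algebra_eq)

lemma tensor_vec_in: "tensor_vec v \<in> carrier S.A"
  using tensor_vec_carrier[of v] by (simp add: tensor_algebra_eq)

lemma E_linear: "linear_between (scal S) (vectors S) (scal S) (vectors S) (E v)"
  unfolding E_eq by (intro S.act_linear S.coset_carrier tensor_vec_in)

lemmas E_closed = linear_betweenD(1)[OF E_linear]
  and E_plus = linear_betweenD(2)[OF E_linear]

lemma E_add: "x \<in> vectors S \<Longrightarrow> E (v + w) x = E v x + E w x"
proof -
  assume x: "x \<in> vectors S"
  have "tensor_vec (v + w) = (\<lambda>y. tensor_vec v y + tensor_vec w y)"
    by (simp add: tensor_vec_def fun_eq_iff distrib_right sum.distrib)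
  then show ?thesis
    using S.M_add[OF S.coset_carrier[OF tensor_vec_in[of v]] S.coset_carrier[OF tensor_vec_in[of w]] x]
    by (simp add: E_eq S.coset_add tensor_vec_in)
qed

lemma E_square: "x \<in> vectors S \<Longrightarrow> E v (E v x) = scal S (bilin v v) x"
proof -
  assume x: "x \<in> vectors S"
  let ?v = "tensor_vec v"
  have vv: "?v \<otimes>\<^bsub>S.A\<^esub> ?v \<in> carrier S.A" by (intro S.alg_mult_closed tensor_vec_in)
  have "?v \<otimes>\<^bsub>S.A\<^esub> ?v \<ominus>\<^bsub>S.A\<^esub> embed S.A (bilin v v) \<in> clifford_ideal"
    using clifford_relator_in_ideal[of v] by (simp only: tensor_algebra_eq)
  then have "S.coset (?v \<otimes>\<^bsub>S.A\<^esub> ?v) = S.coset (embed S.A (bilin v v))"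
    using ring.quotient_eq_iff_same_a_r_cos[OF S.ring_alg S.ideal_I vv S.embed_carrier] by simp
  then have "act S (S.coset ?v \<otimes>\<^bsub>S.Q\<^esub> S.coset ?v) x = act S (embed S.Q (bilin v v)) x"
    by (simp add: S.coset_mult tensor_vec_in quotient_embed)
  then show ?thesis
    using S.M_mult[OF S.coset_carrier[OF tensor_vec_in[of v]] S.coset_carrier[OF tensor_vec_in[of v]] x]
      S.M_embed[OF x]
    by (simp add: E_eq)
qed

lemma bilin_add: "bilin (u + v) w = bilin u w + bilin v w" "bilin w (u + v) = bilin w u + bilin w v"
  by (simp_all add: bilin_def distrib_left distrib_right sum.distrib)

lemma bilin_commute: "bilin v w = bilin w v"
  by (simp add: bilin_def mult.commute)

lemma E_anticommute:
  assumes x: "x \<in> vectors S"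
  shows "E v (E w x) = scal S (2 * bilin v w) x - E w (E v x)"
proof -
  have "scal S (bilin (v + w) (v + w)) x = E (v + w) (E (v + w) x)" by (simp add: E_square x)
  also have "\<dots> = E v (E v x) + E v (E w x) + (E w (E v x) + E w (E w x))"
    using x E_closed by (simp add: E_add E_plus)
  finally have "scal S (bilin (v + w) (v + w)) x =
      scal S (bilin v v) x + E v (E w x) + (E w (E v x) + scal S (bilin w w) x)"
    by (simp only: E_square[OF x])
  moreover have "bilin (v + w) (v + w) = bilin v v + 2 * bilin v w + bilin w w"
    by (simp add: bilin_add bilin_commute[of w v])
  ultimately have "scal S (bilin v v) x + scal S (2 * bilin v w) x + scal S (bilin w w) x =
      scal S (bilin v v) x + E v (E w x) + (E w (E v x) + scal S (bilin w w) x)"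
    by (simp only: S.scale_left_distrib)
  then show ?thesis by (simp add: algebra_simps)
qed

primrec E_word :: "(complex^'n) list \<Rightarrow> 'b \<Rightarrow> 'b" where
  "E_word [] x = x"
| "E_word (v # vs) x = E v (E_word vs x)"

lemma E_word_append: "E_word (us @ vs) x = E_word us (E_word vs x)"
  by (induction us) auto

lemma E_word_linear: "linear_between (scal S) (vectors S) (scal S) (vectors S) (E_word vs)"
proof (induction vs)
  case Nil
  then show ?case by (simp add: linear_between_def)
next
  case (Cons v vs)
  from linear_between_compose[OF Cons E_linear[of v]] show ?case by simp
qed

lemma trace_E_word_reverse:
  assumes F: "frame (scal S) (vectors S) J e c" and "even (length vs)"
  shows "frame_trace J e c (E_word vs) = frame_trace J e c (E_word (rev vs))"
proof (rule clifford_trace_reverse[where \<beta> = bilin and Tr = "\<lambda>vs. frame_trace J e c (E_word vs)"])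
  show "frame_trace J e c (E_word (us @ vs)) = frame_trace J e c (E_word (vs @ us))" for us vs
    unfolding E_word_append by (rule frame_trace_commute[OF F F E_word_linear E_word_linear])
  show "frame_trace J e c (E_word (us @ [v, w] @ vs)) =
      2 * bilin v w * frame_trace J e c (E_word (us @ vs)) - frame_trace J e c (E_word (us @ [w, v] @ vs))"
    for us v w vs
  proof -
    have "c j (E_word (us @ [v, w] @ vs) (e j)) =
        2 * bilin v w * c j (E_word (us @ vs) (e j)) - c j (E_word (us @ [w, v] @ vs) (e j))"
      if j: "j \<in> J" for j
    proof -
      define x where "x = E_word vs (e j)"
      have x: "x \<in> vectors S"
        unfolding x_def by (rule linear_betweenD(1)[OF E_word_linear frameD(4)[OF F j]])
      \<comment> \<open>the left part of the word, merged into the functional, so that only linearity of \<open>h\<close> is used\<close>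
      define h where "h y = c j (E_word us y)" for y
      have h: "linear_between (scal S) (vectors S) (*) UNIV h"
        unfolding h_def by (rule linear_between_compose[OF E_word_linear frameD(5)[OF F j]])
      have wv: "E w (E v x) \<in> vectors S" using x E_closed by simp
      have "E v (E w x) = scal S (2 * bilin v w) x + scal S (-1) (E w (E v x))"
        using E_anticommute[OF x, of v w] by simp
      then have "h (E v (E w x)) = h (scal S (2 * bilin v w) x + scal S (-1) (E w (E v x)))"
        by (simp only:)
      also have "\<dots> = h (scal S (2 * bilin v w) x) + h (scal S (-1) (E w (E v x)))"
        by (intro linear_betweenD(2)[OF h] S.subspace_scale[OF S.vectors_subspace] x wv)
      also have "\<dots> = 2 * bilin v w * h x + (-1) * h (E w (E v x))"
        by (simp only: linear_betweenD(3)[OF h x] linear_betweenD(3)[OF h wv])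
      finally have "h (E v (E w x)) = 2 * bilin v w * h x + (-1) * h (E w (E v x))" .
      then show ?thesis by (simp add: E_word_append x_def h_def)
    qed
    then show ?thesis
      by (simp add: frame_trace_def sum_subtractf sum_distrib_left)
  qed
qed (use assms bilin_commute in auto)

abbreviation "basis_E i \<equiv> E (axis i 1)"

lemma op_Cons: "x \<in> vectors S \<Longrightarrow> S.op (i # w) x = basis_E i (S.op w x)"
proof -
  assume x: "x \<in> vectors S"
  have "tensor_vec (axis i 1) = delta [i]"
    by (rule ext) (simp add: tensor_vec_def axis_def if_distrib[of "\<lambda>c. c * _"] cong: if_cong)
  then have "S.op [i] = basis_E i" by (simp add: S.op_def E_eq)
  moreover have "S.op ([i] \<otimes>\<^bsub>word_monoid\<^esub> w) x = S.op [i] (S.op w x)"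
    using x by (intro S.op_mult) (simp_all add: word_monoid_def)
  ultimately show ?thesis by (simp add: word_monoid_def)
qed

lemma basis_E_graded: "x \<in> piece S j \<Longrightarrow> basis_E i x \<in> piece S (1 + j)"
proof -
  assume x: "x \<in> piece S j"
  then have xV: "x \<in> vectors S" using S.piece_subset_vectors by blast
  have "S.op [] x = x" using S.op_one[OF xV] by (simp add: word_monoid_def)
  then have "S.op [i] x = basis_E i x" using op_Cons[OF xV, of i "[]"] by simp
  then show ?thesis using S.op_graded[of "[i]" x j] x by (simp add: word_monoid_def)
qed

text \<open>Indices are added one at a time. If the span of \<open>X\<close> is stable under the operators \<open>E\<^sub>j\<close> with \<open>j\<close> in \<open>N\<close>, then the
span of \<open>X\<close> and \<open>E\<^sub>i X\<close> is stable under them and under \<open>E\<^sub>i\<close>, since \<open>E\<^sub>j E\<^sub>i + E\<^sub>i E\<^sub>j\<close> is a scalar and \<open>E\<^sub>i\<close> has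
square \<open>1\<close>. It follows that simple Clifford modules are finite-dimensional.\<close>

lemma finite_invariant_set:
  assumes x: "x \<in> piece S k" and "finite N"
  shows "\<exists>X. finite X \<and> x \<in> X \<and> X \<subseteq> piece S 0 \<union> piece S 1 \<and>
    (\<forall>i\<in>N. \<forall>y\<in>X. basis_E i y \<in> S.span X)"
  using assms(2)
proof (induction N)
  case empty
  have "x \<in> piece S 0 \<union> piece S 1" using x by (cases k) auto
  then show ?case by (intro exI[of _ "{x}"]) auto
next
  case (insert i N)
  then obtain X where X: "finite X" "x \<in> X" "X \<subseteq> piece S 0 \<union> piece S 1"
    "\<And>j y. j \<in> N \<Longrightarrow> y \<in> X \<Longrightarrow> basis_E j y \<in> S.span X" by blast
  let ?X = "X \<union> basis_E i ` X"
  have XV: "X \<subseteq> vectors S" using X(3) S.piece_subset_vectors by blast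
  have "basis_E i y \<in> piece S 0 \<union> piece S 1" if "y \<in> X" for y
    using that X(3) basis_E_graded[of y 0 i] basis_E_graded[of y 1 i] by auto
  then have hom: "?X \<subseteq> piece S 0 \<union> piece S 1" using X(3) by blast
  have span: "S.span X \<subseteq> S.span ?X" by (rule S.span_mono) blast
  have "basis_E j y \<in> S.span ?X" if j: "j \<in> insert i N" and y: "y \<in> ?X" for j y
  proof (cases "y \<in> X")
    case True
    then show ?thesis
      using j X(4) span S.span_base[of "basis_E i y" ?X] by blast
  next
    case False
    then obtain y' where y': "y' \<in> X" "y = basis_E i y'" using y by blast
    have y'V: "y' \<in> vectors S" using y' XV by blast
    have y'S: "y' \<in> S.span ?X" using y' by (intro S.span_base) blast
    show ?thesis
    proof (cases "j = i")
      case True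
      then show ?thesis using y' y'V y'S by (simp add: E_square S.span_scale)
    next
      case False
      then have "basis_E j y' \<in> S.span X" using j X(4) y' by blast
      then have "basis_E i (basis_E j y') \<in> S.span ?X"
        by (rule linear_between_in_span[OF S.vector_space_axioms S.vectors_subspace E_linear XV, rotated])
          (intro S.span_base, blast)
      then show ?thesis
        using y'S by (simp add: y'(2) E_anticommute[OF y'V, of "axis j 1" "axis i 1"]
            S.span_diff S.span_scale)
    qed
  qed
  then show ?case using X(1,2) hom by (intro exI[of _ ?X]) blast
qed

lemma simple_clifford_frame:
  assumes "simple_supermodule clifford_algebra S"
  shows "\<exists>Y. frame (scal S) (vectors S) Y (\<lambda>b. b) (\<lambda>b x. S.representation Y x b)"
proof -
  have simple: "simple_supermodule S.Q S"
    using assms by (simp add: clifford_algebra_def tensor_algebra_eq)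
  obtain x k where x: "x \<in> piece S k" "x \<noteq> 0" by (rule S.simple_homogeneous_vector[OF simple])
  obtain X where X: "finite X" "x \<in> X" "X \<subseteq> piece S 0 \<union> piece S 1"
    "\<And>i y. y \<in> X \<Longrightarrow> basis_E i y \<in> S.span X"
    using finite_invariant_set[OF x(1) finite[of UNIV]] by blast
  have XV: "X \<subseteq> vectors S" using X(3) S.piece_subset_vectors by blast
  have "S.op w y \<in> S.span X" if y: "y \<in> X" for w y
  proof (induction w)
    case Nil
    show ?case using S.op_one[of y] y XV S.span_base[OF y] by (auto simp: word_monoid_def)
  next
    case (Cons i w)
    have "basis_E i (S.op w y) \<in> S.span X"
      by (rule linear_between_in_span[OF S.vector_space_axioms S.vectors_subspace E_linear XV X(4) Cons])
    then show ?case using y XV by (auto simp: op_Cons)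
  qed
  then have "S.span X = vectors S"
    using X(2,3) x(2) by (intro S.simple_span[OF simple]) auto
  then show ?thesis by (rule frame_exists_of_finite_span[OF S.vector_space_axioms X(1)])
qed

end

lemma vectors_pullback: "vectors (pullback \<phi> S) = vectors S" "scal (pullback \<phi> S) = scal S"
  by (simp_all add: vectors_def pullback_def)

lemma supermodule_pullback:
  assumes \<phi>: "superalgebra_hom A B \<phi>" and S: "supermodule B S"
  shows "supermodule A (pullback \<phi> S)"
proof -
  interpret supermodule B S by fact
  have hom: "\<phi> \<in> ring_hom A B" and emb: "\<And>c. \<phi> (embed A c) = embed B c"
    and grd: "\<And>i. \<phi> ` homog A i \<subseteq> homog B i"
    using \<phi> by (auto simp: superalgebra_hom_def)
  have P: "piece (pullback \<phi> S) = piece S" "act (pullback \<phi> S) = (\<lambda>a. act S (\<phi> a))"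
    by (simp_all add: pullback_def)
  note closed = ring_hom_closed[OF hom] ring_hom_add[OF hom] ring_hom_mult[OF hom]
  have grd': "act S (\<phi> a) x \<in> piece S (i + j)" if "a \<in> homog A i" "x \<in> piece S j" for a x i j
    using grd[of i] that by (intro graded) auto
  show ?thesis
    unfolding supermodule_def vectors_pullback P emb
    using vector_space subspace direct grd'
    by (simp add: closed act_closed act_plus act_add act_mult act_embed)
qed

context weyl_cover
begin

definition t_prod :: "'n list \<Rightarrow> 'n cover_elt" where
  "t_prod u = foldr (\<lambda>i g. t i \<otimes>\<^bsub>D\<^esub> g) u \<one>\<^bsub>D\<^esub>"

lemma t_prod_Nil: "t_prod [] = \<one>\<^bsub>D\<^esub>" and t_prod_Cons: "t_prod (i # u) = t i \<otimes>\<^bsub>D\<^esub> t_prod u"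
  by (simp_all add: t_prod_def)

lemma t_prod_closed: "t_prod u \<in> carrier D"
  by (induction u) (simp_all add: t_prod_Nil t_prod_Cons t_in_D)

lemma t_prod_snoc: "t_prod (u @ [i]) = t_prod u \<otimes>\<^bsub>D\<^esub> t i"
  by (induction u) (simp_all add: t_prod_Nil t_prod_Cons t_in_D t_prod_closed D.m_assoc)

lemma t_prod_inverse: "inv\<^bsub>D\<^esub> (t_prod u) = t_prod (rev u)"
proof (rule D.inv_equality)
  show "t_prod (rev u) \<otimes>\<^bsub>D\<^esub> t_prod u = \<one>\<^bsub>D\<^esub>"
  proof (induction u)
    case (Cons i u)
    have "t_prod (rev (i # u)) \<otimes>\<^bsub>D\<^esub> t_prod (i # u) =
        t_prod (rev u) \<otimes>\<^bsub>D\<^esub> (t i \<otimes>\<^bsub>D\<^esub> t i) \<otimes>\<^bsub>D\<^esub> t_prod u"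
      by (simp add: t_prod_Cons t_prod_snoc D.m_assoc t_in_D t_prod_closed)
    then show ?case using Cons by (simp add: t_square t_prod_closed)
  qed (simp add: t_prod_Nil)
qed (rule t_prod_closed)+

lemma D_normal_form:
  assumes "g \<in> carrier D"
  obtains u where "g = t_prod u \<or> g = z \<otimes>\<^bsub>D\<^esub> t_prod u"
proof -
  have "\<exists>u. g = t_prod u \<or> g = z \<otimes>\<^bsub>D\<^esub> t_prod u"
    using assms
  proof (induction rule: D_induct)
    case one
    show ?case using t_prod_Nil by metis
  next
    case (z g)
    then show ?case using z_z[OF t_prod_closed] by auto
  next
    case (t i g)
    then obtain u where u: "g = t_prod u \<or> g = z \<otimes>\<^bsub>D\<^esub> t_prod u" by blast
    have "t i \<otimes>\<^bsub>D\<^esub> (z \<otimes>\<^bsub>D\<^esub> t_prod u) = z \<otimes>\<^bsub>D\<^esub> t_prod (i # u)"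
      unfolding t_prod_Cons
      by (simp only: D.m_assoc[symmetric] z_central[OF t_in_D] t_in_D z_in_D t_prod_closed)
    then have "t i \<otimes>\<^bsub>D\<^esub> g = t_prod (i # u) \<or> t i \<otimes>\<^bsub>D\<^esub> g = z \<otimes>\<^bsub>D\<^esub> t_prod (i # u)"
      using u by (auto simp: t_prod_Cons)
    then show ?case by blast
  qed
  then show ?thesis using that by blast
qed

lemma inv_z_mult: "g \<in> carrier D \<Longrightarrow> inv\<^bsub>D\<^esub> (z \<otimes>\<^bsub>D\<^esub> g) = z \<otimes>\<^bsub>D\<^esub> inv\<^bsub>D\<^esub> g"
proof -
  assume g: "g \<in> carrier D"
  have "inv\<^bsub>D\<^esub> z = z" by (rule D.inv_equality[OF z_square z_in_D z_in_D])
  then show ?thesis using g z_in_D by (simp add: D.inv_mult_group z_central)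
qed

lemma parity_t_prod: "cover_parity (t_prod u) = of_nat (length u)"
proof (induction u)
  case Nil
  show ?case by (simp add: t_prod_Nil parity_one)
next
  case (Cons i u)
  have "\<theta> (t_prod (i # u)) = \<theta> (t i) \<otimes>\<^bsub>W\<^esub> \<theta> (t_prod u)"
    by (simp add: t_prod_Cons theta_hom t_in_D t_prod_closed)
  then show ?case
    using Cons parity_mult[OF theta_in_W[OF t_in_D] theta_in_W[OF t_prod_closed], of i u]
    by (simp add: theta_t parity_s)
qed

lemma parity_z_mult: "g \<in> carrier D \<Longrightarrow> cover_parity (z \<otimes>\<^bsub>D\<^esub> g) = cover_parity g"
  using theta_eq_iff[of "z \<otimes>\<^bsub>D\<^esub> g" g] by (simp add: eq_mod_z_def z_in_D)

end

locale basic_spin = weyl_cover \<Phi> \<alpha> m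
  for \<Phi> :: "(real^'n::finite) set" and \<alpha> :: "'n \<Rightarrow> real^'n" and m :: "'n \<Rightarrow> 'n \<Rightarrow> nat" +
  fixes B :: "('n spin_elt, 'b::ab_group_add) supermod"
  assumes basic_spin: "basic_spin_module \<Phi> \<alpha> m B"
begin

sublocale spin_module \<Phi> \<alpha> m B
proof (rule spin_module.intro[OF weyl_cover_axioms spin_module_axioms.intro])
  obtain \<phi> S where "spin_to_clifford \<Phi> \<alpha> m \<phi>" "simple_supermodule clifford_algebra S" "B = pullback \<phi> S"
    using basic_spin by (auto simp: basic_spin_module_def)
  then show "supermodule (spin_algebra \<Phi> \<alpha> m) B"
    by (auto simp: spin_to_clifford_def simple_supermodule_def intro: supermodule_pullback)
qed

lemma basic_spin_frame:
  "\<exists>Y. frame (scal B) (vectors B) Y (\<lambda>b. b) (\<lambda>b x. module.representation (scal B) Y x b)"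
proof -
  obtain \<phi> S where \<phi>: "spin_to_clifford \<Phi> \<alpha> m \<phi>"
    and S: "simple_supermodule clifford_algebra S" "B = pullback \<phi> S"
    using basic_spin by (auto simp: basic_spin_module_def)
  interpret clifford_module S using S(1) by (simp add: clifford_module_def simple_supermodule_def)
  show ?thesis using simple_clifford_frame[OF S(1)] by (simp add: S(2) vectors_pullback)
qed

text \<open>Up to the central sign, \<open>g\<close> is a product of an even number of generators \<open>t\<^sub>i\<close>. These are
involutions acting as Clifford vectors, so the inverse of the product is the reversed product.\<close>

lemma basic_spin_trace_inverse:
  assumes F: "frame (scal B) (vectors B) J e c"
    and g: "g \<in> carrier D" and even: "cover_parity g = 0"
  shows "frame_trace J e c (M.op (inv\<^bsub>D\<^esub> g)) = frame_trace J e c (M.op g)"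
proof -
  obtain \<phi> S where \<phi>: "spin_to_clifford \<Phi> \<alpha> m \<phi>"
    and S: "simple_supermodule clifford_algebra S" and B: "B = pullback \<phi> S"
    using basic_spin by (auto simp: basic_spin_module_def)
  interpret C: clifford_module S using S by (simp add: clifford_module_def simple_supermodule_def)
  have FS: "frame (scal S) (vectors S) J e c" using F by (simp add: B vectors_pullback)
  define a where "a i = cvec ((1 / sqrt (\<alpha> i \<bullet> \<alpha> i)) *\<^sub>R \<alpha> i)" for i
  have act_B: "act B x = act S (\<phi> x)" and vectors_B: "vectors B = vectors S" for x
    by (simp_all add: B vectors_pullback) (simp add: pullback_def)
  have op_t: "M.op (t i) = C.E (a i)" for i
    using \<phi> by (simp add: op_spin[symmetric] act_B spin_to_clifford_def C.E_def a_def)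
  have op_word: "M.op (t_prod u) x = C.E_word (map a u) x" if "x \<in> vectors S" for u x
  proof (induction u)
    case Nil
    show ?case using that M.op_one[of x] by (simp add: t_prod_Nil vectors_B)
  next
    case (Cons i u)
    then show ?case
      using that M.op_mult[OF t_in_D t_prod_closed, of x i u]
      by (simp add: t_prod_Cons op_t vectors_B)
  qed
  have tr: "frame_trace J e c (M.op (t_prod u)) = frame_trace J e c (C.E_word (map a u))" for u
    unfolding frame_trace_def using frameD(4)[OF FS] by (simp add: op_word)
  have rev: "frame_trace J e c (M.op (inv\<^bsub>D\<^esub> (t_prod u))) = frame_trace J e c (M.op (t_prod u))"
    if "cover_parity (t_prod u) = 0" for u
  proof -
    have "(of_nat k :: bit) = (if even k then 0 else 1)" for k by (induction k) auto
    then have "even (length u)" using that by (simp add: parity_t_prod split: if_splits)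
    then show ?thesis
      using C.trace_E_word_reverse[OF FS, of "map a u"] by (simp add: t_prod_inverse tr rev_map)
  qed
  obtain u where "g = t_prod u \<or> g = z \<otimes>\<^bsub>D\<^esub> t_prod u" by (rule D_normal_form[OF g])
  then show ?thesis
  proof
    assume "g = t_prod u"
    then show ?thesis using rev even by simp
  next
    assume gz: "g = z \<otimes>\<^bsub>D\<^esub> t_prod u"
    have "cover_parity (t_prod u) = 0" using even by (simp add: gz parity_z_mult t_prod_closed)
    from rev[OF this] show ?thesis
      by (simp add: gz inv_z_mult t_prod_closed trace_z_mult[OF F])
  qed
qed

end


section \<open>The tensor product with a symmetric power\<close>

lemma cmat_mult: "cmat (x ** y) = cmat x ** cmat y"
  by (simp add: cmat_def matrix_matrix_mult_def vec_eq_iff)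

lemma cmat_one: "cmat (mat 1) = diag (\<lambda>_. 1)"
  by (auto simp: cmat_def mat_def diag_def vec_eq_iff)

lemma cmat_transpose: "cmat (transpose x) = transpose (cmat x)"
  by (simp add: cmat_def transpose_def vec_eq_iff)

lemma sym_coeff_one: "sym_coeff (diag (\<lambda>_. 1)) \<nu> \<mu> = (if \<mu> = \<nu> then 1 else 0)"
  by (simp add: sym_coeff_def subst_monomial_diag lookup_single when_def)

lemma sym_act_monomial: "sym_act x (single \<mu> 1) = subst_monomial (cmat x) \<mu>"
  by (simp add: sym_act_eq_subst subst_single)

context spin_module
begin

abbreviation "ts \<equiv> tensor_scal M"
abbreviation "\<T> \<equiv> cover_tensor_act \<Phi> \<alpha> m M"

text \<open>The space underlying \<open>M \<otimes> S\<^sup>kV\<close>: homogeneous polynomials of degree \<open>k\<close> with coefficients in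
\<open>M\<close>.\<close>

definition coeff_space :: "nat \<Rightarrow> (('n \<Rightarrow>\<^sub>0 nat) \<Rightarrow>\<^sub>0 'm) set" where
  "coeff_space k = {f. (\<forall>\<mu>. lookup f \<mu> \<in> vectors M) \<and> (\<forall>\<mu>. \<mu> \<notin> monomials k \<longrightarrow> lookup f \<mu> = 0)}"

lemma lookup_ts: "lookup (ts c f) \<mu> = scal M c (lookup f \<mu>)"
  by (simp add: tensor_scal_def Poly_Mapping.map.rep_eq when_def)

lemma lookup_pure: "lookup (pure_tensor M b p) \<mu> = scal M (lookup p \<mu>) b"
  by (simp add: pure_tensor_def Poly_Mapping.map.rep_eq when_def)

lemma vector_space_ts: "vector_space (ts :: complex \<Rightarrow> (('n \<Rightarrow>\<^sub>0 nat) \<Rightarrow>\<^sub>0 'm) \<Rightarrow> _)"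
  by unfold_locales
    (auto intro!: poly_mapping_eqI simp: lookup_ts lookup_add M.scale_right_distrib M.scale_left_distrib)

sublocale ts: complex_vector_space "ts :: complex \<Rightarrow> (('n \<Rightarrow>\<^sub>0 nat) \<Rightarrow>\<^sub>0 'm) \<Rightarrow> _"
  by (rule complex_vector_space.intro[OF vector_space_ts])

lemma coeff_space_subspace: "ts.subspace (coeff_space k)"
  by (rule ts.subspaceI)
    (auto simp: coeff_space_def lookup_add lookup_ts M.subspace_0[OF M.vectors_subspace]
      intro: M.subspace_add[OF M.vectors_subspace] M.subspace_scale[OF M.vectors_subspace])

lemma spin_tensor_simps: "scal (spin_tensor \<Phi> \<alpha> m M k) = ts"
  "piece (spin_tensor \<Phi> \<alpha> m M k) i =
     ts.span {pure_tensor M b p |b p. b \<in> piece M i \<and> p \<in> sym_power k}"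
  by (simp_all add: spin_tensor_def)

lemma spin_tensor_vectors: "vectors (spin_tensor \<Phi> \<alpha> m M k) = coeff_space k"
proof
  let ?N = "spin_tensor \<Phi> \<alpha> m M k"
  have sub: "ts.subspace (vectors ?N)"
    unfolding vectors_def spin_tensor_simps
    by (rule ts.subspace_sums[OF ts.subspace_span ts.subspace_span])
  have "piece ?N i \<subseteq> coeff_space k" for i
    unfolding spin_tensor_simps
  proof (rule ts.span_minimal[OF _ coeff_space_subspace], safe)
    fix b and p :: "'n symalg" assume b: "b \<in> piece M i" and p: "p \<in> sym_power k"
    have "b \<in> vectors M" using b M.piece_subset_vectors by blast
    moreover have "lookup p \<mu> = 0" if "\<mu> \<notin> monomials k" for \<mu>
      using p that by (auto simp: sym_power_def monomials_def in_keys_iff)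
    ultimately show "pure_tensor M b p \<in> coeff_space k"
      by (auto simp: coeff_space_def lookup_pure intro: M.subspace_scale[OF M.vectors_subspace])
  qed
  then show "vectors ?N \<subseteq> coeff_space k"
    using ts.subspace_add[OF coeff_space_subspace] unfolding vectors_def by blast
  show "coeff_space k \<subseteq> vectors ?N"
  proof
    fix f assume f: "f \<in> coeff_space k"
    have pure: "single \<mu> x \<in> piece ?N i" if "\<mu> \<in> monomials k" "x \<in> piece M i" for \<mu> x i
    proof -
      have "single \<mu> x = pure_tensor M x (single \<mu> 1)"
        by (rule poly_mapping_eqI) (simp add: lookup_pure lookup_single when_def)
      moreover have "single \<mu> 1 \<in> sym_power k" using that(1) by (simp add: sym_power_def monomials_def)
      ultimately show ?thesis unfolding spin_tensor_simps using that(2) by (intro ts.span_base) blast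
    qed
    have "single \<mu> (lookup f \<mu>) \<in> vectors ?N" if "\<mu> \<in> keys f" for \<mu>
    proof -
      have \<mu>: "\<mu> \<in> monomials k" "lookup f \<mu> \<in> vectors M"
        using f that by (auto simp: coeff_space_def in_keys_iff)
      obtain x y where xy: "x \<in> piece M 0" "y \<in> piece M 1" "lookup f \<mu> = x + y"
        using \<mu>(2) by (rule M.vectors_cases)
      show ?thesis
        unfolding xy(3) single_add vectors_def using pure[OF \<mu>(1)] xy(1,2) by blast
    qed
    then have "(\<Sum>\<mu>\<in>keys f. single \<mu> (lookup f \<mu>)) \<in> vectors ?N" by (rule ts.subspace_sum[OF sub])
    moreover have "(\<Sum>\<mu>\<in>keys f. single \<mu> (lookup f \<mu>)) = f"
      by (rule poly_mapping_eqI)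
        (auto simp: lookup_sum lookup_single when_def in_keys_iff cong: if_cong)
    ultimately show "f \<in> vectors ?N" by simp
  qed
qed

lemma op_zero: "g \<in> carrier D \<Longrightarrow> M.op g 0 = 0"
  by (rule linear_between_zero[OF M.op_linear M.subspace_0[OF M.vectors_subspace]])

text \<open>In coordinates \<open>g\<close> acts by the Kronecker product of its matrix on \<open>S\<^sup>kV\<close> with its operator on
\<open>M\<close>.\<close>

lemma lookup_tensor_act:
  assumes g: "g \<in> carrier D" and f: "f \<in> coeff_space k"
  shows "lookup (\<T> g f) \<nu> =
    (\<Sum>\<mu>\<in>monomials k. scal M (sym_coeff (cmat (\<theta> g)) \<nu> \<mu>) (M.op g (lookup f \<mu>)))"
proof -
  have "lookup (\<T> g f) \<nu> =
      (\<Sum>\<mu>\<in>keys f. scal M (sym_coeff (cmat (\<theta> g)) \<nu> \<mu>) (M.op g (lookup f \<mu>)))"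
    by (simp add: cover_tensor_act_def lookup_sum lookup_pure op_spin sym_act_monomial sym_coeff_def)
  also have "\<dots> = (\<Sum>\<mu>\<in>monomials k. scal M (sym_coeff (cmat (\<theta> g)) \<nu> \<mu>) (M.op g (lookup f \<mu>)))"
    by (rule sum.mono_neutral_left)
      (use f op_zero[OF g] finite_monomials in \<open>auto simp: coeff_space_def in_keys_iff\<close>)
  finally show ?thesis .
qed

lemma lookup_in_vectors: "f \<in> coeff_space k \<Longrightarrow> lookup f \<mu> \<in> vectors M"
  by (simp add: coeff_space_def)

lemma tensor_act_closed:
  assumes g: "g \<in> carrier D" and f: "f \<in> coeff_space k"
  shows "\<T> g f \<in> coeff_space k"
  using linear_betweenD(1)[OF M.op_linear[OF g]] lookup_in_vectors[OF f]
  by (auto simp: coeff_space_def[of k] lookup_tensor_act[OF g f] sym_coeff_outside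
      intro!: M.subspace_sum[OF M.vectors_subspace] M.subspace_scale[OF M.vectors_subspace])

lemma tensor_act_linear:
  assumes g: "g \<in> carrier D"
  shows "linear_between ts (coeff_space k) ts (coeff_space k) (\<T> g)"
proof (rule linear_betweenI)
  note lin = linear_betweenD[OF M.op_linear[OF g]]
  fix f assume f: "f \<in> coeff_space k"
  show "\<T> g f \<in> coeff_space k" by (rule tensor_act_closed[OF g f])
  show "\<T> g (f + h) = \<T> g f + \<T> g h" if h: "h \<in> coeff_space k" for h
    by (rule poly_mapping_eqI)
      (simp add: lookup_add lookup_tensor_act[OF g f] lookup_tensor_act[OF g h]
        lookup_tensor_act[OF g ts.subspace_add[OF coeff_space_subspace f h]]
        lin(2)[OF lookup_in_vectors[OF f] lookup_in_vectors[OF h]] M.scale_right_distrib sum.distrib)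
  show "\<T> g (ts c f) = ts c (\<T> g f)" for c
    by (rule poly_mapping_eqI)
      (simp add: lookup_ts lookup_tensor_act[OF g f]
        lookup_tensor_act[OF g ts.subspace_scale[OF coeff_space_subspace f]]
        lin(3)[OF lookup_in_vectors[OF f]] M.scale_sum_right mult.commute)
qed

lemma tensor_act_mult:
  assumes g: "g \<in> carrier D" and h: "h \<in> carrier D" and f: "f \<in> coeff_space k"
  shows "\<T> (g \<otimes>\<^bsub>D\<^esub> h) f = \<T> g (\<T> h f)"
proof (rule poly_mapping_eqI)
  fix \<nu>
  let ?A = "cmat (\<theta> g)" and ?B = "cmat (\<theta> h)"
  have gh: "g \<otimes>\<^bsub>D\<^esub> h \<in> carrier D" using g h by simp
  have AB: "cmat (\<theta> (g \<otimes>\<^bsub>D\<^esub> h)) = ?A ** ?B" by (simp add: theta_hom[OF g h] W_mult cmat_mult)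
  note ling = linear_betweenD[OF M.op_linear[OF g]] and linh = linear_betweenD[OF M.op_linear[OF h]]
  have V: "lookup f \<mu> \<in> vectors M" for \<mu> by (rule lookup_in_vectors[OF f])
  have op: "M.op (g \<otimes>\<^bsub>D\<^esub> h) (lookup f \<mu>) = M.op g (M.op h (lookup f \<mu>))" for \<mu>
    by (rule M.op_mult[OF g h V])
  have "lookup (\<T> g (\<T> h f)) \<nu> = (\<Sum>\<kappa>\<in>monomials k. scal M (sym_coeff ?A \<nu> \<kappa>)
      (M.op g (\<Sum>\<mu>\<in>monomials k. scal M (sym_coeff ?B \<kappa> \<mu>) (M.op h (lookup f \<mu>)))))"
    by (simp add: lookup_tensor_act[OF g tensor_act_closed[OF h f]] lookup_tensor_act[OF h f])
  also have "\<dots> = (\<Sum>\<kappa>\<in>monomials k. \<Sum>\<mu>\<in>monomials k.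
      scal M (sym_coeff ?A \<nu> \<kappa> * sym_coeff ?B \<kappa> \<mu>) (M.op (g \<otimes>\<^bsub>D\<^esub> h) (lookup f \<mu>)))"
  proof (rule sum.cong[OF HOL.refl])
    fix \<kappa>
    have "M.op g (\<Sum>\<mu>\<in>monomials k. scal M (sym_coeff ?B \<kappa> \<mu>) (M.op h (lookup f \<mu>))) =
        (\<Sum>\<mu>\<in>monomials k. M.op g (scal M (sym_coeff ?B \<kappa> \<mu>) (M.op h (lookup f \<mu>))))"
      by (intro linear_between_sum[OF M.op_linear[OF g] M.vector_space_axioms M.vectors_subspace]
          M.subspace_scale[OF M.vectors_subspace] linh(1) V)
    then show "scal M (sym_coeff ?A \<nu> \<kappa>)
        (M.op g (\<Sum>\<mu>\<in>monomials k. scal M (sym_coeff ?B \<kappa> \<mu>) (M.op h (lookup f \<mu>)))) =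
      (\<Sum>\<mu>\<in>monomials k.
        scal M (sym_coeff ?A \<nu> \<kappa> * sym_coeff ?B \<kappa> \<mu>) (M.op (g \<otimes>\<^bsub>D\<^esub> h) (lookup f \<mu>)))"
      by (simp add: ling(3)[OF linh(1)[OF V]] M.scale_sum_right op)
  qed
  also have "\<dots> = (\<Sum>\<mu>\<in>monomials k. \<Sum>\<kappa>\<in>monomials k.
      scal M (sym_coeff ?A \<nu> \<kappa> * sym_coeff ?B \<kappa> \<mu>) (M.op (g \<otimes>\<^bsub>D\<^esub> h) (lookup f \<mu>)))"
    by (rule sum.swap)
  also have "\<dots> = lookup (\<T> (g \<otimes>\<^bsub>D\<^esub> h) f) \<nu>"
    unfolding lookup_tensor_act[OF gh f] AB
    by (intro sum.cong HOL.refl) (simp add: sym_coeff_mult M.scale_sum_left)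
  finally show "lookup (\<T> (g \<otimes>\<^bsub>D\<^esub> h) f) \<nu> = lookup (\<T> g (\<T> h f)) \<nu>" ..
qed

lemma tensor_act_trivial:
  assumes g: "g \<in> carrier D" "\<theta> g = mat 1" and f: "f \<in> coeff_space k"
  shows "lookup (\<T> g f) \<nu> = M.op g (lookup f \<nu>)"
proof -
  have "lookup (\<T> g f) \<nu> = (\<Sum>\<mu>\<in>monomials k. if \<mu> = \<nu> then M.op g (lookup f \<nu>) else 0)"
    unfolding lookup_tensor_act[OF g(1) f] g(2) cmat_one sym_coeff_one by (intro sum.cong) auto
  then show ?thesis
    using f op_zero[OF g(1)] by (auto simp: coeff_space_def finite_monomials)
qed

lemma tensor_group_rep: "group_rep D ts (coeff_space k) \<T>"
proof -
  have "\<T> \<one>\<^bsub>D\<^esub> f = f" if f: "f \<in> coeff_space k" for f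
  proof (rule poly_mapping_eqI)
    have "\<theta> \<one>\<^bsub>D\<^esub> = mat 1" using \<theta>.hom_one by (simp add: W_one)
    then show "lookup (\<T> \<one>\<^bsub>D\<^esub> f) \<nu> = lookup f \<nu>" for \<nu>
      by (simp add: tensor_act_trivial[OF _ _ f] M.op_one[OF lookup_in_vectors[OF f]])
  qed
  then show ?thesis
    using tensor_act_linear tensor_act_mult by (simp add: group_rep_def)
qed

lemma tensor_act_z:
  assumes f: "f \<in> coeff_space k"
  shows "\<T> z f = - f"
  by (rule poly_mapping_eqI)
    (simp add: tensor_act_trivial[OF z_in_D theta_z f] op_z[OF lookup_in_vectors[OF f]])

text \<open>The representative of the coset that is used to define the action differs from \<open>f\<close> by an element
of the spin ideal, which acts as zero.\<close>

lemma spin_tensor_act: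
  assumes f: "f \<in> carrier CA" and y: "y \<in> coeff_space k"
  shows "act (spin_tensor \<Phi> \<alpha> m M k) (spin_ideal \<Phi> \<alpha> m +>\<^bsub>CA\<^esub> f) y =
    linear_extension ts (\<lambda>g. \<T> g y) f"
proof -
  interpret I: ideal "spin_ideal \<Phi> \<alpha> m" CA by (rule ideal_spin_ideal)
  define c where "c = (SOME c. c \<in> spin_ideal \<Phi> \<alpha> m +>\<^bsub>CA\<^esub> f)"
  have "f \<in> spin_ideal \<Phi> \<alpha> m +>\<^bsub>CA\<^esub> f" by (rule I.a_rcos_self[OF f])
  then have "c \<in> spin_ideal \<Phi> \<alpha> m +>\<^bsub>CA\<^esub> f" 
    unfolding c_def by (rule someI[of "\<lambda>c. c \<in> M.coset f"])
  then obtain i where i: "i \<in> spin_ideal \<Phi> \<alpha> m" "c = i \<oplus>\<^bsub>CA\<^esub> f"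
    by (auto simp: a_r_coset_def' )
  have fin: "finite (support i)" "finite (support f)"
    using I.a_Hcarr[OF i(1)] f by (simp_all add: D.alg_carrier)
  have "act (spin_tensor \<Phi> \<alpha> m M k) (spin_ideal \<Phi> \<alpha> m +>\<^bsub>CA\<^esub> f) y =
      linear_extension ts (\<lambda>g. \<T> g y) c"
    by (simp add: spin_tensor_def c_def[symmetric] Let_def linear_extension_def support_def)
  also have "\<dots> = linear_extension ts (\<lambda>g. \<T> g y) i + linear_extension ts (\<lambda>g. \<T> g y) f"
    unfolding i(2) D.alg_add by (rule ts.linear_extension_add[OF fin])
  also have "linear_extension ts (\<lambda>g. \<T> g y) i = 0"
    by (rule spin_ideal_acts_by_zero[OF tensor_group_rep vector_space_ts coeff_space_subspace
          tensor_act_z i(1) y])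
  finally show ?thesis by simp
qed

lemma tensor_frame:
  assumes F: "frame (scal M) (vectors M) J e c"
  shows "frame ts (coeff_space k) (J \<times> monomials k)
    (\<lambda>(j, \<mu>). single \<mu> (e j)) (\<lambda>(j, \<mu>) f. c j (lookup f \<mu>))"
proof -
  have fin: "finite (J \<times> (monomials k :: ('n \<Rightarrow>\<^sub>0 nat) set))"
    by (rule finite_cartesian_product[OF frameD(3)[OF F] finite_monomials])
  have e: "single \<mu> (e j) \<in> coeff_space k" if "j \<in> J" "\<mu> \<in> monomials k" for j \<mu>
    using frameD(4)[OF F that(1)] that(2) M.subspace_0[OF M.vectors_subspace]
    by (auto simp: coeff_space_def lookup_single when_def)
  have lin: "linear_between ts (coeff_space k) (*) UNIV (\<lambda>f. c j (lookup f \<mu>))" if "j \<in> J" for j \<mu>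
    using linear_betweenD(2,3)[OF frameD(5)[OF F that]] lookup_in_vectors
    by (auto simp: lookup_add lookup_ts intro!: linear_betweenI)
  have expand: "(\<Sum>p\<in>J \<times> monomials k. ts ((case p of (j, \<mu>) \<Rightarrow> \<lambda>f. c j (lookup f \<mu>)) f)
      (case p of (j, \<mu>) \<Rightarrow> single \<mu> (e j))) = f" if f: "f \<in> coeff_space k" for f
  proof (rule poly_mapping_eqI)
    fix \<nu>
    have "lookup (\<Sum>p\<in>J \<times> monomials k. ts ((case p of (j, \<mu>) \<Rightarrow> \<lambda>f. c j (lookup f \<mu>)) f)
        (case p of (j, \<mu>) \<Rightarrow> single \<mu> (e j))) \<nu> =
        (\<Sum>j\<in>J. \<Sum>\<mu>\<in>monomials k. scal M (c j (lookup f \<mu>)) (lookup (single \<mu> (e j)) \<nu>))"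
      unfolding lookup_sum lookup_ts sum.cartesian_product
      by (intro sum.cong) (auto simp: lookup_ts)
    also have "\<dots> = (\<Sum>j\<in>J. if \<nu> \<in> monomials k then scal M (c j (lookup f \<nu>)) (e j) else 0)"
    proof (rule sum.cong[OF HOL.refl])
      fix j
      have "(\<Sum>\<mu>\<in>monomials k. scal M (c j (lookup f \<mu>)) (lookup (single \<mu> (e j)) \<nu>)) =
          (\<Sum>\<mu>\<in>monomials k. if \<mu> = \<nu> then scal M (c j (lookup f \<nu>)) (e j) else 0)"
        by (intro sum.cong) (auto simp: lookup_single when_def)
      then show "(\<Sum>\<mu>\<in>monomials k. scal M (c j (lookup f \<mu>)) (lookup (single \<mu> (e j)) \<nu>)) =
          (if \<nu> \<in> monomials k then scal M (c j (lookup f \<nu>)) (e j) else 0)"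
        by (simp add: finite_monomials)
    qed
    also have "\<dots> = lookup f \<nu>"
      using frameD(6)[OF F lookup_in_vectors[OF f]] f
      by (cases "\<nu> \<in> monomials k") (simp_all add: coeff_space_def)
    finally show "lookup (\<Sum>p\<in>J \<times> monomials k. ts ((case p of (j, \<mu>) \<Rightarrow> \<lambda>f. c j (lookup f \<mu>)) f)
        (case p of (j, \<mu>) \<Rightarrow> single \<mu> (e j))) \<nu> = lookup f \<nu>" .
  qed
  show ?thesis
    unfolding frame_def using vector_space_ts coeff_space_subspace fin e lin expand by auto
qed

lemma tensor_trace:
  assumes F: "frame (scal M) (vectors M) J e c" and g: "g \<in> carrier D"
  shows "frame_trace (J \<times> monomials k) (\<lambda>(j, \<mu>). single \<mu> (e j)) (\<lambda>(j, \<mu>) f. c j (lookup f \<mu>)) (\<T> g) =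
    frame_trace J e c (M.op g) * sym_trace k (cmat (\<theta> g))"
proof -
  have "c j (lookup (\<T> g (single \<mu> (e j))) \<mu>) = c j (M.op g (e j)) * sym_coeff (cmat (\<theta> g)) \<mu> \<mu>"
    if j: "j \<in> J" and \<mu>: "\<mu> \<in> monomials k" for j \<mu>
  proof -
    have s: "single \<mu> (e j) \<in> coeff_space k"
      using frameD(4)[OF tensor_frame[OF F], of "(j, \<mu>)"] j \<mu> by simp
    have "lookup (\<T> g (single \<mu> (e j))) \<mu> =
        (\<Sum>\<kappa>\<in>monomials k. if \<kappa> = \<mu> then scal M (sym_coeff (cmat (\<theta> g)) \<mu> \<mu>) (M.op g (e j)) else 0)"
      unfolding lookup_tensor_act[OF g s]
      by (intro sum.cong) (auto simp: lookup_single when_def op_zero[OF g])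
    then have "lookup (\<T> g (single \<mu> (e j))) \<mu> = scal M (sym_coeff (cmat (\<theta> g)) \<mu> \<mu>) (M.op g (e j))"
      using \<mu> by (simp add: finite_monomials)
    then show ?thesis
      using linear_betweenD(3)[OF frameD(5)[OF F j] linear_betweenD(1)[OF M.op_linear[OF g] frameD(4)[OF F j]]]
      by simp
  qed
  then show ?thesis
    unfolding frame_trace_def sym_trace_def sum_product sum.cartesian_product
    by (intro sum.cong) auto
qed

end


section \<open>The graded multiplicity\<close>

context weyl_cover
begin

text \<open>Powers in the group are turned into iterates of the complexified matrix, the form in which finite
order enters Molien's formula.\<close>

lemma W_power_action: "((*v) (cmat x) ^^ k) v = cmat (x [^]\<^bsub>W\<^esub> k) *v v"
proof (induction k arbitrary: v)
  case 0
  show ?case by (simp add: W_one cmat_def mat_def matrix_vector_mult_def vec_eq_iff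
        if_distrib if_distribR cong: if_cong)
next
  case (Suc k)
  have "((*v) (cmat x) ^^ Suc k) v = ((*v) (cmat x) ^^ k) (cmat x *v v)"
    by (simp only: funpow_Suc_right o_apply)
  then show ?case by (simp add: Suc W_mult cmat_mult matrix_vector_mul_assoc)
qed

lemma molien_W:
  assumes x: "x \<in> carrier W"
  shows "char_det (cmat x) * Abs_fps (\<lambda>k. sym_trace k (cmat x)) = 1"
proof (rule molien_finite_order)
  show "0 < order W" using finite_W by (simp add: W.order_gt_0_iff_finite)
  show "((*v) (cmat x) ^^ order W) v = v" for v
    using W_power_action[where k = 0 and x = x and v = v] by (simp add: W_power_action W.pow_order_eq_1[OF x])
qed

text \<open>The inverse of \<open>\<theta> g\<close> is its transpose, and \<open>det(1 - tx)\<close>, which is invariant under transposition,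
determines all the traces.\<close>

lemma sym_trace_inverse:
  assumes "g \<in> carrier D"
  shows "sym_trace k (cmat (\<theta> (inv\<^bsub>D\<^esub> g))) = sym_trace k (cmat (\<theta> g))"
proof -
  note x = theta_in_W[OF assms]
  have inv: "\<theta> (inv\<^bsub>D\<^esub> g) = transpose (\<theta> g)" using assms by (simp add: W_inv[OF x])
  have "char_det (cmat (\<theta> g)) * Abs_fps (\<lambda>k. sym_trace k (cmat (\<theta> (inv\<^bsub>D\<^esub> g)))) = 1"
    using molien_W[OF theta_in_W[OF D.inv_closed[OF assms]]]
    by (simp add: inv cmat_transpose char_det_transpose)
  then have "Abs_fps (\<lambda>k. sym_trace k (cmat (\<theta> (inv\<^bsub>D\<^esub> g)))) = Abs_fps (\<lambda>k. sym_trace k (cmat (\<theta> g)))"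
    using molien_W[OF x] fps_inverse_unique by metis
  from arg_cong[OF this, of "\<lambda>f. fps_nth f k"] show ?thesis by simp
qed

lemma sym_trace_conj:
  assumes g: "g \<in> carrier D" and k: "k \<in> carrier D"
  shows "sym_trace i (cmat (\<theta> (k \<otimes>\<^bsub>D\<^esub> g \<otimes>\<^bsub>D\<^esub> inv\<^bsub>D\<^esub> k))) = sym_trace i (cmat (\<theta> g))"
proof -
  have "sym_trace i (cmat (\<theta> (k \<otimes>\<^bsub>D\<^esub> g \<otimes>\<^bsub>D\<^esub> inv\<^bsub>D\<^esub> k))) =
      sym_trace i (cmat (\<theta> (inv\<^bsub>D\<^esub> k)) ** cmat (\<theta> (k \<otimes>\<^bsub>D\<^esub> g)))"
    using g k by (subst sym_trace_commute) (simp add: theta_hom W_mult cmat_mult)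
  also have "cmat (\<theta> (inv\<^bsub>D\<^esub> k)) ** cmat (\<theta> (k \<otimes>\<^bsub>D\<^esub> g)) = cmat (\<theta> (inv\<^bsub>D\<^esub> k \<otimes>\<^bsub>D\<^esub> (k \<otimes>\<^bsub>D\<^esub> g)))"
    using g k theta_hom[of "inv\<^bsub>D\<^esub> k" "k \<otimes>\<^bsub>D\<^esub> g"] by (simp add: W_mult cmat_mult)
  also have "inv\<^bsub>D\<^esub> k \<otimes>\<^bsub>D\<^esub> (k \<otimes>\<^bsub>D\<^esub> g) = g" using g k by (simp add: D.m_assoc[symmetric])
  finally show ?thesis .
qed

lemma fps_const_div_det:
  assumes "x \<in> carrier W"
  shows "fps_const a / det_one_minus_t x = fps_const a * Abs_fps (\<lambda>k. sym_trace k (cmat x))"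
proof -
  let ?G = "Abs_fps (\<lambda>k. sym_trace k (cmat x))"
  have eq: "det_one_minus_t x * ?G = 1" using molien_W[OF assms] by (simp add: det_one_minus_t_eq)
  then have "fps_nth (det_one_minus_t x) 0 * fps_nth ?G 0 = 1"
    by (metis fps_mult_nth_0 fps_one_nth)
  then have "fps_nth (det_one_minus_t x) 0 \<noteq> 0" by auto
  then show ?thesis using fps_inverse_unique[OF eq] by (simp add: fps_divide_unit)
qed

end

locale spin_molien = spin: basic_spin \<Phi> \<alpha> m B + simple: spin_module \<Phi> \<alpha> m M
  for \<Phi> :: "(real^'n::finite) set" and \<alpha> :: "'n \<Rightarrow> real^'n" and m :: "'n \<Rightarrow> 'n \<Rightarrow> nat"
    and B :: "('n spin_elt, 'b::ab_group_add) supermod"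
    and M :: "('n spin_elt, 'm::ab_group_add) supermod" +
  assumes simple_M: "simple_supermodule (spin_algebra \<Phi> \<alpha> m) M"
begin

lemma hom_dim_eq:
  assumes FM: "frame (scal M) (vectors M) I e c" and FB: "frame (scal B) (vectors B) J e' c'"
  shows "of_nat (hom_dim (spin_algebra \<Phi> \<alpha> m) M (spin_tensor \<Phi> \<alpha> m B k)) =
    (\<Sum>g\<in>carrier spin.D. frame_trace I e c (simple.M.op (inv\<^bsub>spin.D\<^esub> g)) *
      (frame_trace J e' c' (spin.M.op g) * sym_trace k (cmat (spin.\<theta> g))))
    / of_nat (card (carrier spin.D))"
proof -
  let ?N = "spin_tensor \<Phi> \<alpha> m B k"
  have "hom_space (spin_algebra \<Phi> \<alpha> m) M ?N =
      intertwiners spin.D (scal M) (vectors M) simple.M.op spin.ts (spin.coeff_space k) spin.\<T>"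
    unfolding spin.spin_algebra_eq
    using simple.M.hom_space_eq_intertwiners[of ?N spin.\<T>] spin.vector_space_ts
      spin.coeff_space_subspace spin.spin_tensor_act spin.tensor_act_closed
    by (simp add: spin.spin_tensor_simps spin.spin_tensor_vectors)
  then have "hom_dim (spin_algebra \<Phi> \<alpha> m) M ?N = vector_space.dim (\<lambda>c f x. spin.ts c (f x))
      (intertwiners spin.D (scal M) (vectors M) simple.M.op spin.ts (spin.coeff_space k) spin.\<T>)"
    by (simp add: hom_dim_def spin.spin_tensor_simps)
  then show ?thesis
    using dim_intertwiners[OF spin.D.group_axioms spin.finite_D FM spin.tensor_frame[OF FB, where k = k]
        simple.M.op_group_rep spin.tensor_group_rep[where k = k]]
    by (simp add: spin.tensor_trace[OF FB])
qed

text \<open>Schur orthogonality produces \<open>\<psi>\<close> at \<open>g\<^sup>-\<^sup>1\<close>. The substitution of \<open>g\<^sup>-\<^sup>1\<close> for \<open>g\<close> shifts the inverse to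
\<open>\<beta>\<close> and \<open>h\<close>, where it has no effect as soon as \<open>\<psi> g\<close> is nonzero.\<close>

lemma multiplicity_coefficient:
  assumes lift: "\<And>C. C \<in> even_split_classes \<Phi> \<alpha> m \<Longrightarrow> lift C \<in> carrier spin.D \<and> spin.\<theta> (lift C) \<in> C"
  shows "of_nat (hom_dim (spin_algebra \<Phi> \<alpha> m) M (spin_tensor \<Phi> \<alpha> m B k)) =
    (\<Sum>C\<in>even_split_classes \<Phi> \<alpha> m.
      spin_character \<Phi> \<alpha> m M (lift C) * spin_character \<Phi> \<alpha> m B (lift C)
        * sym_trace k (cmat (spin.\<theta> (lift C)))
        / of_nat (card (centralizer spin.W (spin.\<theta> (lift C)))))"
proof -
  have simple: "simple_supermodule simple.M.Q M" using simple_M by (simp add: spin.spin_algebra_eq)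
  obtain I where FM: "frame (scal M) (vectors M) I (\<lambda>b. b) (\<lambda>b x. simple.M.representation I x b)"
    using simple.M.simple_finite_frame[OF simple spin.finite_D] by blast
  obtain J where FB: "frame (scal B) (vectors B) J (\<lambda>b. b) (\<lambda>b x. spin.M.representation J x b)"
    using spin.basic_spin_frame by blast
  define \<psi> where "\<psi> g = frame_trace I (\<lambda>b. b) (\<lambda>b x. simple.M.representation I x b) (simple.M.op g)" for g
  define \<beta> where "\<beta> g = frame_trace J (\<lambda>b. b) (\<lambda>b x. spin.M.representation J x b) (spin.M.op g)" for g
  define h where "h g = sym_trace k (cmat (spin.\<theta> g))" for g
  let ?D = "spin.D"
  have \<psi>_odd: "\<psi> g = 0" if "g \<in> carrier ?D" "spin.cover_parity g \<noteq> 0" for g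
    unfolding \<psi>_def using that by (intro simple.M.frame_trace_odd[OF FM]) auto
  have h_inv: "h (inv\<^bsub>?D\<^esub> g) = h g" if "g \<in> carrier ?D" for g
    unfolding h_def by (rule spin.sym_trace_inverse[OF that])
  have "of_nat (hom_dim (spin_algebra \<Phi> \<alpha> m) M (spin_tensor \<Phi> \<alpha> m B k)) =
      (\<Sum>g\<in>carrier ?D. \<psi> (inv\<^bsub>?D\<^esub> g) * (\<beta> g * h g)) / of_nat (card (carrier ?D))"
    unfolding \<psi>_def \<beta>_def h_def by (rule hom_dim_eq[OF FM FB])
  also have "(\<Sum>g\<in>carrier ?D. \<psi> (inv\<^bsub>?D\<^esub> g) * (\<beta> g * h g)) =
      (\<Sum>g\<in>carrier ?D. \<psi> g * (\<beta> (inv\<^bsub>?D\<^esub> g) * h (inv\<^bsub>?D\<^esub> g)))"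
    by (rule sum.reindex_bij_witness[of _ "\<lambda>g. inv\<^bsub>?D\<^esub> g" "\<lambda>g. inv\<^bsub>?D\<^esub> g"]) auto
  also have "\<dots> = (\<Sum>g\<in>carrier ?D. \<psi> g * \<beta> g * h g)"
  proof (rule sum.cong[OF HOL.refl])
    fix g assume g: "g \<in> carrier ?D"
    show "\<psi> g * (\<beta> (inv\<^bsub>?D\<^esub> g) * h (inv\<^bsub>?D\<^esub> g)) = \<psi> g * \<beta> g * h g"
    proof (cases "spin.cover_parity g = 0")
      case True
      then have "\<beta> (inv\<^bsub>?D\<^esub> g) = \<beta> g"
        unfolding \<beta>_def by (rule spin.basic_spin_trace_inverse[OF FB g])
      then show ?thesis by (simp add: h_inv[OF g])
    next
      case False
      then show ?thesis by (simp add: \<psi>_odd[OF g])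
    qed
  qed
  also have "\<dots> / of_nat (card (carrier ?D)) = (\<Sum>C\<in>even_split_classes \<Phi> \<alpha> m.
      \<psi> (lift C) * \<beta> (lift C) * h (lift C) / of_nat (card (centralizer spin.W (spin.\<theta> (lift C)))))"
  proof (rule spin.sum_over_double_cover[OF _ _ _ _ _ lift])
    show "cover_z m \<noteq> \<one>\<^bsub>?D\<^esub>"
      using simple_M by (intro simple.z_neq_one) (simp add: simple_supermodule_def)
    fix g assume g: "g \<in> carrier ?D"
    show "\<psi> (k \<otimes>\<^bsub>?D\<^esub> g \<otimes>\<^bsub>?D\<^esub> inv\<^bsub>?D\<^esub> k) * \<beta> (k \<otimes>\<^bsub>?D\<^esub> g \<otimes>\<^bsub>?D\<^esub> inv\<^bsub>?D\<^esub> k)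
        * h (k \<otimes>\<^bsub>?D\<^esub> g \<otimes>\<^bsub>?D\<^esub> inv\<^bsub>?D\<^esub> k) = \<psi> g * \<beta> g * h g" if k: "k \<in> carrier ?D" for k
      unfolding \<psi>_def \<beta>_def h_def
      by (simp add: frame_trace_conj[OF FM simple.M.op_group_rep spin.D.group_axioms g k]
          frame_trace_conj[OF FB spin.M.op_group_rep spin.D.group_axioms g k] spin.sym_trace_conj[OF g k])
    have "spin.\<theta> (cover_z m \<otimes>\<^bsub>?D\<^esub> g) = spin.\<theta> g"
      using spin.theta_eq_iff[of "cover_z m \<otimes>\<^bsub>?D\<^esub> g" g] g spin.z_in_D by (simp add: spin.eq_mod_z_def)
    then show "\<psi> (cover_z m \<otimes>\<^bsub>?D\<^esub> g) * \<beta> (cover_z m \<otimes>\<^bsub>?D\<^esub> g) * h (cover_z m \<otimes>\<^bsub>?D\<^esub> g) = \<psi> g * \<beta> g * h g"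
      unfolding \<psi>_def \<beta>_def h_def
      by (simp add: simple.trace_z_mult[OF FM g] spin.trace_z_mult[OF FB g])
    show "\<psi> g * \<beta> g * h g = 0" if "spin.parity (spin.\<theta> g) \<noteq> 0"
      by (simp add: \<psi>_odd[OF g that])
    show "\<psi> g * \<beta> g * h g = 0" if "\<not> split_class \<Phi> \<alpha> m (conj_class spin.W (spin.\<theta> g))"
      unfolding \<psi>_def by (simp add: simple.trace_nonsplit[OF FM g that])
  qed
  also have "\<dots> = (\<Sum>C\<in>even_split_classes \<Phi> \<alpha> m.
      spin_character \<Phi> \<alpha> m M (lift C) * spin_character \<Phi> \<alpha> m B (lift C)
        * sym_trace k (cmat (spin.\<theta> (lift C)))
        / of_nat (card (centralizer spin.W (spin.\<theta> (lift C)))))"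
    unfolding \<psi>_def \<beta>_def h_def
    by (intro sum.cong HOL.refl) (simp add: simple.spin_character_eq[OF FM] spin.spin_character_eq[OF FB] lift)
  finally show ?thesis .
qed

end

theorem proposition3p2:
  fixes \<Phi> :: "(real^'n::finite) set"
    and \<alpha> :: "'n \<Rightarrow> real^'n"
    and m :: "'n \<Rightarrow> 'n \<Rightarrow> nat"
    and B :: "('n spin_elt, 'b::ab_group_add) supermod"
    and M :: "('n spin_elt, 'm::ab_group_add) supermod"
    and lift :: "(real^'n^'n) set \<Rightarrow> 'n cover_elt"
  assumes "weyl_datum \<Phi> \<alpha> m"
    and "basic_spin_module \<Phi> \<alpha> m B"
    and "simple_supermodule (spin_algebra \<Phi> \<alpha> m) M"
    and "\<And>C. C \<in> even_split_classes \<Phi> \<alpha> m \<Longrightarrow>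
           lift C \<in> carrier (double_cover m) \<and> theta \<Phi> \<alpha> (lift C) \<in> C"
  shows "graded_multiplicity \<Phi> \<alpha> m M B =
    (\<Sum>C\<in>even_split_classes \<Phi> \<alpha> m.
       fps_const (spin_character \<Phi> \<alpha> m M (lift C) * spin_character \<Phi> \<alpha> m B (lift C)
                  / of_nat (card (centralizer (weyl_group \<Phi>) (theta \<Phi> \<alpha> (lift C)))))
       / det_one_minus_t (theta \<Phi> \<alpha> (lift C)))"
proof -
  have "weyl_cover \<Phi> \<alpha> m" using assms(1) by (rule weyl_cover.intro)
  moreover have "supermodule (spin_algebra \<Phi> \<alpha> m) M"
    using assms(3) by (simp add: simple_supermodule_def)
  ultimately interpret spin_molien \<Phi> \<alpha> m B M
    by (intro spin_molien.intro basic_spin.intro spin_module.intro basic_spin_axioms.intro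
        spin_module_axioms.intro spin_molien_axioms.intro assms(2,3))
  show ?thesis
  proof (rule fps_ext)
    fix k
    have "fps_nth (graded_multiplicity \<Phi> \<alpha> m M B) k =
        of_nat (hom_dim (spin_algebra \<Phi> \<alpha> m) M (spin_tensor \<Phi> \<alpha> m B k))"
      by (simp add: graded_multiplicity_def)
    also have "\<dots> = (\<Sum>C\<in>even_split_classes \<Phi> \<alpha> m.
        spin_character \<Phi> \<alpha> m M (lift C) * spin_character \<Phi> \<alpha> m B (lift C)
          * sym_trace k (cmat (theta \<Phi> \<alpha> (lift C)))
          / of_nat (card (centralizer (weyl_group \<Phi>) (theta \<Phi> \<alpha> (lift C)))))"
      by (rule multiplicity_coefficient[OF assms(4)])
    also have "\<dots> = (\<Sum>C\<in>even_split_classes \<Phi> \<alpha> m. fps_nth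
       (fps_const (spin_character \<Phi> \<alpha> m M (lift C) * spin_character \<Phi> \<alpha> m B (lift C)
                  / of_nat (card (centralizer (weyl_group \<Phi>) (theta \<Phi> \<alpha> (lift C)))))
       / det_one_minus_t (theta \<Phi> \<alpha> (lift C))) k)"
      using assms(4)
      by (intro sum.cong HOL.refl) (simp add: spin.fps_const_div_det[OF spin.theta_in_W])
    finally show "fps_nth (graded_multiplicity \<Phi> \<alpha> m M B) k =
      fps_nth (\<Sum>C\<in>even_split_classes \<Phi> \<alpha> m.
       fps_const (spin_character \<Phi> \<alpha> m M (lift C) * spin_character \<Phi> \<alpha> m B (lift C)
                  / of_nat (card (centralizer (weyl_group \<Phi>) (theta \<Phi> \<alpha> (lift C)))))
       / det_one_minus_t (theta \<Phi> \<alpha> (lift C))) k"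
      by (simp add: fps_sum_nth)
  qed
qed

end
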